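(* Let $\mathscr{H}=\ell\boxtimes\mathcal{H}$ be a homogeneous convex pre-foliation of co-degree $1$ and degree $d\geq 2$ on $\mathbb{P}^2_{\mathbb{C}}$. Then its dual web (Legendre transform) $\mathrm{Leg}\,\mathscr{H}$, a $d$-web on $\check{\mathbb{P}}^2_{\mathbb{C}}$, is flat.
   Context: Foliations and pre-foliations. A holomorphic foliation of degree $n$ on $\mathbb{P}^2_{\mathbb{C}}$ is given in homogeneous coordinates by a 1-form $\Omega_0=a\,dx+b\,dy+c\,dz$, with $a,b,c$ homogeneous of degree $n+1$ without common factor and $xa+yb+zc=0$. A pre-foliation of co-degree $1$ and degree $d$ (type $(1,d)$) on $\mathbb{P}^2_{\mathbb{C}}$ is a pair, written $\ell\boxtimes\mathcal{F}$, of a line $\ell$ and a holomorphic foliation $\mathcal{F}$ of degree $d-1$. It is homogeneous if there is an affine chart $(x,y)$ in which it is invariant under all homotheties $(x,y)\mapsto\lambda(x,y)$, $\lambda\in\mathbb{C}^*$; then $\ell$ passes through the origin $O$ or is the line at infinity $L_\infty$, and $\mathcal{F}$ is defined by $A\,dx+B\,dy$ with $A,B\in\mathbb{C}[x,y]_{d-1}$ coprime. Convexity. A foliation on $\mathbb{P}^2_{\mathbb{C}}$ is convex if its leaves other than straight lines have no inflection points. A pre-foliation $\ell\boxtimes\mathcal{F}$ is convex if $\mathcal{F}$ is convex and $\ell$ is invariant by $\mathcal{F}$. Legendre transform. If $\ell\boxtimes\mathcal F$ is given in an affine chart by $f(x,y)(A\,dx+B\,dy)$ ($f=0$ being an equation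 of $\ell$), then in the affine chart $(p,q)$ of $\check{\mathbb{P}}^2_{\mathbb{C}}$ associated to the line $\{y=px-q\}$, $\mathrm{Leg}(\ell\boxtimes\mathcal F)$ is the $d$-web given by $f(x,px-q)\big(A(x,px-q)+pB(x,px-q)\big)=0$ with $x=dq/dp$. Equivalently $\mathrm{Leg}(\ell\boxtimes\mathcal F)=\mathrm{Leg}\,\ell\boxtimes\mathrm{Leg}\,\mathcal F$, where $\mathrm{Leg}\,\ell$ is the pencil of lines through the point $\check\ell$ dual to $\ell$ (for $\ell=L_\infty$ it is $dp=0$), and the tangents of $\mathrm{Leg}\,\mathcal F$ at a generic $L\in\check{\mathbb{P}}^2_{\mathbb{C}}$ are the lines dual to the tangency points of $L$ with $\mathcal F$. Curvature. At a generic point a $d$-web is a superposition $\mathcal F_1\boxtimes\cdots\boxtimes\mathcal F_d$ of $d$ pairwise transverse foliations, $\mathcal F_i:\omega_i=0$. Put $\omega_i\wedge\omega_j=\delta_{ij}\,dx\wedge dy$. For $r<s<t$ let $\eta_{rst}$ be the unique meromorphic 1-form with $d(\delta_{st}\omega_r)=\eta_{rst}\wedge\delta_{st}\omega_r$, $d(\delta_{tr}\omega_s)=\eta_{rst}\wedge\delta_{tr}\omega_s$, $d(\delta_{rs}\omega_t)=\eta_{rst}\wedge\delta_{rs}\omega_t$. The curvature $K(\mathcal W)=d\big(\sum_{r<s<t}\eta_{rst}\big)$ is a well-defined global meromorphic 2-form (zero if $d\le 2$); $\mathcal W$ is flat if $K(\mathcal W)\equiv0$. *)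

theory Defs
  imports
    "HOL-Complex_Analysis.Complex_Analysis"
    "HOL-Computational_Algebra.Computational_Algebra"
begin

section \<open>Foliations and pre-foliations on the complex projective plane\<close>

text \<open>
  A polynomial in \<open>x, y, z\<close> is an element of \<open>\<complex>[x][y][z]\<close>; the outermost \<open>poly\<close> is the
  one in \<open>z\<close>.  Points of the plane are represented by non-zero vectors \<open>m = (x, y, z)\<close>, and the
  homogeneous 1-form \<open>a dx + b dy + c dz\<close> by the vector \<open>(a, b, c)\<close>.
\<close>

type_synonym poly3 = "complex poly poly poly"
type_synonym form3 = "poly3 ^ 3"

definition homogeneous_poly3 :: "nat \<Rightarrow> poly3 \<Rightarrow> bool" where
  "homogeneous_poly3 n P \<longleftrightarrow>
     (\<forall>i j k. coeff (coeff (coeff P k) j) i \<noteq> 0 \<longrightarrow> i + j + k = n)"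

definition eval3 :: "poly3 \<Rightarrow> complex ^ 3 \<Rightarrow> complex" where
  "eval3 P m = poly (poly (poly P [:[:m $ 3:]:]) [:m $ 2:]) (m $ 1)"

definition form_at :: "form3 \<Rightarrow> complex ^ 3 \<Rightarrow> complex ^ 3" where
  "form_at \<Omega> m = (\<chi> i. eval3 (\<Omega> $ i) m)"

text \<open>The complex bilinear pairing (the library's inner product on \<open>complex ^ 3\<close> is the real one).\<close>

definition cdot :: "complex ^ 3 \<Rightarrow> complex ^ 3 \<Rightarrow> complex" where
  "cdot u v = (\<Sum>i\<in>UNIV. u $ i * v $ i)"

definition foliation :: "nat \<Rightarrow> form3 \<Rightarrow> bool" where
  "foliation n \<Omega> \<longleftrightarrow>
     (\<forall>i. homogeneous_poly3 (n + 1) (\<Omega> $ i)) \<and>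
     (\<forall>h. (\<forall>i. h dvd \<Omega> $ i) \<longrightarrow> is_unit h) \<and>
     [:[:[:0, 1:]:]:] * \<Omega> $ 1 + [:[:0, 1:]:] * \<Omega> $ 2 + [:0, 1:] * \<Omega> $ 3 = 0"

text \<open>The line attached to \<open>u\<close> consists of the points \<open>m\<close> with \<open>cdot u m = 0\<close>.\<close>

definition prefoliation :: "nat \<Rightarrow> complex ^ 3 \<Rightarrow> form3 \<Rightarrow> bool" where
  "prefoliation d u \<Omega> \<longleftrightarrow> 1 \<le> d \<and> u \<noteq> 0 \<and> foliation (d - 1) \<Omega>"


section \<open>Homogeneity\<close>

definition line_preserved :: "complex ^ 3 ^ 3 \<Rightarrow> complex ^ 3 \<Rightarrow> bool" where
  "line_preserved N u \<longleftrightarrow> (\<forall>m. cdot u (N *v m) = 0 \<longleftrightarrow> cdot u m = 0)"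

text \<open>A foliation determines its 1-form up to a non-zero constant; the left-hand side below is the
  pull-back of \<open>\<Omega>\<close> by \<open>N\<close>, at the point \<open>m\<close>, applied to the vector \<open>v\<close>.\<close>

definition foliation_preserved :: "complex ^ 3 ^ 3 \<Rightarrow> form3 \<Rightarrow> bool" where
  "foliation_preserved N \<Omega> \<longleftrightarrow>
     (\<exists>c. c \<noteq> 0 \<and>
       (\<forall>m v. cdot (form_at \<Omega> (N *v m)) (N *v v) = c * cdot (form_at \<Omega> m) v))"

definition homothety :: "complex \<Rightarrow> complex ^ 3 ^ 3" where
  "homothety \<mu> = (\<chi> i j. if i = j then (if i = 3 then 1 else \<mu>) else 0)"

text \<open>An affine chart is given by an invertible matrix \<open>M\<close>: the point with affine coordinates
  \<open>(x, y)\<close> is the class of \<open>M (x, y, 1)\<close>.\<close>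

definition homogeneous_prefoliation :: "complex ^ 3 \<Rightarrow> form3 \<Rightarrow> bool" where
  "homogeneous_prefoliation u \<Omega> \<longleftrightarrow>
     (\<exists>M. invertible M \<and>
       (\<forall>\<mu>. \<mu> \<noteq> 0 \<longrightarrow>
         line_preserved (M ** homothety \<mu> ** matrix_inv M) u \<and>
         foliation_preserved (M ** homothety \<mu> ** matrix_inv M) \<Omega>))"


section \<open>Convexity\<close>

definition curve_deriv :: "(complex \<Rightarrow> complex ^ 3) \<Rightarrow> complex \<Rightarrow> complex ^ 3" where
  "curve_deriv \<gamma> t = (\<chi> i. deriv (\<lambda>s. \<gamma> s $ i) t)"

text \<open>
  A parametrized piece of a leaf: \<open>\<gamma>\<close> lifts to \<open>\<complex>\<^sup>3\<close> a holomorphic immersion into the plane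
  which avoids the singular points of the foliation and is tangent to it.  By analytic continuation
  a leaf is a straight line as soon as one such piece of it is contained in a line.
\<close>

definition leaf_piece :: "form3 \<Rightarrow> complex set \<Rightarrow> (complex \<Rightarrow> complex ^ 3) \<Rightarrow> bool" where
  "leaf_piece \<Omega> S \<gamma> \<longleftrightarrow>
     open S \<and> connected S \<and> (\<forall>i. (\<lambda>t. \<gamma> t $ i) holomorphic_on S) \<and>
     (\<forall>t\<in>S. \<gamma> t \<noteq> 0 \<and> (\<forall>c. curve_deriv \<gamma> t \<noteq> c *s \<gamma> t) \<and>
            form_at \<Omega> (\<gamma> t) \<noteq> 0 \<and> cdot (form_at \<Omega> (\<gamma> t)) (curve_deriv \<gamma> t) = 0)"

text \<open>The tangent line at \<open>\<gamma> t\<close> is spanned by \<open>\<gamma> t\<close> and \<open>\<gamma>' t\<close>; it has contact of order at least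
  3 with the curve iff it also contains \<open>\<gamma>'' t\<close>.\<close>

definition inflection_point :: "(complex \<Rightarrow> complex ^ 3) \<Rightarrow> complex \<Rightarrow> bool" where
  "inflection_point \<gamma> t \<longleftrightarrow>
     det (vector [\<gamma> t, curve_deriv \<gamma> t, curve_deriv (curve_deriv \<gamma>) t] :: complex ^ 3 ^ 3) = 0"

definition convex_foliation :: "form3 \<Rightarrow> bool" where
  "convex_foliation \<Omega> \<longleftrightarrow>
     (\<forall>S \<gamma>. leaf_piece \<Omega> S \<gamma> \<and> \<not> (\<exists>u. u \<noteq> 0 \<and> (\<forall>t\<in>S. cdot u (\<gamma> t) = 0)) \<longrightarrow>
            (\<forall>t\<in>S. \<not> inflection_point \<gamma> t))"

definition invariant_line :: "complex ^ 3 \<Rightarrow> form3 \<Rightarrow> bool" where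
  "invariant_line u \<Omega> \<longleftrightarrow>
     (\<forall>m v. cdot u m = 0 \<longrightarrow> cdot u v = 0 \<longrightarrow> cdot (form_at \<Omega> m) v = 0)"

definition convex_prefoliation :: "complex ^ 3 \<Rightarrow> form3 \<Rightarrow> bool" where
  "convex_prefoliation u \<Omega> \<longleftrightarrow> convex_foliation \<Omega> \<and> invariant_line u \<Omega>"


section \<open>The Legendre transform\<close>

text \<open>
  A \<open>d\<close>-web on the affine plane with coordinates \<open>(p, q)\<close> is given by a form of degree \<open>d\<close> in
  \<open>(dp, dq)\<close> with coefficients depending on \<open>(p, q)\<close>; its arguments are the point and the
  tangent vector.
\<close>

type_synonym web = "complex \<times> complex \<Rightarrow> complex \<times> complex \<Rightarrow> complex"

text \<open>
  The polynomial \<open>f(x, px - q) (A(x, px - q) + p B(x, px - q))\<close> in \<open>x\<close>, where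
  \<open>f(x, y) = u\<^sub>1 x + u\<^sub>2 y + u\<^sub>3\<close>, \<open>A = a(x, y, 1)\<close> and \<open>B = b(x, y, 1)\<close>.
\<close>

definition legendre_poly :: "complex ^ 3 \<Rightarrow> form3 \<Rightarrow> complex \<Rightarrow> complex \<Rightarrow> complex poly" where
  "legendre_poly u \<Omega> p q =
     ([:0, u $ 1:] + smult (u $ 2) [:- q, p:] + [:u $ 3:]) *
     (poly (poly (\<Omega> $ 1) 1) [:- q, p:] + smult p (poly (poly (\<Omega> $ 2) 1) [:- q, p:]))"

text \<open>
  Putting \<open>x = dq/dp\<close> and clearing denominators.  The relation \<open>xa + yb + zc = 0\<close> makes
  \<open>A(x, px - q) + p B(x, px - q)\<close> of degree at most \<open>d - 1\<close> in \<open>x\<close>, so that no coefficient is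
  lost.  For the line at infinity \<open>f\<close> is constant and the missing degree becomes the factor \<open>dp\<close>.
\<close>

definition legendre :: "nat \<Rightarrow> complex ^ 3 \<Rightarrow> form3 \<Rightarrow> web" where
  "legendre d u \<Omega> = (\<lambda>(p, q) (dp, dq).
     \<Sum>i\<le>d. coeff (legendre_poly u \<Omega> p q) i * dq ^ i * dp ^ (d - i))"


section \<open>Webs and their curvature\<close>

text \<open>A 1-form \<open>\<alpha> dp + \<beta> dq\<close> is represented by \<open>(\<alpha>, \<beta>)\<close>, a 2-form by its coefficient with
  respect to \<open>dp \<and> dq\<close>.\<close>

type_synonym form1 = "complex \<times> complex \<Rightarrow> complex \<times> complex"

definition holomorphic2_on :: "(complex \<times> complex \<Rightarrow> complex) \<Rightarrow> (complex \<times> complex) set \<Rightarrow> bool" where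
  "holomorphic2_on f U \<longleftrightarrow>
     (\<forall>z\<in>U. \<exists>a b. (f has_derivative (\<lambda>(h, k). a * h + b * k)) (at z))"

definition holomorphic_form :: "form1 \<Rightarrow> (complex \<times> complex) set \<Rightarrow> bool" where
  "holomorphic_form \<omega> U \<longleftrightarrow>
     holomorphic2_on (\<lambda>z. fst (\<omega> z)) U \<and> holomorphic2_on (\<lambda>z. snd (\<omega> z)) U"

definition wedge :: "form1 \<Rightarrow> form1 \<Rightarrow> complex \<times> complex \<Rightarrow> complex" where
  "wedge \<omega> \<theta> z = fst (\<omega> z) * snd (\<theta> z) - snd (\<omega> z) * fst (\<theta> z)"

definition scale_form :: "(complex \<times> complex \<Rightarrow> complex) \<Rightarrow> form1 \<Rightarrow> form1" where
  "scale_form g \<omega> z = (g z * fst (\<omega> z), g z * snd (\<omega> z))"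

definition ext_deriv :: "form1 \<Rightarrow> complex \<times> complex \<Rightarrow> complex" where
  "ext_deriv \<omega> = (\<lambda>(p, q).
     deriv (\<lambda>s. snd (\<omega> (s, q))) p - deriv (\<lambda>s. fst (\<omega> (p, s))) q)"

text \<open>
  On the open set \<open>U\<close> the web is the superposition of the \<open>d\<close> pairwise transverse foliations
  \<open>\<omega> i = 0\<close>: at each point the zero directions of the form of degree \<open>d\<close> are exactly the \<open>d\<close>
  distinct directions \<open>ker (\<omega> i)\<close>.
\<close>

definition superposition :: "nat \<Rightarrow> web \<Rightarrow> (complex \<times> complex) set \<Rightarrow> (nat \<Rightarrow> form1) \<Rightarrow> bool" where
  "superposition d W U \<omega> \<longleftrightarrow>
     open U \<and> (\<forall>i<d. holomorphic_form (\<omega> i) U) \<and>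
     (\<forall>z\<in>U. \<forall>i<d. \<omega> i z \<noteq> 0) \<and>
     (\<forall>z\<in>U. \<forall>i<d. \<forall>j<d. i \<noteq> j \<longrightarrow> wedge (\<omega> i) (\<omega> j) z \<noteq> 0) \<and>
     (\<forall>z\<in>U. \<forall>v. W z v = 0 \<longleftrightarrow> (\<exists>i<d. fst (\<omega> i z) * fst v + snd (\<omega> i z) * snd v = 0))"

definition is_web :: "nat \<Rightarrow> web \<Rightarrow> bool" where
  "is_web d W \<longleftrightarrow> closure {z. \<exists>U \<omega>. z \<in> U \<and> superposition d W U \<omega>} = UNIV"

definition eta_form :: "(complex \<times> complex) set \<Rightarrow> form1 \<Rightarrow> form1 \<Rightarrow> form1 \<Rightarrow> form1 \<Rightarrow> bool" where
  "eta_form U \<omega>\<^sub>r \<omega>\<^sub>s \<omega>\<^sub>t \<eta> \<longleftrightarrow>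
     holomorphic_form \<eta> U \<and>
     (\<forall>z\<in>U.
        ext_deriv (scale_form (wedge \<omega>\<^sub>s \<omega>\<^sub>t) \<omega>\<^sub>r) z = wedge \<eta> (scale_form (wedge \<omega>\<^sub>s \<omega>\<^sub>t) \<omega>\<^sub>r) z \<and>
        ext_deriv (scale_form (wedge \<omega>\<^sub>t \<omega>\<^sub>r) \<omega>\<^sub>s) z = wedge \<eta> (scale_form (wedge \<omega>\<^sub>t \<omega>\<^sub>r) \<omega>\<^sub>s) z \<and>
        ext_deriv (scale_form (wedge \<omega>\<^sub>r \<omega>\<^sub>s) \<omega>\<^sub>t) z = wedge \<eta> (scale_form (wedge \<omega>\<^sub>r \<omega>\<^sub>s) \<omega>\<^sub>t) z)"

definition curvature :: "nat \<Rightarrow> (nat \<Rightarrow> nat \<Rightarrow> nat \<Rightarrow> form1) \<Rightarrow> complex \<times> complex \<Rightarrow> complex" where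
  "curvature d \<eta> = ext_deriv (\<lambda>z. \<Sum>(r, s, t) | r < s \<and> s < t \<and> t < d. \<eta> r s t z)"

text \<open>
  Transversality makes the forms \<open>\<eta> r s t\<close> unique on \<open>U\<close>, and the curvature does not depend on
  the choice of the \<open>\<omega> i\<close>.
\<close>

definition flat_web :: "nat \<Rightarrow> web \<Rightarrow> bool" where
  "flat_web d W \<longleftrightarrow>
     (\<forall>U \<omega> \<eta>. superposition d W U \<omega> \<longrightarrow>
        (\<forall>r s t. r < s \<and> s < t \<and> t < d \<longrightarrow> eta_form U (\<omega> r) (\<omega> s) (\<omega> t) (\<eta> r s t)) \<longrightarrow>
        (\<forall>z\<in>U. curvature d \<eta> z = 0))"

end

theory Submission
  imports Defs "HOL-Computational_Algebra.Field_as_Ring"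
begin

text \<open>
  In a suitable affine chart the foliation is \<open>A dx + B dy\<close> with \<open>A, B\<close> homogeneous of degree
  \<open>n = d - 1\<close> and \<open>x = 0\<close> invariant; with \<open>a(t) = A(1, t)\<close>, \<open>b(t) = B(1, t)\<close> the line
  \<open>y = P x - Q\<close> is tangent to it at the points of slope \<open>y / x = t\<close>, \<open>a(t) + P b(t) = 0\<close>.  Hence the dual
  web consists of the \<open>n\<close> foliations \<open>dQ / Q - dP / (P - t)\<close>, \<open>t\<close> a root, and of \<open>dQ\<close> or \<open>dP\<close>
  according to whether the line \<open>\<ell>\<close> is \<open>x = 0\<close> or the line at infinity.  Up to a closed form \<open>dF / F\<close>,
  every \<open>\<eta>\<^bsub>rst\<^esub>\<close> is \<open>\<alpha> dP + \<beta> dQ / Q\<close> with \<open>\<alpha>, \<beta>\<close> functions of \<open>P\<close> alone, so that the web is flat iff the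
  sum of the \<open>\<beta>\<close> is constant.  This sum is a symmetric function of the roots.  Convexity says that
  every critical point of the rational map \<open>t \<mapsto> - a / b\<close> is fixed, i.e. that the roots of the Wronskian
  \<open>a' b - a b'\<close> are roots of \<open>a + t b\<close>; this turns the sum into one of the form
  \<open>\<Sum> L(t) / (b(t) (a + P b)'(t))\<close> with a polynomial \<open>L\<close> of degree at most \<open>2 n - 2\<close>, which does
  not depend on \<open>P\<close> by the Euler--Jacobi formula.  All this holds off finitely many lines of the dual
  plane; the curvature is continuous, so that it vanishes everywhere.
\<close>

section \<open>Sums over the roots of a pencil of polynomials\<close>

text \<open>Write l = 1 / (P - t) for the slope of a dual foliation. The factors by which the forms
  of a superposition may be multiplied enter \<eta> only through F, so an arbitrary superposition is
  as good as a normalized one. For three slopes that depend on P alone, \<beta> is minus the second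
  divided difference of the derivatives l' with the slopes l as nodes; each summand carries the
  weight 1 + b / (a + P b)', which comes from implicit differentiation of the root. The obstacle is
  the second part of this weight: the sums over the other roots produce second and third derivatives
  divided by (a + P b)', and multiplication by the weight gives denominators with the square of (a +
  P b)', out of reach of Euler--Jacobi. At a root the Wronskian equals b (a + P b)', and a + t b
  equals (t - P) b; the divisibility relations that convexity forces on the Wronskian therefore
  trade one factor of the square for a polynomial numerator. The line x = 0 is made invariant
  because then deg b < deg a: degree and leading coefficient of a + P b do not vary with P.\<close>

definition root_poly :: "complex set \<Rightarrow> complex poly" where
  "root_poly S = (\<Prod>s\<in>S. [:- s, 1:])"

lemma root_poly_insert:
  assumes "finite S" "r \<notin> S"
  shows "root_poly (insert r S) = [:- r, 1:] * root_poly S"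
  using assms by (simp add: root_poly_def)

lemma degree_root_poly: "degree (root_poly S) = card S"
  unfolding root_poly_def by (subst degree_prod_eq_sum_degree) auto

lemma lead_coeff_root_poly: "lead_coeff (root_poly S) = 1"
  unfolding root_poly_def by (simp add: lead_coeff_prod)

lemma poly_root_poly_eq_0_iff: "finite S \<Longrightarrow> poly (root_poly S) x = 0 \<longleftrightarrow> x \<in> S"
  unfolding root_poly_def by (auto simp: poly_prod)

lemma pderiv_linear_mult:
  fixes q :: "complex poly"
  shows "pderiv ([:- r, 1:] * q) = q + [:- r, 1:] * pderiv q"
  by (simp only: pderiv_mult) (simp add: pderiv_pCons)

text \<open>Logarithmic differentiation: q' / q is the sum e of the 1 / (x - s), and q'' / q = e^2 +
  e', where e' is minus the sum of the squares.\<close>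

lemma poly_pderiv_root_poly:
  assumes "finite S" "x \<notin> S"
  shows "poly (pderiv (root_poly S)) x = poly (root_poly S) x * (\<Sum>s\<in>S. 1 / (x - s))" (is ?A)
    and "poly (pderiv (pderiv (root_poly S))) x =
      poly (root_poly S) x * ((\<Sum>s\<in>S. 1 / (x - s))\<^sup>2 - (\<Sum>s\<in>S. (1 / (x - s))\<^sup>2))" (is ?B)
proof -
  have "?A \<and> ?B"
    using assms
  proof (induction S rule: finite_induct)
    case empty
    then show ?case by (simp add: root_poly_def)
  next
    case (insert r S)
    define q where "q = root_poly S"
    have x: "x - r \<noteq> 0" using insert by auto
    note d1 = pderiv_linear_mult[of r q]
    have d2: "pderiv (pderiv ([:- r, 1:] * q)) = pderiv q + (pderiv q + [:- r, 1:] * pderiv (pderiv q))"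
      by (simp only: d1 pderiv_add pderiv_linear_mult)
    define e e2 where "e = (\<Sum>s\<in>S. 1 / (x - s))" and "e2 = (\<Sum>s\<in>S. (1 / (x - s))\<^sup>2)"
    have q: "poly (pderiv q) x = poly q x * e" "poly (pderiv (pderiv q)) x = poly q x * (e\<^sup>2 - e2)"
      using insert by (auto simp: q_def e_def e2_def)
    have "(x - r) * (1 / (x - r)) = 1" using x by simp
    then have "poly q x + (x - r) * (poly q x * e) = (x - r) * poly q x * (1 / (x - r) + e)"
      "2 * (poly q x * e) + (x - r) * (poly q x * (e\<^sup>2 - e2)) =
        (x - r) * poly q x * ((1 / (x - r) + e)\<^sup>2 - ((1 / (x - r))\<^sup>2 + e2))"
      by algebra+
    then show ?case
      unfolding root_poly_insert[OF insert.hyps] q_def[symmetric] d2 unfolding d1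
      using insert.hyps by (simp add: q e_def[symmetric] e2_def[symmetric] algebra_simps)
  qed
  then show ?A ?B by auto
qed

section \<open>Polynomials with simple roots only, and sums over their roots\<close>

locale split_poly =
  fixes T :: "complex poly" and R :: "complex set"
  assumes T0: "T \<noteq> 0" and R_def: "R = {t. poly T t = 0}" and cardR: "card R = degree T"
begin

lemma finR: "finite R" unfolding R_def using T0 by (rule poly_roots_finite)

lemma T_eq: "T = smult (lead_coeff T) (root_poly R)"
proof (rule poly_eqI_degree_lead_coeff[where A = R and n = "degree T"])
  show "coeff T (degree T) = coeff (smult (lead_coeff T) (root_poly R)) (degree T)"
    using lead_coeff_root_poly[of R] by (simp add: degree_root_poly cardR)
  show "degree (smult (lead_coeff T) (root_poly R)) \<le> degree T"
    by (simp add: degree_root_poly cardR)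
  show "poly T x = poly (smult (lead_coeff T) (root_poly R)) x" if "x \<in> R" for x
    using that poly_root_poly_eq_0_iff[OF finR, of x] by (simp add: R_def[symmetric]) (simp add: R_def)
qed (simp_all add: cardR)

context
  fixes r assumes r: "r \<in> R"
begin

lemma T_eq': "T = smult (lead_coeff T) ([:- r, 1:] * root_poly (R - {r}))"
  using T_eq root_poly_insert[of "R - {r}" r] finR r by (simp add: insert_absorb)

text \<open>Leibniz' rule for T = c (x - r) q: at r only the terms survive in which the linear
  factor is differentiated exactly once, hence the factors 1, 2, 3.\<close>

lemma poly_pderiv_T:
  "poly (pderiv T) r = lead_coeff T * poly (root_poly (R - {r})) r" (is ?A)
  "poly (pderiv (pderiv T)) r = lead_coeff T * (2 * poly (pderiv (root_poly (R - {r}))) r)" (is ?B)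
  "poly (pderiv (pderiv (pderiv T))) r =
    lead_coeff T * (3 * poly (pderiv (pderiv (root_poly (R - {r})))) r)" (is ?C)
proof -
  define c q where "c = lead_coeff T" and "q = root_poly (R - {r})"
  have T: "T = smult c ([:- r, 1:] * q)"
    unfolding c_def q_def by (rule T_eq')
  have "poly (pderiv T) r = c * poly q r"
    "poly (pderiv (pderiv T)) r = c * (2 * poly (pderiv q) r)"
    "poly (pderiv (pderiv (pderiv T))) r = c * (3 * poly (pderiv (pderiv q)) r)"
    by (simp_all only: T pderiv_smult pderiv_linear_mult pderiv_add) simp_all
  then show ?A ?B ?C unfolding c_def q_def by blast+
qed

lemma pderiv_T_nz: "poly (pderiv T) r \<noteq> 0"
  using T0 by (simp add: poly_pderiv_T poly_root_poly_eq_0_iff finR)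

lemma sum_inverse_root_diff:
  "(\<Sum>s\<in>R-{r}. 1 / (r - s)) = poly (pderiv (pderiv T)) r / (2 * poly (pderiv T) r)"
  using pderiv_T_nz by (simp add: poly_pderiv_T poly_pderiv_root_poly finR field_simps)

lemma sum_inverse_root_diff_square:
  "(\<Sum>s\<in>R-{r}. 1 / (r - s))\<^sup>2 - (\<Sum>s\<in>R-{r}. (1 / (r - s))\<^sup>2)
    = poly (pderiv (pderiv (pderiv T))) r / (3 * poly (pderiv T) r)"
  using pderiv_T_nz by (simp add: poly_pderiv_T poly_pderiv_root_poly finR)

end

text \<open>Euler--Jacobi: comparison of the top coefficients in Lagrange's interpolation formula.\<close>

lemma sum_over_roots:
  assumes k: "degree k < degree T"
  shows "(\<Sum>r\<in>R. poly k r / poly (pderiv T) r) = coeff k (degree T - 1) / lead_coeff T"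
proof -
  define q where "q = (\<Sum>r\<in>R. smult (poly k r / poly (root_poly (R - {r})) r) (root_poly (R - {r})))"
  have dq: "degree (root_poly (R - {r})) = degree T - 1" if "r \<in> R" for r
    using that finR cardR by (simp add: degree_root_poly)
  have "degree q \<le> degree T - 1"
    unfolding q_def
    by (rule degree_sum_le) (use finR dq in \<open>auto intro: order.trans[OF degree_smult_le]\<close>)
  moreover have "poly q x = poly k x" if x: "x \<in> R" for x
  proof -
    have "poly q x = (\<Sum>r\<in>R. if r = x then poly k x else 0)"
      unfolding q_def poly_sum
      by (rule sum.cong) (use x finR in \<open>auto simp: poly_root_poly_eq_0_iff\<close>)
    then show ?thesis using x finR by simp
  qed
  ultimately have "k = q"
    using k by (intro poly_eqI_degree[where A = R]) (auto simp: cardR)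
  then have "coeff k (degree T - 1) = coeff q (degree T - 1)" by simp
  moreover have "coeff (root_poly (R - {r})) (degree T - 1) = 1" if "r \<in> R" for r
    using lead_coeff_root_poly[of "R - {r}"] unfolding dq[OF that] .
  ultimately have "coeff k (degree T - 1) = (\<Sum>r\<in>R. poly k r / poly (root_poly (R - {r})) r)"
    by (simp add: q_def coeff_sum)
  also have "\<dots> = lead_coeff T * (\<Sum>r\<in>R. poly k r / poly (pderiv T) r)"
    unfolding sum_distrib_left by (rule sum.cong) (use T0 in \<open>auto simp: poly_pderiv_T\<close>)
  finally show ?thesis using T0 by simp
qed

lemma sum_over_roots_eq_0:
  assumes "degree k + 2 \<le> degree T"
  shows "(\<Sum>r\<in>R. poly k r / poly (pderiv T) r) = 0"
  using assms sum_over_roots[of k] by (simp add: coeff_eq_0)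

end

text \<open>V' / V has only simple poles, whatever the multiplicities in \<open>V\<close>, and
  \<open>C\<close> vanishes at each of them. The induction splits off one linear factor at a
  time.\<close>

lemma dvd_mult_pderiv:
  fixes V C :: "complex poly"
  assumes "V \<noteq> 0" "\<And>c. poly V c = 0 \<Longrightarrow> poly C c = 0"
  shows "V dvd C * pderiv V"
  using assms
proof (induction "degree V" arbitrary: V rule: less_induct)
  case less
  show ?case
  proof (cases "degree V = 0")
    case True
    then obtain v where "V = [:v:]" by (rule degree_eq_zeroE)
    then show ?thesis by (simp add: pderiv_pCons)
  next
    case False
    then obtain c where c: "poly V c = 0"
      using fundamental_theorem_of_algebra_alt[of V] by (metis degree_pCons_0)
    then obtain U where U: "V = [:- c, 1:] * U" by (meson dvdE poly_eq_0_iff_dvd)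
    have "poly C c = 0" using less.prems c by blast
    then obtain E where E: "C = [:- c, 1:] * E" by (meson dvdE poly_eq_0_iff_dvd)
    have U0: "U \<noteq> 0" using U less.prems by auto
    have "degree U < degree V" unfolding U using U0 by (subst degree_mult_eq) auto
    then have "U dvd C * pderiv U" using less.prems U0 by (intro less.hyps) (auto simp: U)
    then have "[:- c, 1:] * U dvd [:- c, 1:] * (E * U + C * pderiv U)"
      by (intro mult_dvd_mono dvd_add) auto
    also have "[:- c, 1:] * (E * U + C * pderiv U) = C * pderiv V"
      unfolding U pderiv_linear_mult E by (simp only: algebra_simps)
    finally show ?thesis using U by simp
  qed
qed


section \<open>Pencils \<open>a + P b\<close> whose critical points are fixed\<close>

lemma coprime_if_no_common_root:
  fixes a b :: "complex poly"
  assumes "\<And>t. \<not> (poly a t = 0 \<and> poly b t = 0)"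
  shows "coprime a b"
proof (rule coprimeI)
  fix c assume c: "c dvd a" "c dvd b"
  have "poly c x \<noteq> 0" for x
    using c assms[of x] by (auto elim!: dvdE)
  then obtain v where "v \<noteq> 0" "c = [:v:]"
    using fundamental_theorem_of_algebra_alt[of c] by auto
  then show "is_unit c" by (simp add: is_unit_poly_iff dvd_field_iff)
qed

locale convex_pencil =
  fixes a b :: "complex poly" and n :: nat
  assumes deg_a: "degree a = n" and deg_b: "degree b < n" and b0: "b \<noteq> 0"
    and cop: "coprime a b"
    and crit_fixed: "poly (pderiv a * b - a * pderiv b) c = 0 \<Longrightarrow> poly (a + pCons 0 b) c = 0"
begin

text \<open>The zeros of \<open>wr\<close> are the critical points and those of \<open>fixp\<close>
  the fixed points of the rational map - a / b, whose fibre over \<open>P\<close> is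
  \<open>R P\<close>.\<close>

definition wr where "wr = pderiv a * b - a * pderiv b"
definition fixp where "fixp = a + pCons 0 b"
definition T where "T P = a + smult P b"
definition R where "R P = {t. poly (T P) t = 0}"

lemma n_pos: "0 < n" using deg_b by simp

lemma a0: "a \<noteq> 0" using deg_a n_pos by auto

lemma degree_T: "degree (T P) = n" and lead_coeff_T: "lead_coeff (T P) = lead_coeff a"
proof -
  have "degree (smult P b) < degree a" using deg_a deg_b by (metis degree_smult_le le_less_trans)
  then show "degree (T P) = n" "lead_coeff (T P) = lead_coeff a"
    unfolding T_def using deg_a deg_b by (auto simp: degree_add_eq_left coeff_eq_0 simp del: degree_smult_eq)
qed

lemma T_nz: "T P \<noteq> 0" using degree_T[of P] n_pos by auto

text \<open>The top terms of a' b and a b' carry the different factors \<open>n\<close> and deg b,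
  so they do not cancel. The resulting lower bound for deg wr limits the degree of the quotient
  \<open>L\<close> in \<open>pair_sum_const\<close>.\<close>

lemma coeff_wr: "coeff wr (n - 1 + degree b) = (of_nat n - of_nat (degree b)) * (lead_coeff a * lead_coeff b)"
proof -
  have 1: "coeff (pderiv a * b) (n - 1 + degree b) = of_nat n * lead_coeff a * lead_coeff b"
    using coeff_mult_degree_sum[of "pderiv a" b] n_pos
    by (simp add: degree_pderiv deg_a coeff_pderiv del: of_nat_Suc)
  have 2: "coeff (a * pderiv b) (n - 1 + degree b) = of_nat (degree b) * lead_coeff a * lead_coeff b"
  proof (cases "degree b = 0")
    case True
    then have "pderiv b = 0" by (simp add: pderiv_eq_0_iff)
    then show ?thesis using True by simp
  next
    case False
    then show ?thesis
      using coeff_mult_degree_sum[of a "pderiv b"] n_pos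
      by (simp add: degree_pderiv deg_a coeff_pderiv mult.commute del: of_nat_Suc)
  qed
  show ?thesis unfolding wr_def coeff_diff 1 2 by (simp add: algebra_simps)
qed

lemma wr_nz: "wr \<noteq> 0"
proof
  assume "wr = 0"
  then have "(of_nat n - of_nat (degree b)) * (lead_coeff a * lead_coeff b) = (0 :: complex)"
    using coeff_wr by simp
  then show False using deg_b b0 a0 by simp
qed

lemma degree_wr: "n - 1 + degree b \<le> degree wr"
  using coeff_wr deg_b b0 a0 by (intro le_degree) simp

lemma b_nz_at_root: "poly (T P) r = 0 \<Longrightarrow> poly b r \<noteq> 0"
proof
  assume "poly (T P) r = 0" "poly b r = 0"
  then have "[:- r, 1:] dvd a" "[:- r, 1:] dvd b" by (auto simp: T_def poly_eq_0_iff_dvd[symmetric])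
  with cop have "is_unit [:- r, 1:]" by (rule coprime_common_divisor)
  then show False by (simp add: is_unit_poly_iff)
qed

text \<open>At a root \<open>a\<close> may be replaced by - P b, which turns the k-th derivative of
  \<open>a\<close> times \<open>b\<close> minus \<open>a\<close> times that of \<open>b\<close> into
  \<open>b\<close> times the k-th derivative of \<open>T P\<close>. The derivative of
  \<open>wr\<close> is the case k = 2, since a' b' cancels.\<close>

lemma at_root:
  assumes "poly (T P) r = 0"
  shows "poly a r = - P * poly b r" (is ?A)
    and "poly wr r = poly b r * poly (pderiv (T P)) r" (is ?B)
    and "poly (pderiv wr) r = poly b r * poly (pderiv (pderiv (T P))) r" (is ?C)
    and "poly (pderiv (pderiv (pderiv a)) * b - a * pderiv (pderiv (pderiv b))) r
      = poly b r * poly (pderiv (pderiv (pderiv (T P)))) r" (is ?D)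
    and "poly fixp r = - (P - r) * poly b r" (is ?E)
proof -
  show *: ?A
    using assms by (simp add: T_def eq_neg_iff_add_eq_0)
  show ?B
    by (simp add: wr_def T_def pderiv_add pderiv_smult * algebra_simps)
  show ?C
    by (simp add: wr_def T_def pderiv_add pderiv_diff pderiv_mult pderiv_smult * algebra_simps)
  show ?D
    by (simp add: T_def pderiv_add pderiv_smult * algebra_simps)
  show ?E
    by (simp add: fixp_def * algebra_simps)
qed

lemma split_T: "card (R P) = n \<Longrightarrow> split_poly (T P) (R P)"
  by unfold_locales (auto simp: T_nz R_def degree_T)

text \<open>At a root a = - P b, so every multiple of \<open>a\<close> in the numerator cancels the
  \<open>b\<close> below. Division by \<open>b\<close> and then by \<open>a\<close> leaves three
  Euler--Jacobi sums: two vanish for reasons of degree, and the third is a top coefficient over the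
  leading coefficient of \<open>a\<close>, in which \<open>P\<close> no longer occurs.\<close>

lemma sum_quotient_const:
  assumes L: "degree L + 2 \<le> 2 * n"
  shows "\<exists>\<kappa>. \<forall>P. card (R P) = n \<longrightarrow>
    (\<Sum>r\<in>R P. poly L r / (poly b r * poly (pderiv (T P)) r)) = \<kappa>"
proof -
  obtain e f where ef: "e * a + f * b = 1"
    using cop bezout_coefficients_fst_snd[of a b] by (metis coprime_iff_gcd_eq_1)
  \<comment> \<open>The cofactor of \<open>a\<close> in Bezout's identity is reduced modulo
    \<open>b\<close>; deg h < deg b then lets the bound on deg L pass to \<open>k\<close>.\<close>
  define h where "h = (L * e) mod b"
  define k where "k = f * L + ((L * e) div b) * a"
  have hk: "h * a + k * b = L"
  proof -
    have "h * a + k * b = (h + (L * e) div b * b) * a + f * L * b"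
      by (simp add: k_def algebra_simps)
    also have "h + (L * e) div b * b = L * e"
      by (simp add: h_def)
    also have "L * e * a + f * L * b = L * (e * a + f * b)" by (simp add: algebra_simps)
    finally show ?thesis using ef by simp
  qed
  have h: "h = 0 \<or> degree h < degree b"
    unfolding h_def using degree_mod_less[OF b0] by blast
  have k: "k = 0 \<or> degree k + degree b + 2 \<le> 2 * n"
  proof (cases "k = 0")
    case False
    have "degree k + degree b = degree (L - h * a)"
      using False b0 hk by (simp add: degree_mult_eq[symmetric] algebra_simps flip: hk)
    also have "\<dots> \<le> max (degree L) (degree (h * a))" by (rule degree_diff_le_max)
    also have "\<dots> + 2 \<le> 2 * n"
      using L h deg_a deg_b n_pos degree_mult_le[of h a] by auto
    finally show ?thesis by simp
  qed auto
  define g k0 where "g = k div a" and "k0 = k mod a"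
  have k0: "degree k0 < n"
    unfolding k0_def using degree_mod_less[OF a0, of k] deg_a n_pos by auto
  have g: "degree (g * b) + 2 \<le> n \<or> g = 0"
  proof (cases "g = 0")
    case False
    have "degree (g * a) = degree g + n" using False a0 deg_a by (simp add: degree_mult_eq)
    moreover have "k = g * a + k0" by (simp add: g_def k0_def)
    ultimately have "degree k = degree g + n" using k0 by (simp add: degree_add_eq_left)
    then show ?thesis using k n_pos False b0 by (auto simp: degree_mult_eq)
  qed auto
  have "(\<Sum>r\<in>R P. poly L r / (poly b r * poly (pderiv (T P)) r)) = coeff k0 (n - 1) / lead_coeff a"
    if P: "card (R P) = n" for P
  proof -
    interpret split_poly "T P" "R P" using split_T[OF P] .
    have "poly L r / (poly b r * poly (pderiv (T P)) r)
       = - P * (poly h r / poly (pderiv (T P)) r) - P * (poly (g * b) r / poly (pderiv (T P)) r)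
         + poly k0 r / poly (pderiv (T P)) r" if r: "r \<in> R P" for r
    proof -
      have r': "poly (T P) r = 0" using r by (simp add: R_def)
      have "k = g * a + k0" by (simp add: g_def k0_def)
      then have "poly L r = poly h r * poly a r + (poly g r * poly a r + poly k0 r) * poly b r"
        by (metis hk poly_add poly_mult)
      also have "\<dots> = (- P * poly h r - P * poly (g * b) r + poly k0 r) * poly b r"
        by (simp add: at_root(1)[OF r'] algebra_simps)
      finally show ?thesis
        using b_nz_at_root[OF r'] pderiv_T_nz[OF r]
        by (simp add: divide_simps algebra_simps)
    qed
    from sum.cong[OF refl this]
    have "(\<Sum>r\<in>R P. poly L r / (poly b r * poly (pderiv (T P)) r))
      = - P * (\<Sum>r\<in>R P. poly h r / poly (pderiv (T P)) r)
        - P * (\<Sum>r\<in>R P. poly (g * b) r / poly (pderiv (T P)) r)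
        + (\<Sum>r\<in>R P. poly k0 r / poly (pderiv (T P)) r)"
      by (simp only: sum.distrib sum_subtractf sum_distrib_left)
    also have "(\<Sum>r\<in>R P. poly h r / poly (pderiv (T P)) r) = 0"
      using h deg_b by (cases "h = 0") (auto intro!: sum_over_roots_eq_0 simp: degree_T)
    also have "(\<Sum>r\<in>R P. poly (g * b) r / poly (pderiv (T P)) r) = 0"
      using g by (cases "g = 0") (auto intro!: sum_over_roots_eq_0 simp: degree_T simp del: poly_mult)
    also have "(\<Sum>r\<in>R P. poly k0 r / poly (pderiv (T P)) r) = coeff k0 (n - 1) / lead_coeff a"
      using sum_over_roots[of k0] k0 lead_coeff_T[of P] by (simp add: degree_T)
    finally show ?thesis by simp
  qed
  then show ?thesis by blast
qed

text \<open>Twice the sum of the \<open>\<beta>\<close>; the foliation dual to \<open>\<ell>\<close> pairs with each root with weight \<open>\<epsilon>\<close>,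
  which is 0 if \<open>\<ell>\<close> is the line at infinity and 1 otherwise.\<close>

definition pair_sum :: "complex \<Rightarrow> complex \<Rightarrow> complex" where
  "pair_sum \<epsilon> P = (\<Sum>r\<in>R P. (1 + poly b r / poly (pderiv (T P)) r) *
     (2 * \<epsilon> * (\<Sum>s\<in>R P - {r}. 1 + (P - r) / (r - s)) +
      ((\<Sum>s\<in>R P - {r}. 1 + (P - r) / (r - s))\<^sup>2 - (\<Sum>s\<in>R P - {r}. (1 + (P - r) / (r - s))\<^sup>2))))"

lemma wr_dvd: "wr dvd fixp * pderiv wr"
  using dvd_mult_pderiv[OF wr_nz, of fixp] crit_fixed by (simp add: wr_def fixp_def)

lemma coprime_wr_b: "coprime wr b"
proof (rule coprime_if_no_common_root)
  fix x show "\<not> (poly wr x = 0 \<and> poly b x = 0)"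
  proof
    assume "poly wr x = 0 \<and> poly b x = 0"
    then have w: "poly wr x = 0" and b: "poly b x = 0" by auto
    have "poly fixp x = 0" unfolding fixp_def by (rule crit_fixed[OF w[unfolded wr_def]])
    then have "poly a x = 0" using b by (simp add: fixp_def)
    then show False using b_nz_at_root[of 0 x] b by (simp add: T_def)
  qed
qed

text \<open>Times \<open>b\<close>, which is coprime to \<open>wr\<close>, the third-order
  expression is b wr'' - b' wr' + b'' wr. One factor \<open>fixp\<close> makes wr' divisible by
  \<open>wr\<close>, and two make wr'' so, as the derivative of fixp wr' = wr K shows.\<close>

lemma wr_dvd_3: "wr dvd fixp\<^sup>2 * (pderiv (pderiv (pderiv a)) * b - a * pderiv (pderiv (pderiv b)))"
proof -
  let ?T3 = "pderiv (pderiv (pderiv a)) * b - a * pderiv (pderiv (pderiv b))"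
  from wr_dvd obtain K where K: "fixp * pderiv wr = wr * K" by (elim dvdE)
  have "pderiv (fixp * pderiv wr) = pderiv (wr * K)" by (simp add: K)
  then have K': "fixp * pderiv (pderiv wr) = pderiv wr * K + wr * pderiv K - pderiv fixp * pderiv wr"
    by (simp add: pderiv_mult algebra_simps)
  have "?T3 * b = b * pderiv (pderiv wr) - pderiv b * pderiv wr + pderiv (pderiv b) * wr"
    by (simp add: wr_def pderiv_mult pderiv_diff pderiv_add algebra_simps)
  then have "fixp\<^sup>2 * ?T3 * b = b * fixp * (fixp * pderiv (pderiv wr))
      - pderiv b * fixp * (fixp * pderiv wr) + fixp\<^sup>2 * pderiv (pderiv b) * wr"
    by (simp add: power2_eq_square mult.assoc) (simp add: algebra_simps)
  also have "\<dots> = (b * K - b * pderiv fixp - pderiv b * fixp) * (fixp * pderiv wr)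
      + (b * fixp * pderiv K + fixp\<^sup>2 * pderiv (pderiv b)) * wr"
    unfolding K' by (simp add: algebra_simps)
  also have "wr dvd \<dots>" unfolding K by simp
  finally show ?thesis using coprime_wr_b by (metis coprime_dvd_mult_left_iff)
qed

text \<open>The inner sums are ratios of derivatives of \<open>T P\<close> at r: each bracket is a
  constant plus multiples of u = (P - r) T'' / T' and v = (P - r)^2 T''' / T'. The summand 1 of the
  weight gives plain Euler--Jacobi sums. For the summand b / T', \<open>K\<close> and
  \<open>L\<close> rewrite u b / T' and v b / T' as quotients to which
  \<open>sum_quotient_const\<close> applies.\<close>

lemma pair_sum_const: "\<exists>\<kappa>. \<forall>P. card (R P) = n \<longrightarrow> pair_sum \<epsilon> P = \<kappa>"
proof -
  let ?T3 = "pderiv (pderiv (pderiv a)) * b - a * pderiv (pderiv (pderiv b))"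
  let ?X = "\<lambda>P r s. 1 + (P - r) / (r - s)"
  obtain K where K: "fixp * pderiv wr = wr * K" using wr_dvd by (elim dvdE)
  obtain L where L: "fixp\<^sup>2 * ?T3 = wr * L" using wr_dvd_3 by (elim dvdE)
  have deg_fixp: "degree fixp \<le> n"
    unfolding fixp_def using deg_a deg_b by (intro degree_add_le) (auto intro: order.trans[OF degree_pCons_le])
  have dK: "degree K + degree b + 2 \<le> 2 * n"
  proof (cases "K = 0")
    case False
    have "degree wr + degree K = degree (fixp * pderiv wr)"
      unfolding K using False wr_nz by (simp add: degree_mult_eq)
    also have "\<dots> \<le> degree fixp + (degree wr - 1)"
      using degree_mult_le[of fixp "pderiv wr"] by (simp add: degree_pderiv)
    finally have *: "degree wr + degree K \<le> n + (degree wr - 1)" using deg_fixp by simp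
    have "pderiv wr \<noteq> 0" using K False wr_nz by auto
    then have "degree wr \<noteq> 0" by (auto simp: pderiv_eq_0_iff)
    then show ?thesis using * deg_b by linarith
  qed (use deg_b in auto)
  \<comment> \<open>2 n + (n + deg b - 3) - (n - 1 + deg b) = 2 n - 2, just what
    \<open>sum_quotient_const\<close> admits.\<close>
  have dL: "degree L + 2 \<le> 2 * n"
  proof (cases "L = 0")
    case False
    have T3: "?T3 \<noteq> 0" using L False wr_nz by auto
    have "degree ?T3 + 3 \<le> n + degree b"
    proof -
      have d3: "p = 0 \<or> degree p + 3 = degree q"
        if "p = pderiv (pderiv (pderiv q))" for p q :: "complex poly"
        using that by (cases "degree q < 3") (auto simp: pderiv_eq_0_iff degree_pderiv)
      have "pderiv (pderiv (pderiv a)) * b = 0 \<or> degree (pderiv (pderiv (pderiv a)) * b) + 3 \<le> n + degree b"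
        using d3[OF refl, of a] degree_mult_le[of "pderiv (pderiv (pderiv a))" b] deg_a by auto
      moreover have "a * pderiv (pderiv (pderiv b)) = 0 \<or> degree (a * pderiv (pderiv (pderiv b))) + 3 \<le> n + degree b"
        using d3[OF refl, of b] degree_mult_le[of a "pderiv (pderiv (pderiv b))"] deg_a by auto
      ultimately show ?thesis
        using T3 degree_diff_le_max[of "pderiv (pderiv (pderiv a)) * b" "a * pderiv (pderiv (pderiv b))"]
        by (auto simp: max_def split: if_splits)
    qed
    moreover have "degree wr + degree L = degree (fixp\<^sup>2 * ?T3)"
      unfolding L using False wr_nz by (simp add: degree_mult_eq)
    moreover have "degree (fixp\<^sup>2 * ?T3) \<le> 2 * degree fixp + degree ?T3"
      using degree_mult_le[of "fixp\<^sup>2" ?T3] degree_power_le[of fixp 2] by simp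
    ultimately show ?thesis using degree_wr deg_fixp n_pos by linarith
  qed (use n_pos in auto)
  have "degree (b * b) + 2 \<le> 2 * n" using deg_b degree_mult_le[of b b] by linarith
  from sum_quotient_const[OF this] obtain \<kappa>2 where
    \<kappa>2: "card (R P) = n \<Longrightarrow> (\<Sum>r\<in>R P. poly (b * b) r / (poly b r * poly (pderiv (T P)) r)) = \<kappa>2" for P
    by blast
  have "degree (- K * b) + 2 \<le> 2 * n" using dK degree_mult_le[of K b] by simp
  from sum_quotient_const[OF this] obtain \<kappa>4 where
    \<kappa>4: "card (R P) = n \<Longrightarrow> (\<Sum>r\<in>R P. poly (- K * b) r / (poly b r * poly (pderiv (T P)) r)) = \<kappa>4" for P
    by blast
  from sum_quotient_const[OF dL] obtain \<kappa>6 where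
    \<kappa>6: "card (R P) = n \<Longrightarrow> (\<Sum>r\<in>R P. poly L r / (poly b r * poly (pderiv (T P)) r)) = \<kappa>6" for P
    by blast
  \<comment> \<open>The Euler--Jacobi values of the sums of u and of v: the coefficients of x^(n -
    1) in (P - x) T'' and (P - x)^2 T''', relative to the leading coefficient of \<open>T P\<close>.
    The sign of \<open>\<kappa>3\<close> is that of - x.\<close>
  define \<kappa>3 \<kappa>5 :: complex where
    "\<kappa>3 = - (of_nat n * (of_nat n - 1))" and "\<kappa>5 = of_nat n * (of_nat n - 1) * (of_nat n - 2)"
  \<comment> \<open>The coefficients of 1 and of u in the expanded bracket; the 1 in
    \<open>?X\<close> contributes n - 1 to each inner sum.\<close>
  define k0 k1 where "k0 = 2 * \<epsilon> * (of_nat n - 1) + (of_nat n - 1)\<^sup>2 - (of_nat n - 1)"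
    and "k1 = \<epsilon> + of_nat n - 2"
  have "pair_sum \<epsilon> P = k0 * (of_nat n + \<kappa>2) + k1 * (\<kappa>3 + \<kappa>4) + (\<kappa>5 + \<kappa>6) / 3"
    if P: "card (R P) = n" for P
  proof -
    interpret split_poly "T P" "R P" using split_T[OF P] .
    define T1 T2 T3 where "T1 = pderiv (T P)" and "T2 = pderiv T1" and "T3 = pderiv T2"
    have tm: "(1 + poly b r / poly T1 r) *
      (2 * \<epsilon> * (\<Sum>s\<in>R P - {r}. ?X P r s) +
      ((\<Sum>s\<in>R P - {r}. ?X P r s)\<^sup>2 - (\<Sum>s\<in>R P - {r}. (?X P r s)\<^sup>2)))
      = k0 * (1 + poly (b * b) r / (poly b r * poly T1 r))
        + k1 * (poly ([:P, -1:] * T2) r / poly T1 r + poly (- K * b) r / (poly b r * poly T1 r))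
        + (poly ([:P, -1:] * ([:P, -1:] * T3)) r / poly T1 r + poly L r / (poly b r * poly T1 r)) / 3"
      if r: "r \<in> R P" for r
    proof -
      have r': "poly (T P) r = 0" using r by (simp add: R_def)
      note nz = b_nz_at_root[OF r'] pderiv_T_nz[OF r, folded T1_def]
      define \<sigma> E E2 where "\<sigma> = P - r" and "E = (\<Sum>s\<in>R P-{r}. 1 / (r - s))"
        and "E2 = (\<Sum>s\<in>R P-{r}. (1 / (r - s))\<^sup>2)"
      have E: "E = poly T2 r / (2 * poly T1 r)" "E\<^sup>2 - E2 = poly T3 r / (3 * poly T1 r)"
        using sum_inverse_root_diff[OF r] sum_inverse_root_diff_square[OF r]
        by (simp_all add: E_def E2_def T1_def T2_def T3_def)
      have card: "of_nat (card (R P - {r})) = (of_nat n - 1 :: complex)"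
        using r finR P n_pos by (simp add: of_nat_diff)
      have X1: "(\<Sum>s\<in>R P - {r}. ?X P r s) = of_nat n - 1 + \<sigma> * E"
        by (simp only: sum.distrib sum_distrib_left E_def \<sigma>_def sum_constant card) simp
      have "(\<Sum>s\<in>R P - {r}. (?X P r s)\<^sup>2)
          = (\<Sum>s\<in>R P - {r}. 1 + (2 * \<sigma> * (1 / (r - s)) + \<sigma>\<^sup>2 * (1 / (r - s))\<^sup>2))"
        by (rule sum.cong) (simp_all add: \<sigma>_def power2_eq_square divide_simps, simp_all add: algebra_simps)
      also have "\<dots> = of_nat n - 1 + (2 * \<sigma> * E + \<sigma>\<^sup>2 * E2)"
        by (simp only: sum.distrib sum_distrib_left E_def E2_def sum_constant card) simp
      finally have X2: "(\<Sum>s\<in>R P - {r}. (?X P r s)\<^sup>2)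
          = of_nat n - 1 + (2 * \<sigma> * E + \<sigma>\<^sup>2 * E2)" .
      define u v where "u = \<sigma> * poly T2 r / poly T1 r" and "v = \<sigma>\<^sup>2 * poly T3 r / poly T1 r"
      have "2 * \<epsilon> * (of_nat n - 1 + \<sigma> * E) +
          ((of_nat n - 1 + \<sigma> * E)\<^sup>2 - (of_nat n - 1 + (2 * \<sigma> * E + \<sigma>\<^sup>2 * E2)))
        = k0 + k1 * (2 * (\<sigma> * E)) + \<sigma>\<^sup>2 * (E\<^sup>2 - E2)"
        by (simp add: k0_def k1_def power2_eq_square algebra_simps)
      also have "\<dots> = k0 + k1 * u + v / 3"
        unfolding E(2) unfolding E(1) by (simp add: u_def v_def)
      finally have main: "2 * \<epsilon> * (of_nat n - 1 + \<sigma> * E) +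
          ((of_nat n - 1 + \<sigma> * E)\<^sup>2 - (of_nat n - 1 + (2 * \<sigma> * E + \<sigma>\<^sup>2 * E2)))
        = k0 + k1 * u + v / 3" .
      have wr_r: "poly wr r \<noteq> 0" using nz by (simp add: at_root(2)[OF r', folded T1_def])
      \<comment> \<open>Evaluated at r this reads - (P - r) b b T'' = b T' K, i.e. u = - K / b, so
        that only one T' remains in the denominator of u b / T'.\<close>
      have "poly (fixp * pderiv wr) r = poly (wr * K) r" by (simp add: K)
      then have "- \<sigma> * poly b r * (poly b r * poly T2 r) = poly b r * poly T1 r * poly K r"
        by (simp add: at_root[OF r', folded T1_def, folded T2_def, folded T3_def] \<sigma>_def)
      then have "poly b r * (- \<sigma> * poly b r * poly T2 r) = poly b r * (poly T1 r * poly K r)"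
        by (simp add: algebra_simps)
      then have "- \<sigma> * poly b r * poly T2 r = poly T1 r * poly K r"
        using nz(1) mult_left_cancel by blast
      then have "poly K r = - \<sigma> * poly b r * poly T2 r / poly T1 r"
        using nz by (simp add: nonzero_eq_divide_eq mult.commute)
      then have uK: "u * (poly b r / poly T1 r) = poly (- K * b) r / (poly b r * poly T1 r)"
        using nz by (simp add: u_def divide_simps)
      \<comment> \<open>Likewise v = L / b^2; one \<open>b\<close> stays in the denominator of v b /
        T', which is why that factor is allowed in \<open>sum_quotient_const\<close>.\<close>
      have "poly (fixp\<^sup>2 * ?T3) r = poly (wr * L) r" by (simp only: L)
      then have "(\<sigma> * poly b r)\<^sup>2 * (poly b r * poly T3 r) = poly b r * poly T1 r * poly L r"
        unfolding poly_mult poly_power at_root(2,4,5)[OF r', folded T1_def, folded T2_def, folded T3_def, unfolded poly_mult]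
        by (simp add: \<sigma>_def power2_eq_square algebra_simps)
      then have "\<sigma>\<^sup>2 * (poly b r)\<^sup>2 * poly T3 r = poly T1 r * poly L r"
        using nz by (simp add: power_mult_distrib mult.assoc)
      then have vL: "v * (poly b r / poly T1 r) = poly L r / (poly b r * poly T1 r)"
        using nz by (simp add: v_def divide_simps) (simp add: algebra_simps power2_eq_square)
      have bb: "poly (b * b) r / (poly b r * poly T1 r) = poly b r / poly T1 r"
        using nz by simp
      have uu: "poly ([:P, -1:] * T2) r / poly T1 r = u"
        and vv: "poly ([:P, -1:] * ([:P, -1:] * T3)) r / poly T1 r = v"
        by (simp_all add: u_def v_def \<sigma>_def power2_eq_square algebra_simps)
      show ?thesis
        unfolding X1 X2 main uu vv bb uK[symmetric] vL[symmetric] by (simp add: algebra_simps)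
    qed
    have c2: "coeff T2 m = of_nat ((m + 1) * (m + 2)) * coeff (T P) (m + 2)" for m
      by (simp add: T2_def T1_def coeff_pderiv algebra_simps)
    have c3: "coeff T3 m = of_nat ((m + 1) * (m + 2) * (m + 3)) * coeff (T P) (m + 3)" for m
      by (simp add: T3_def c2 coeff_pderiv algebra_simps numeral_3_eq_3)
    have lcT: "coeff (T P) n \<noteq> 0" using T_nz[of P] degree_T[of P] by (metis leading_coeff_0_iff)
    have z: "coeff (T P) m = 0" if "m > n" for m using that degree_T by (auto intro: coeff_eq_0)
    have d2: "degree ([:P, -1:] * T2) < degree (T P)"
    proof (cases "n = 1")
      case True
      then have "T2 = 0" by (simp add: T2_def T1_def pderiv_eq_0_iff degree_pderiv degree_T)
      then show ?thesis using n_pos by (simp add: degree_T)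
    next
      case False
      then show ?thesis
        using degree_mult_le[of "[:P, -1:]" T2] n_pos
        by (simp add: T2_def T1_def degree_pderiv degree_T del: mult_pCons_left)
    qed
    have T3z: "T3 = 0" if "n < 3"
      using that by (simp add: T3_def T2_def T1_def pderiv_eq_0_iff degree_pderiv degree_T)
    have d3: "degree ([:P, -1:] * ([:P, -1:] * T3)) < degree (T P)"
    proof (cases "n < 3")
      case True
      then show ?thesis using T3z n_pos by (simp add: degree_T)
    next
      case False
      have "degree T3 = n - 3" by (simp add: T3_def T2_def T1_def degree_pderiv degree_T)
      then show ?thesis
        using degree_mult_le[of "[:P, -1:]" "[:P, -1:] * T3"] degree_mult_le[of "[:P, -1:]" T3] False
        by (simp add: degree_T del: mult_pCons_left)
    qed
    have s3: "(\<Sum>r\<in>R P. poly ([:P, -1:] * T2) r / poly T1 r) = \<kappa>3"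
    proof -
      have "coeff ([:P, -1:] * T2) (n - 1) = \<kappa>3 * coeff (T P) n"
      proof (cases "n = 1")
        case False
        then obtain m where m: "n = m + 2" using n_pos by (metis add_2_eq_Suc' less_one not_less_less_Suc_eq less_imp_Suc_add add.commute add_Suc_right plus_1_eq_Suc Suc_lessI)
        then show ?thesis by (simp add: c2 z \<kappa>3_def coeff_pCons algebra_simps)
      qed (simp add: c2 z \<kappa>3_def)
      then show ?thesis using sum_over_roots[OF d2] lcT by (simp add: degree_T T1_def)
    qed
    have s5: "(\<Sum>r\<in>R P. poly ([:P, -1:] * ([:P, -1:] * T3)) r / poly T1 r) = \<kappa>5"
    proof -
      have "coeff ([:P, -1:] * ([:P, -1:] * T3)) (n - 1) = \<kappa>5 * coeff (T P) n"
      proof (cases "n < 3")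
        case False
        define m where "m = n - 3"
        have m: "n = m + 3" using False by (simp add: m_def)
        have lin: "coeff ([:P, -1:] * X) (Suc i) = P * coeff X (Suc i) - coeff X i" for X i
          by simp
        have "coeff ([:P, -1:] * ([:P, -1:] * T3)) (Suc (Suc m)) = coeff T3 m"
          unfolding lin by (simp add: c3 z m)
        then show ?thesis by (simp add: m c3 \<kappa>5_def algebra_simps numeral_3_eq_3)
      next
        case True
        then have "n = 1 \<or> n = 2" using n_pos by auto
        then show ?thesis using T3z by (auto simp: \<kappa>5_def)
      qed
      then show ?thesis using sum_over_roots[OF d3] lcT by (simp add: degree_T T1_def)
    qed
    have s1: "(\<Sum>r\<in>R P. 1) = (of_nat n :: complex)" using P by simp
    have "pair_sum \<epsilon> P = (\<Sum>r\<in>R P. k0 * (1 + poly (b * b) r / (poly b r * poly T1 r))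
        + k1 * (poly ([:P, -1:] * T2) r / poly T1 r + poly (- K * b) r / (poly b r * poly T1 r))
        + (poly ([:P, -1:] * ([:P, -1:] * T3)) r / poly T1 r + poly L r / (poly b r * poly T1 r)) / 3)"
      unfolding pair_sum_def T1_def[symmetric] by (rule sum.cong[OF refl tm])
    then show ?thesis
      by (simp only: sum.distrib sum_distrib_left[symmetric] sum_divide_distrib[symmetric]
          s1 s3 s5 \<kappa>2[OF P, folded T1_def] \<kappa>4[OF P, folded T1_def] \<kappa>6[OF P, folded T1_def])
  qed
  then show ?thesis by blast
qed

end

section \<open>Holomorphic functions and forms in two variables\<close>

definition dotp :: "complex \<times> complex \<Rightarrow> complex \<times> complex \<Rightarrow> complex" where
  "dotp A v = fst A * fst v + snd A * snd v"

definition scl :: "complex \<Rightarrow> complex \<times> complex \<Rightarrow> complex \<times> complex" where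
  "scl c A = (c * fst A, c * snd A)"

definition wd :: "complex \<times> complex \<Rightarrow> complex \<times> complex \<Rightarrow> complex" where
  "wd A B = fst A * snd B - snd A * fst B"

text \<open>\<open>has_diff f A z\<close> says that \<open>df = A\<close> at \<open>z\<close>, and \<open>has_ext \<omega> e z\<close> that \<open>d\<omega> = e dp \<and> dq\<close> at \<open>z\<close>.\<close>

definition has_diff :: "(complex \<times> complex \<Rightarrow> complex) \<Rightarrow> complex \<times> complex \<Rightarrow> complex \<times> complex \<Rightarrow> bool" where
  "has_diff f A z \<longleftrightarrow> (f has_derivative dotp A) (at z)"

definition has_ext :: "form1 \<Rightarrow> complex \<Rightarrow> complex \<times> complex \<Rightarrow> bool" where
  "has_ext \<omega> e z \<longleftrightarrow>
     (\<exists>A B. has_diff (\<lambda>z. fst (\<omega> z)) A z \<and> has_diff (\<lambda>z. snd (\<omega> z)) B z \<and> e = fst B - snd A)"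

lemma fst_scl [simp]: "fst (scl c A) = c * fst A" and snd_scl [simp]: "snd (scl c A) = c * snd A"
  by (simp_all add: scl_def)

lemma wedge_eq_wd: "wedge \<omega> \<theta> z = wd (\<omega> z) (\<theta> z)"
  by (simp add: wedge_def wd_def)

lemma scale_form_eq_scl: "scale_form g \<omega> z = scl (g z) (\<omega> z)"
  by (simp add: scale_form_def scl_def)

lemma holomorphic2_on_iff_has_diff: "holomorphic2_on f U \<longleftrightarrow> (\<forall>z\<in>U. \<exists>A. has_diff f A z)"
proof -
  have "(\<lambda>(h, k). a * h + b * k) = dotp (a, b)" for a b
    by (auto simp: dotp_def)
  then show ?thesis by (simp add: holomorphic2_on_def has_diff_def)
qed

lemma holomorphic_form_iff_has_ext: "holomorphic_form \<omega> U \<longleftrightarrow> (\<forall>z\<in>U. \<exists>e. has_ext \<omega> e z)"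
  unfolding holomorphic_form_def holomorphic2_on_iff_has_diff has_ext_def by blast

lemma has_extI:
  "has_diff (\<lambda>z. fst (\<omega> z)) A z \<Longrightarrow> has_diff (\<lambda>z. snd (\<omega> z)) B z \<Longrightarrow> e = fst B - snd A \<Longrightarrow> has_ext \<omega> e z"
  unfolding has_ext_def by blast

lemma has_extE:
  assumes "has_ext \<omega> e z"
  obtains A B where "has_diff (\<lambda>z. fst (\<omega> z)) A z" "has_diff (\<lambda>z. snd (\<omega> z)) B z" "e = fst B - snd A"
  using assms unfolding has_ext_def by blast

lemma has_diff_eq: "has_diff f A z \<Longrightarrow> A = B \<Longrightarrow> has_diff f B z" by simp
lemma has_ext_eq: "has_ext f A z \<Longrightarrow> A = B \<Longrightarrow> has_ext f B z" by simp

lemma has_diff_const: "has_diff (\<lambda>z. c) 0 z"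
  by (simp add: has_diff_def dotp_def[abs_def])

lemma has_diff_fst: "has_diff fst (1, 0) z"
  unfolding has_diff_def dotp_def by (auto intro!: derivative_eq_intros)

lemma has_diff_snd: "has_diff snd (0, 1) z"
  unfolding has_diff_def dotp_def by (auto intro!: derivative_eq_intros)

lemma has_diff_add: "has_diff f A z \<Longrightarrow> has_diff g B z \<Longrightarrow> has_diff (\<lambda>z. f z + g z) (A + B) z"
  unfolding has_diff_def
  by (rule has_derivative_eq_rhs[OF has_derivative_add]) (auto simp: dotp_def algebra_simps)

lemma has_diff_diff: "has_diff f A z \<Longrightarrow> has_diff g B z \<Longrightarrow> has_diff (\<lambda>z. f z - g z) (A - B) z"
  unfolding has_diff_def
  by (rule has_derivative_eq_rhs[OF has_derivative_diff]) (auto simp: dotp_def algebra_simps)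

lemma has_diff_minus: "has_diff f A z \<Longrightarrow> has_diff (\<lambda>z. - f z) (- A) z"
  unfolding has_diff_def
  by (rule has_derivative_eq_rhs[OF has_derivative_minus]) (auto simp: dotp_def algebra_simps)

lemma has_diff_mult: "has_diff f A z \<Longrightarrow> has_diff g B z \<Longrightarrow> has_diff (\<lambda>z. f z * g z) (scl (f z) B + scl (g z) A) z"
  unfolding has_diff_def
  by (rule has_derivative_eq_rhs[OF has_derivative_mult]) (auto simp: dotp_def algebra_simps)

lemma has_diff_comp:
  assumes "has_diff f A z" "(g has_field_derivative g') (at (f z))"
  shows "has_diff (\<lambda>z. g (f z)) (scl g' A) z"
  using has_derivative_compose[OF assms(1)[unfolded has_diff_def] assms(2)[unfolded has_field_derivative_def]]
  unfolding has_diff_def by (rule has_derivative_eq_rhs) (auto simp: dotp_def algebra_simps)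

lemma has_diff_inverse: "has_diff f A z \<Longrightarrow> f z \<noteq> 0 \<Longrightarrow> has_diff (\<lambda>z. inverse (f z)) (scl (- (inverse (f z) ^ 2)) A) z"
  by (rule has_diff_comp) (auto intro!: derivative_eq_intros simp: power2_eq_square)

lemma has_diff_divide:
  "has_diff f A z \<Longrightarrow> has_diff g B z \<Longrightarrow> g z \<noteq> 0 \<Longrightarrow>
    has_diff (\<lambda>z. f z / g z) (scl (1 / g z) A - scl (f z / (g z)\<^sup>2) B) z"
  unfolding divide_inverse
  by (rule has_diff_eq[OF has_diff_mult[OF _ has_diff_inverse]])
     (auto simp: prod_eq_iff power_inverse algebra_simps)

lemma has_diff_sum: "(\<And>i. i \<in> I \<Longrightarrow> has_diff (f i) (A i) z) \<Longrightarrow> has_diff (\<lambda>z. \<Sum>i\<in>I. f i z) (\<Sum>i\<in>I. A i) z"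
  by (induction I rule: infinite_finite_induct) (auto intro: has_diff_const has_diff_add)

lemma has_diff_unique:
  assumes "has_diff f A z" "has_diff f B z"
  shows "A = B"
proof -
  have "dotp A = dotp B" using assms unfolding has_diff_def by (rule has_derivative_unique)
  then have "dotp A (1, 0) = dotp B (1, 0)" "dotp A (0, 1) = dotp B (0, 1)" by simp_all
  then show ?thesis by (simp add: dotp_def prod_eq_iff)
qed

lemma has_diff_cong:
  assumes "has_diff f A z" "open V" "z \<in> V" "\<And>w. w \<in> V \<Longrightarrow> g w = f w"
  shows "has_diff g A z"
  using assms unfolding has_diff_def by (metis has_derivative_transform_within_open)

lemma has_diff_isCont: "has_diff f A z \<Longrightarrow> isCont f z"
  unfolding has_diff_def by (rule has_derivative_continuous)

lemma has_diff_partial1: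
  assumes "has_diff f A z"
  shows "((\<lambda>s. f (s, snd z)) has_field_derivative fst A) (at (fst z))"
proof -
  have "((\<lambda>s. (s, snd z)) has_derivative (\<lambda>h. (h, 0))) (at (fst z))"
    by (auto intro!: derivative_eq_intros)
  then have "((\<lambda>s. f (s, snd z)) has_derivative (\<lambda>h. dotp A (h, 0))) (at (fst z))"
    by (rule has_derivative_compose) (use assms in \<open>simp add: has_diff_def\<close>)
  then show ?thesis
    by (simp add: has_field_derivative_def dotp_def mult_commute_abs)
qed

lemma has_diff_partial2:
  assumes "has_diff f A z"
  shows "((\<lambda>s. f (fst z, s)) has_field_derivative snd A) (at (snd z))"
proof -
  have "((\<lambda>s. (fst z, s)) has_derivative (\<lambda>h. (0, h))) (at (snd z))"
    by (rule has_derivative_eq_rhs[OF has_derivative_Pair[OF has_derivative_const has_derivative_ident]]) auto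
  then have "((\<lambda>s. f (fst z, s)) has_derivative (\<lambda>h. dotp A (0, h))) (at (snd z))"
    by (rule has_derivative_compose) (use assms in \<open>simp add: has_diff_def\<close>)
  then show ?thesis
    by (simp add: has_field_derivative_def dotp_def mult_commute_abs)
qed

lemma has_ext_ext_deriv:
  assumes "has_ext \<omega> e z"
  shows "ext_deriv \<omega> z = e"
proof -
  obtain A B where "has_diff (\<lambda>z. fst (\<omega> z)) A z" "has_diff (\<lambda>z. snd (\<omega> z)) B z" "e = fst B - snd A"
    using assms by (rule has_extE)
  then show ?thesis
    using DERIV_imp_deriv[OF has_diff_partial1[of "\<lambda>z. snd (\<omega> z)" B z]]
      DERIV_imp_deriv[OF has_diff_partial2[of "\<lambda>z. fst (\<omega> z)" A z]]
    by (simp add: ext_deriv_def case_prod_beta)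
qed

lemma has_ext_cong:
  assumes "has_ext \<omega> e z" "open V" "z \<in> V" "\<And>w. w \<in> V \<Longrightarrow> \<theta> w = \<omega> w"
  shows "has_ext \<theta> e z"
proof -
  obtain A B where AB: "has_diff (\<lambda>z. fst (\<omega> z)) A z" "has_diff (\<lambda>z. snd (\<omega> z)) B z" "e = fst B - snd A"
    using assms(1) by (auto simp: has_ext_def)
  have "has_diff (\<lambda>z. fst (\<theta> z)) A z" "has_diff (\<lambda>z. snd (\<theta> z)) B z"
    by (rule has_diff_cong[OF AB(1) assms(2,3)], simp add: assms(4))
       (rule has_diff_cong[OF AB(2) assms(2,3)], simp add: assms(4))
  then show ?thesis using AB(3) by (rule has_extI)
qed

lemma has_ext_zero: "has_ext (\<lambda>z. 0) 0 z"
  by (rule has_extI[of _ 0 _ 0]) (simp_all add: has_diff_const)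

lemma has_ext_add:
  assumes "has_ext \<omega> e z" "has_ext \<theta> e' z" shows "has_ext (\<lambda>z. \<omega> z + \<theta> z) (e + e') z"
  using assms(1)
proof (rule has_extE)
  fix A B assume 1: "has_diff (\<lambda>z. fst (\<omega> z)) A z" "has_diff (\<lambda>z. snd (\<omega> z)) B z" "e = fst B - snd A"
  from assms(2) show ?thesis
    by (rule has_extE, intro has_extI) (auto intro!: has_diff_add 1 simp: 1(3))
qed

lemma has_ext_scl:
  assumes "has_diff g G z" "has_ext \<omega> e z"
  shows "has_ext (\<lambda>z. scl (g z) (\<omega> z)) (wd G (\<omega> z) + g z * e) z"
  using assms(2)
proof (rule has_extE)
  fix A B assume 1: "has_diff (\<lambda>z. fst (\<omega> z)) A z" "has_diff (\<lambda>z. snd (\<omega> z)) B z" "e = fst B - snd A"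
  show ?thesis
    by (rule has_extI, unfold fst_scl snd_scl, (rule has_diff_mult assms(1) 1)+)
      (simp add: 1(3) wd_def algebra_simps)
qed

lemma has_ext_diff:
  assumes "has_ext \<omega> e z" "has_ext \<theta> e' z" shows "has_ext (\<lambda>z. \<omega> z - \<theta> z) (e - e') z"
proof -
  have "has_ext (\<lambda>z. \<omega> z + scl (- 1) (\<theta> z)) (e + (wd 0 (\<theta> z) + (- 1) * e')) z"
    by (intro has_ext_add has_ext_scl has_diff_const assms)
  then show ?thesis by (simp add: wd_def scl_def plus_prod_def minus_prod_def)
qed

lemma has_ext_sum: "(\<And>i. i \<in> I \<Longrightarrow> has_ext (\<omega> i) (e i) z) \<Longrightarrow> has_ext (\<lambda>z. \<Sum>i\<in>I. \<omega> i z) (\<Sum>i\<in>I. e i) z"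
  by (induction I rule: infinite_finite_induct) (auto intro: has_ext_zero has_ext_add)

lemma has_diff_wd:
  assumes "has_ext \<omega> e z" "has_ext \<theta> e' z"
  shows "\<exists>A. has_diff (\<lambda>z. wd (\<omega> z) (\<theta> z)) A z"
proof -
  obtain A B C D where "has_diff (\<lambda>z. fst (\<omega> z)) A z" "has_diff (\<lambda>z. snd (\<omega> z)) B z"
    "has_diff (\<lambda>z. fst (\<theta> z)) C z" "has_diff (\<lambda>z. snd (\<theta> z)) D z"
    using assms by (auto simp: has_ext_def)
  then show ?thesis
    unfolding wd_def by (intro exI) (rule has_diff_diff has_diff_mult | assumption)+
qed

section \<open>Symmetry of mixed partials and continuity of first partials\<close>

lemma second_difference_bound:
  assumes V: "open V" "(p, q) \<in> V"
    and D: "\<And>z. z \<in> V \<Longrightarrow> ((\<lambda>s. f (s, snd z)) has_field_derivative D1 z) (at (fst z))"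
    and A: "has_diff D1 A (p, q)" and \<epsilon>: "\<epsilon> > 0"
  shows "\<exists>\<delta>>0. \<forall>h. norm h < \<delta> \<longrightarrow>
    norm (f (p + h, q + h) - f (p + h, q) - f (p, q + h) + f (p, q) - snd A * h\<^sup>2) \<le> \<epsilon> * (norm h)\<^sup>2"
proof -
  obtain r where r: "r > 0" "ball (p, q) r \<subseteq> V"
    using V open_contains_ball by blast
  obtain d where d: "d > 0" "\<And>y. norm (y - (p, q)) < d \<Longrightarrow>
      norm (D1 y - D1 (p, q) - dotp A (y - (p, q))) \<le> \<epsilon> / 4 * norm (y - (p, q))"
    using A[unfolded has_diff_def has_derivative_at_alt] \<epsilon> by (meson divide_pos_pos zero_less_numeral)
  define \<delta> where "\<delta> = min r d / 2"
  have "norm (f (p + h, q + h) - f (p + h, q) - f (p, q + h) + f (p, q) - snd A * h\<^sup>2) \<le> \<epsilon> * (norm h)\<^sup>2"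
    if h: "norm h < \<delta>" for h
  proof -
    have near: "norm ((x, y) - (p, q)) \<le> 2 * norm h"
      if "x \<in> cball p (norm h)" "norm (y - q) \<le> norm h" for x y
      using that norm_Pair_le[of "x - p" "y - q"] by (auto simp: dist_norm norm_minus_commute)
    have inV: "(x, y) \<in> V" if "x \<in> cball p (norm h)" "norm (y - q) \<le> norm h" for x y
    proof (rule subsetD[OF r(2)])
      show "(x, y) \<in> ball (p, q) r"
        using near[OF that] h by (simp add: \<delta>_def dist_norm norm_minus_commute[of "(p, q)"] del: diff_Pair)
    qed
    \<comment> \<open>The subtracted term makes the derivative of \<open>G\<close> small on the
      whole disc: D1 (x, q + h) - D1 (x, q) is \<open>snd A * h\<close> up to o(h). The mean value
      inequality then bounds the increment of \<open>G\<close>.\<close>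
    define G where "G x = f (x, q + h) - f (x, q) - snd A * h * x" for x
    have "norm (G (p + h) - G p) \<le> \<epsilon> * norm h * norm ((p + h) - p)"
    proof (rule field_differentiable_bound[of "cball p (norm h)" G "\<lambda>x. D1 (x, q + h) - D1 (x, q) - snd A * h"])
      fix x assume x: "x \<in> cball p (norm h)"
      have "((\<lambda>s. f (s, q + h)) has_field_derivative D1 (x, q + h)) (at x)"
        using D[OF inV[OF x, of "q + h"]] by simp
      moreover have "((\<lambda>s. f (s, q)) has_field_derivative D1 (x, q)) (at x)"
        using D[OF inV[OF x, of q]] by simp
      ultimately have "(G has_field_derivative D1 (x, q + h) - D1 (x, q) - snd A * h) (at x)"
        unfolding G_def by (auto intro!: derivative_eq_intros)
      then show "(G has_field_derivative D1 (x, q + h) - D1 (x, q) - snd A * h) (at x within cball p (norm h))"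
        by (rule has_field_derivative_at_within)
      have n1: "norm ((x, q + h) - (p, q)) \<le> 2 * norm h" "norm ((x, q) - (p, q)) \<le> 2 * norm h"
        using near[OF x, of "q + h"] near[OF x, of q] by simp_all
      have "norm (D1 (x, q + h) - D1 (p, q) - dotp A ((x, q + h) - (p, q))) \<le> \<epsilon> / 4 * (2 * norm h)"
        by (rule order.trans[OF d(2) mult_left_mono[OF n1(1)]])
          (use n1(1) h \<epsilon> in \<open>auto simp: \<delta>_def\<close>)
      moreover have "norm (D1 (x, q) - D1 (p, q) - dotp A ((x, q) - (p, q))) \<le> \<epsilon> / 4 * (2 * norm h)"
        by (rule order.trans[OF d(2) mult_left_mono[OF n1(2)]])
          (use n1(2) h \<epsilon> in \<open>auto simp: \<delta>_def\<close>)
      ultimately have "norm ((D1 (x, q + h) - D1 (p, q) - dotp A ((x, q + h) - (p, q)))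
        - (D1 (x, q) - D1 (p, q) - dotp A ((x, q) - (p, q)))) \<le> \<epsilon> / 4 * (2 * norm h) + \<epsilon> / 4 * (2 * norm h)"
        by (rule order.trans[OF norm_triangle_ineq4 add_mono])
      also have "(D1 (x, q + h) - D1 (p, q) - dotp A ((x, q + h) - (p, q)))
        - (D1 (x, q) - D1 (p, q) - dotp A ((x, q) - (p, q))) = D1 (x, q + h) - D1 (x, q) - snd A * h"
        by (simp add: dotp_def algebra_simps)
      finally show "norm (D1 (x, q + h) - D1 (x, q) - snd A * h) \<le> \<epsilon> * norm h" by simp
    qed (auto simp: dist_norm)
    then show ?thesis by (simp add: G_def power2_eq_square algebra_simps)
  qed
  moreover have "\<delta> > 0" using r d by (simp add: \<delta>_def)
  ultimately show ?thesis by blast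
qed

lemma has_diff_swap:
  assumes "has_diff f A (prod.swap z)"
  shows "has_diff (\<lambda>z. f (prod.swap z)) (prod.swap A) z"
proof -
  have "(prod.swap has_derivative prod.swap) (at z)"
    unfolding prod.swap_def by (auto intro!: derivative_eq_intros)
  from has_derivative_compose[OF this assms[unfolded has_diff_def]] show ?thesis
    unfolding has_diff_def
    by (rule has_derivative_eq_rhs) (auto simp: dotp_def algebra_simps)
qed

text \<open>Schwarz's theorem in Young's form, where the first partials are known to be
  differentiable at the point \<open>z\<close> only: both mixed derivatives are limits of the same
  second difference quotient.\<close>

lemma mixed_partials_commute:
  assumes V: "open V" "z \<in> V"
    and D: "\<And>z. z \<in> V \<Longrightarrow> has_diff f (D z) z"
    and e: "has_ext D e z"
  shows "e = 0"
proof -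
  obtain A B where AB: "has_diff (\<lambda>z. fst (D z)) A z" "has_diff (\<lambda>z. snd (D z)) B z" "e = fst B - snd A"
    using e by (auto simp: has_ext_def)
  obtain p q where z: "z = (p, q)" by fastforce
  let ?V = "prod.swap -` V"
  have V': "open ?V" "(q, p) \<in> ?V"
    using V z by (auto intro!: open_vimage continuous_intros simp: prod.swap_def)
  have "norm (fst B - snd A) \<le> 2 * \<epsilon>" if \<epsilon>: "\<epsilon> > 0" for \<epsilon>
  proof -
    obtain \<delta>1 where \<delta>1: "\<delta>1 > 0" "\<And>h. norm h < \<delta>1 \<Longrightarrow>
      norm (f (p + h, q + h) - f (p + h, q) - f (p, q + h) + f (p, q) - snd A * h\<^sup>2) \<le> \<epsilon> * (norm h)\<^sup>2"
      using second_difference_bound[OF V(1) V(2)[unfolded z] _ AB(1)[unfolded z] \<epsilon>, of f]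
        has_diff_partial1[OF D] by blast
    obtain \<delta>2 where \<delta>2: "\<delta>2 > 0" "\<And>h. norm h < \<delta>2 \<Longrightarrow>
      norm (f (p + h, q + h) - f (p, q + h) - f (p + h, q) + f (p, q) - fst B * h\<^sup>2) \<le> \<epsilon> * (norm h)\<^sup>2"
      using second_difference_bound[OF V' _ _ \<epsilon>, of "\<lambda>z. f (prod.swap z)" "\<lambda>z. snd (D (prod.swap z))" "prod.swap B"]
        has_diff_partial2[OF D] has_diff_swap[of "\<lambda>z. snd (D z)" B "(q, p)"] AB(2) by (auto simp: z)
    define h :: complex where "h = of_real (min \<delta>1 \<delta>2 / 2)"
    have h: "norm h < \<delta>1" "norm h < \<delta>2" "norm h > 0" using \<delta>1(1) \<delta>2(1) by (auto simp: h_def)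
    have "norm ((fst B - snd A) * h\<^sup>2) \<le> \<epsilon> * (norm h)\<^sup>2 + \<epsilon> * (norm h)\<^sup>2"
    proof -
      have "(fst B - snd A) * h\<^sup>2 =
        (f (p + h, q + h) - f (p + h, q) - f (p, q + h) + f (p, q) - snd A * h\<^sup>2)
        - (f (p + h, q + h) - f (p, q + h) - f (p + h, q) + f (p, q) - fst B * h\<^sup>2)"
        by (simp add: algebra_simps)
      also have "norm \<dots> \<le> \<epsilon> * (norm h)\<^sup>2 + \<epsilon> * (norm h)\<^sup>2"
        using \<delta>1(2)[OF h(1)] \<delta>2(2)[OF h(2)] norm_triangle_ineq4 by (smt (verit))
      finally show ?thesis .
    qed
    then have "norm (fst B - snd A) * (norm h)\<^sup>2 \<le> (2 * \<epsilon>) * (norm h)\<^sup>2"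
      by (simp add: norm_mult norm_power)
    then show ?thesis using h(3) by simp
  qed
  then have "norm (fst B - snd A) \<le> \<epsilon>" if "\<epsilon> > 0" for \<epsilon>
    using that by (metis field_sum_of_halves half_gt_zero mult_2)
  then show ?thesis using AB(3) by (metis field_le_epsilon add_0 norm_le_zero_iff)
qed

text \<open>Differentiability at each point says nothing directly about the derivatives. Cauchy's
  estimate bounds the derivative of the difference of two nearby slices by the supremum of that
  difference on a circle, which is small by uniform continuity.\<close>

lemma continuous_partial1:
  assumes U: "open U" "z0 \<in> U" and f: "holomorphic2_on f U"
  shows "isCont (\<lambda>z. deriv (\<lambda>s. f (s, snd z)) (fst z)) z0"
proof -
  obtain p q where z0: "z0 = (p, q)" by fastforce
  obtain r' where r': "r' > 0" "cball z0 r' \<subseteq> U" using U open_contains_cball by blast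
  \<comment> \<open>A quarter, so that the polydisc of radius 2 r lies in the closed ball of radius
    r' and has room for a disc of radius \<open>r\<close> shifted by less than
    \<open>r\<close>.\<close>
  define r where "r = r' / 4"
  have r: "r > 0" using r' by (simp add: r_def)
  define K where "K = cball p (2 * r) \<times> cball q (2 * r)"
  have KU: "K \<subseteq> U"
  proof
    fix w assume "w \<in> K"
    then have "norm (w - z0) \<le> 2 * r + 2 * r"
      using norm_Pair_le[of "fst w - p" "snd w - q"]
      by (cases w) (auto simp: K_def z0 dist_norm norm_minus_commute)
    then show "w \<in> U" using r' by (auto simp: r_def dist_norm norm_minus_commute)
  qed
  have der: "((\<lambda>s. f (s, y)) has_field_derivative deriv (\<lambda>s. f (s, y)) x) (at x)" if "(x, y) \<in> U" for x y
    using that f has_diff_partial1[of f _ "(x, y)"] by (auto simp: holomorphic2_on_iff_has_diff dest!: bspec DERIV_deriv_iff_has_field_derivative[THEN iffD2, OF exI])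
  have "continuous_on K f"
    using KU f has_diff_isCont by (meson continuous_at_imp_continuous_on holomorphic2_on_iff_has_diff subsetD)
  then have uc: "uniformly_continuous_on K f"
    by (intro compact_uniformly_continuous) (auto simp: K_def compact_Times)
  show ?thesis
    unfolding continuous_at_eps_delta
  proof (intro allI impI)
    fix e :: real assume e: "e > 0"
    obtain d where d: "d > 0" "\<And>x y. x \<in> K \<Longrightarrow> y \<in> K \<Longrightarrow> dist y x < d \<Longrightarrow> dist (f y) (f x) < e / 2 * r"
      using uc e r unfolding uniformly_continuous_on_def by (metis half_gt_zero mult_pos_pos)
    have "dist (deriv (\<lambda>s. f (s, snd z)) (fst z)) (deriv (\<lambda>s. f (s, snd z0)) (fst z0)) < e"
      if z: "dist z z0 < min d r" for z
    proof -
      define P Q where "P = fst z" and "Q = snd z"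
      have PQ: "norm (P - p) < r" "norm (Q - q) < r"
        using z dist_fst_le[of z z0] dist_snd_le[of z z0] by (auto simp: P_def Q_def z0 dist_norm)
      have K1: "(s + (P - p), Q) \<in> K" "(s, q) \<in> K" if "s \<in> cball p r" for s
      proof -
        have "dist p s \<le> r" "dist s (s + (P - p)) < r" "dist q Q < r"
          using that PQ by (simp_all add: dist_norm norm_minus_commute)
        then show "(s + (P - p), Q) \<in> K" "(s, q) \<in> K"
          using r dist_triangle[of p "s + (P - p)" s] by (simp_all add: K_def)
      qed
      \<comment> \<open>One slice is translated so that both derivatives are taken at the same point
        \<open>p\<close>.\<close>
      define G where "G s = f (s + (P - p), Q) - f (s, q)" for s
      have G': "(G has_field_derivative deriv (\<lambda>s. f (s, Q)) (s + (P - p)) - deriv (\<lambda>s. f (s, q)) s) (at s)"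
        if "s \<in> cball p r" for s
      proof -
        have "((\<lambda>s. f (s + (P - p), Q)) has_field_derivative deriv (\<lambda>s. f (s, Q)) (s + (P - p))) (at s)"
          using DERIV_shift[of "\<lambda>s. f (s, Q)" _ s "P - p"] der[of "s + (P - p)" Q] K1[OF that] KU by blast
        moreover have "((\<lambda>s. f (s, q)) has_field_derivative deriv (\<lambda>s. f (s, q)) s) (at s)"
          using der K1[OF that] KU by blast
        ultimately show ?thesis unfolding G_def by (rule DERIV_diff)
      qed
      have "norm ((deriv ^^ 1) G p) \<le> fact 1 * (e / 2 * r) / r ^ 1"
      proof (rule Cauchy_inequality)
        show "G holomorphic_on ball p r"
          by (rule holomorphic_onI) (meson G' ball_subset_cball field_differentiable_at_within field_differentiable_def subsetD)
        show "continuous_on (cball p r) G"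
          by (meson G' DERIV_isCont continuous_at_imp_continuous_on)
        fix x assume "norm (p - x) = r"
        then have x: "x \<in> cball p r" by (simp add: dist_norm)
        have "dist (x + (P - p), Q) (x, q) = dist z z0"
          by (simp add: dist_prod_def z0 P_def Q_def dist_norm)
        then show "norm (G x) \<le> e / 2 * r"
          using d(2)[OF K1(2)[OF x] K1(1)[OF x]] z by (simp add: G_def dist_norm)
      qed (rule r)
      moreover have "deriv G p = deriv (\<lambda>s. f (s, Q)) P - deriv (\<lambda>s. f (s, q)) p"
        using DERIV_imp_deriv[OF G'[of p]] r by simp
      ultimately show ?thesis
        using e r by (simp add: dist_norm z0 P_def Q_def)
    qed
    then show "\<exists>d>0. \<forall>x'. dist x' z0 < d \<longrightarrow>
        dist (deriv (\<lambda>s. f (s, snd x')) (fst x')) (deriv (\<lambda>s. f (s, snd z0)) (fst z0)) < e"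
      using d(1) r by (intro exI[of _ "min d r"]) auto
  qed
qed

lemma continuous_partial2:
  assumes U: "open U" "z0 \<in> U" and f: "holomorphic2_on f U"
  shows "isCont (\<lambda>z. deriv (\<lambda>s. f (fst z, s)) (snd z)) z0"
proof -
  have "holomorphic2_on (\<lambda>z. f (prod.swap z)) (prod.swap -` U)"
    using f unfolding holomorphic2_on_iff_has_diff by (metis has_diff_swap vimageE)
  moreover have "open (prod.swap -` U)" "prod.swap z0 \<in> prod.swap -` U"
    using U by (auto intro!: open_vimage continuous_intros simp: prod.swap_def)
  ultimately have "isCont (\<lambda>z. deriv (\<lambda>s. f (prod.swap (s, snd z))) (fst z)) (prod.swap z0)"
    by (intro continuous_partial1)
  then have "isCont ((\<lambda>z. deriv (\<lambda>s. f (prod.swap (s, snd z))) (fst z)) \<circ> prod.swap) z0"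
    by (intro continuous_at_compose) (auto intro!: continuous_intros simp: prod.swap_def)
  then show ?thesis by (simp add: o_def)
qed

text \<open>The exterior derivative involves first partials only, hence is continuous on
  \<open>U\<close>; an open set where it does not vanish would meet \<open>D\<close>.\<close>

lemma ext_deriv_eq_0_dense:
  assumes U: "open U" "holomorphic_form \<omega> U" and D: "closure D = UNIV"
    and 0: "\<And>z. z \<in> U \<inter> D \<Longrightarrow> ext_deriv \<omega> z = 0" and z: "z \<in> U"
  shows "ext_deriv \<omega> z = 0"
proof (rule ccontr)
  assume nz: "ext_deriv \<omega> z \<noteq> 0"
  have "ext_deriv \<omega> = (\<lambda>z. deriv (\<lambda>s. snd (\<omega> (s, snd z))) (fst z) - deriv (\<lambda>s. fst (\<omega> (fst z, s))) (snd z))"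
    by (auto simp: ext_deriv_def)
  then have "isCont (ext_deriv \<omega>) z"
    using U z unfolding holomorphic_form_def
    by (auto intro!: continuous_diff continuous_partial1[of U z "\<lambda>z. snd (\<omega> z)", simplified]
        continuous_partial2[of U z "\<lambda>z. fst (\<omega> z)", simplified])
  then have "\<forall>\<^sub>F w in nhds z. ext_deriv \<omega> w \<in> - {0}"
    using nz by (intro topological_tendstoD[of "ext_deriv \<omega>" "ext_deriv \<omega> z"])
      (auto simp: continuous_at tendsto_at_iff_tendsto_nhds)
  then obtain N where N: "open N" "z \<in> N" "\<And>w. w \<in> N \<Longrightarrow> ext_deriv \<omega> w \<noteq> 0"
    unfolding eventually_nhds by auto
  have "U \<inter> N \<inter> closure D \<noteq> {}" using D z N by auto
  then have "U \<inter> N \<inter> D \<noteq> {}"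
    using open_Int_closure_eq_empty[of "U \<inter> N" D] U N by auto
  then show False using 0 N by blast
qed

section \<open>Curvature in the normalized coordinates\<close>

text \<open>To first order at \<open>z\<close>, the function is constant along the leaves of
  \<open>\<phi>\<close>. For \<open>\<phi>\<close> = dP this is the pointwise form of being a
  function of P alone.\<close>

definition basic :: "form1 \<Rightarrow> complex \<times> complex \<Rightarrow> (complex \<times> complex \<Rightarrow> complex) \<Rightarrow> bool" where
  "basic \<phi> z g \<longleftrightarrow> (\<exists>c. has_diff g (scl c (\<phi> z)) z)"

lemma scl_simps: "scl c (scl e A) = scl (c * e) A" "scl c A + scl e A = scl (c + e) A"
  "scl c A - scl e A = scl (c - e) A" "scl 0 A = 0" "scl 1 A = A" "- scl c A = scl (- c) A"
  by (simp_all add: scl_def prod_eq_iff algebra_simps)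

lemma sum_scl: "(\<Sum>i\<in>I. scl (c i) A) = scl (\<Sum>i\<in>I. c i) A"
  by (induction I rule: infinite_finite_induct) (simp_all add: scl_simps)

lemma wd_simps: "wd (scl c A) B = c * wd A B" "wd A (scl c B) = c * wd A B"
  "wd (A + A') B = wd A B + wd A' B" "wd (A - A') B = wd A B - wd A' B"
  "wd A (B + B') = wd A B + wd A B'" "wd A (B - B') = wd A B - wd A B'" "wd A A = 0"
  "wd 0 A = 0" "wd A 0 = 0"
  by (simp_all add: wd_def algebra_simps)

lemma wd_swap: "wd A B = - wd B A" by (simp add: wd_def)

lemma basic_const: "basic \<phi> z (\<lambda>z. c)"
  unfolding basic_def using has_diff_const[of c z] by (intro exI[of _ 0]) (simp add: scl_simps)

lemma basic_add:
  assumes "basic \<phi> z f" "basic \<phi> z g"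
  shows "basic \<phi> z (\<lambda>z. f z + g z)"
  using assms unfolding basic_def
  by (elim exE) (drule (1) has_diff_add, simp only: scl_simps, rule exI)

lemma basic_diff:
  assumes "basic \<phi> z f" "basic \<phi> z g"
  shows "basic \<phi> z (\<lambda>z. f z - g z)"
  using assms unfolding basic_def
  by (elim exE) (drule (1) has_diff_diff, simp only: scl_simps, rule exI)

lemma basic_mult:
  assumes "basic \<phi> z f" "basic \<phi> z g"
  shows "basic \<phi> z (\<lambda>z. f z * g z)"
  using assms unfolding basic_def
  by (elim exE) (drule (1) has_diff_mult, simp only: scl_simps, rule exI)

lemma basic_divide:
  assumes "basic \<phi> z f" "basic \<phi> z g" "g z \<noteq> 0"
  shows "basic \<phi> z (\<lambda>z. f z / g z)"
  using assms unfolding basic_def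
  by (elim exE) (drule (2) has_diff_divide, simp only: scl_simps, rule exI)

lemma basic_poly:
  assumes "basic \<phi> z f"
  shows "basic \<phi> z (\<lambda>z. poly p (f z))"
  using assms unfolding basic_def
  by (elim exE) (drule has_diff_comp[OF _ poly_DERIV], simp only: scl_simps, rule exI)

text \<open>
  With \<open>J = \<phi> \<and> \<theta>\<close> and \<open>F = f\<^sub>r f\<^sub>s f\<^sub>t J\<close> one gets \<open>\<eta> = dF / F + \<alpha> \<phi> + \<beta> \<theta>\<close>; the first two
  terms are closed.
\<close>

lemma ext_eta_form:
  fixes om :: "'i \<Rightarrow> form1" and \<phi> \<theta> \<eta> :: form1
  assumes V: "open V" and \<phi>: "\<And>z. z \<in> V \<Longrightarrow> has_ext \<phi> 0 z" and \<theta>: "\<And>z. z \<in> V \<Longrightarrow> has_ext \<theta> 0 z"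
    and J: "\<And>z. z \<in> V \<Longrightarrow> wd (\<phi> z) (\<theta> z) \<noteq> 0"
    and om: "\<And>i z. i \<in> {r, s, t} \<Longrightarrow> z \<in> V \<Longrightarrow> om i z = scl (f i z) (scl (x i) (\<theta> z) - scl (l i z) (\<phi> z))"
    and f: "\<And>i z. i \<in> {r, s, t} \<Longrightarrow> z \<in> V \<Longrightarrow> \<exists>A. has_diff (f i) A z"
    and f0: "\<And>i z. i \<in> {r, s, t} \<Longrightarrow> z \<in> V \<Longrightarrow> f i z \<noteq> 0"
    and l: "\<And>i z. i \<in> {r, s, t} \<Longrightarrow> z \<in> V \<Longrightarrow> has_diff (l i) (scl (l' i z) (\<phi> z)) z"
    and \<Delta>: "\<And>i j z. i \<in> {r, s, t} \<Longrightarrow> j \<in> {r, s, t} \<Longrightarrow> i \<noteq> j \<Longrightarrow> z \<in> V \<Longrightarrow> l j z * x i - l i z * x j \<noteq> 0"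
    and rst: "r \<noteq> s" "s \<noteq> t" "t \<noteq> r"
    and \<alpha>: "\<And>z. z \<in> V \<Longrightarrow> basic \<phi> z \<alpha>"
    and \<beta>: "\<And>z. z \<in> V \<Longrightarrow> has_diff \<beta> (scl (\<beta>' z) (\<phi> z)) z"
    and e1: "\<And>z. z \<in> V \<Longrightarrow> x r * (l' t z * x s - l' s z * x t) = (l t z * x s - l s z * x t) * (\<alpha> z * x r + \<beta> z * l r z)"
    and e2: "\<And>z. z \<in> V \<Longrightarrow> x s * (l' r z * x t - l' t z * x r) = (l r z * x t - l t z * x r) * (\<alpha> z * x s + \<beta> z * l s z)"
    and e3: "\<And>z. z \<in> V \<Longrightarrow> x t * (l' s z * x r - l' r z * x s) = (l s z * x r - l r z * x s) * (\<alpha> z * x t + \<beta> z * l t z)"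
    and \<eta>: "eta_form V (om r) (om s) (om t) \<eta>" and z: "z \<in> V"
  shows "has_ext \<eta> (\<beta>' z * wd (\<phi> z) (\<theta> z)) z"
proof -
  define F where "F z = f r z * f s z * f t z * wd (\<phi> z) (\<theta> z)" for z
  have "\<exists>A. has_diff F A z" if z: "z \<in> V" for z
  proof -
    obtain A1 A2 A3 A4 where "has_diff (f r) A1 z" "has_diff (f s) A2 z" "has_diff (f t) A3 z"
      "has_diff (\<lambda>z. wd (\<phi> z) (\<theta> z)) A4 z"
      using f[of r z] f[of s z] f[of t z] has_diff_wd[OF \<phi>[OF z] \<theta>[OF z]] z by blast
    then show ?thesis
      unfolding F_def by (intro exI) (rule has_diff_mult | assumption)+
  qed
  then obtain dF where dF: "\<And>z. z \<in> V \<Longrightarrow> has_diff F (dF z) z" by metis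
  have F0: "F z \<noteq> 0" if "z \<in> V" for z using f0 J that by (simp add: F_def)
  define Y where "Y i z = scl (x i) (\<theta> z) - scl (l i z) (\<phi> z)" for i z
  have Y: "has_ext (Y i) 0 z" if "i \<in> {r, s, t}" "z \<in> V" for i z
    unfolding Y_def
    by (rule has_ext_eq[OF has_ext_diff[OF has_ext_scl[OF has_diff_const \<theta>] has_ext_scl[OF l \<phi>]]])
      (use that in \<open>auto simp: wd_simps\<close>)
  define \<zeta> where "\<zeta> z = \<eta> z - scl (\<alpha> z) (\<phi> z) - scl (\<beta> z) (\<theta> z)" for z
  \<comment> \<open>\<open>scale_form (wedge (om j) (om k)) (om i)\<close> is F D Y_i with
    \<open>Y i\<close> closed. The assumption \<open>al\<close> accounts for the term with dD, and
    what remains of the equation for \<eta> says that F \<zeta> - dF is parallel to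
    \<open>Y i\<close>.\<close>
  have claim: "wd (scl (F w) (\<zeta> w) - dF w) (Y i w) = 0"
    if ijk: "i \<in> {r, s, t}" "j \<in> {r, s, t}" "k \<in> {r, s, t}" "j \<noteq> k"
      and Fp: "\<And>w. F w = f i w * f j w * f k w * wd (\<phi> w) (\<theta> w)"
      and al: "x i * (l' k w * x j - l' j w * x k) = (l k w * x j - l j w * x k) * (\<alpha> w * x i + \<beta> w * l i w)"
      and ext: "ext_deriv (scale_form (wedge (om j) (om k)) (om i)) w
        = wedge \<eta> (scale_form (wedge (om j) (om k)) (om i)) w"
      and w: "w \<in> V" for i j k w
  proof -
    define D where "D w = l k w * x j - l j w * x k" for w
    have eq: "scale_form (wedge (om j) (om k)) (om i) w = scl (F w * D w) (Y i w)" if "w \<in> V" for w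
      unfolding scale_form_eq_scl wedge_eq_wd om[OF ijk(1) that] om[OF ijk(2) that] om[OF ijk(3) that]
      by (simp add: Fp Y_def D_def prod_eq_iff wd_def algebra_simps)
    have D': "has_diff D (scl (l' k w * x j - l' j w * x k) (\<phi> w)) w"
      unfolding D_def
      by (rule has_diff_eq[OF has_diff_diff[OF has_diff_mult[OF l has_diff_const] has_diff_mult[OF l has_diff_const]]])
        (use ijk w in \<open>auto simp: scl_simps prod_eq_iff algebra_simps\<close>)
    have "has_ext (\<lambda>w. scl (F w * D w) (Y i w))
       (wd (scl (F w) (scl (l' k w * x j - l' j w * x k) (\<phi> w)) + scl (D w) (dF w)) (Y i w)
         + F w * D w * 0) w"
      by (intro has_ext_scl has_diff_mult dF w D' Y ijk)
    from has_ext_ext_deriv[OF has_ext_cong[OF this V w eq]] ext eq[OF w]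
    have "F w * (l' k w * x j - l' j w * x k) * wd (\<phi> w) (Y i w) + D w * wd (dF w) (Y i w)
        = F w * D w * wd (\<eta> w) (Y i w)"
      by (simp add: wedge_eq_wd wd_simps)
    moreover have "wd (\<phi> w) (Y i w) = x i * wd (\<phi> w) (\<theta> w)"
      by (simp add: Y_def wd_simps)
    moreover have "wd (scl (\<alpha> w) (\<phi> w) + scl (\<beta> w) (\<theta> w)) (Y i w)
        = (\<alpha> w * x i + \<beta> w * l i w) * wd (\<phi> w) (\<theta> w)"
      by (simp add: Y_def wd_simps wd_swap[of "\<theta> w" "\<phi> w"] algebra_simps)
    ultimately have "D w * wd (scl (F w) (\<zeta> w) - dF w) (Y i w) = 0"
      using al unfolding D_def[symmetric] \<zeta>_def wd_simps by algebra
    moreover have "D w \<noteq> 0" using \<Delta>[OF ijk(2,3,4) w] by (simp add: D_def)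
    ultimately show ?thesis by simp
  qed
  \<comment> \<open>A covector parallel to both of the independent \<open>Y r\<close> and
    \<open>Y s\<close> is zero.\<close>
  have \<zeta>F: "scl (F w) (\<zeta> w) = dF w" if w: "w \<in> V" for w
  proof -
    let ?X = "scl (F w) (\<zeta> w) - dF w"
    have 1: "wd ?X (Y r w) = 0"
    proof (rule claim[of r s t])
      show "F w = f r w * f s w * f t w * wd (\<phi> w) (\<theta> w)" for w
        by (simp add: F_def mult_ac)
    qed (use \<eta> w rst e1[OF w] in \<open>auto simp: eta_form_def\<close>)
    have 2: "wd ?X (Y s w) = 0"
    proof (rule claim[of s t r])
      show "F w = f s w * f t w * f r w * wd (\<phi> w) (\<theta> w)" for w
        by (simp add: F_def mult_ac)
    qed (use \<eta> w rst e2[OF w] in \<open>auto simp: eta_form_def\<close>)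
    have "wd (Y r w) (Y s w) = (l s w * x r - l r w * x s) * wd (\<phi> w) (\<theta> w)"
      by (simp add: Y_def wd_simps wd_swap[of "\<theta> w" "\<phi> w"] algebra_simps)
    then have nz: "wd (Y r w) (Y s w) \<noteq> 0" using \<Delta>[of r s w] rst w J by simp
    have "fst ?X * wd (Y r w) (Y s w) = 0" "snd ?X * wd (Y r w) (Y s w) = 0"
      using 1 2 unfolding wd_def by algebra+
    then show ?thesis using nz by (simp add: prod_eq_iff)
  qed
  obtain e where e: "has_ext \<eta> e z"
    using \<eta> z by (auto simp: eta_form_def holomorphic_form_iff_has_ext)
  obtain \<alpha>' where \<alpha>': "has_diff \<alpha> (scl \<alpha>' (\<phi> z)) z" using \<alpha>[OF z] by (auto simp: basic_def)
  have \<zeta>: "has_ext \<zeta> (e - \<beta>' z * wd (\<phi> z) (\<theta> z)) z"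
    unfolding \<zeta>_def
    by (rule has_ext_eq[OF has_ext_diff[OF has_ext_diff[OF e has_ext_scl[OF \<alpha>' \<phi>[OF z]]] has_ext_scl[OF \<beta>[OF z] \<theta>[OF z]]]])
      (simp add: wd_simps)
  \<comment> \<open>0 = d(dF) = d(F \<zeta>) = dF \<and> \<zeta> + F d\<zeta>, and dF = F \<zeta>
    removes the first term, so \<zeta> is closed.\<close>
  have "wd (dF z) (\<zeta> z) + F z * (e - \<beta>' z * wd (\<phi> z) (\<theta> z)) = 0"
    using dF \<zeta>F by (intro mixed_partials_commute[OF V z _ has_ext_scl[OF dF[OF z] \<zeta>], of F]) simp
  then have "e = \<beta>' z * wd (\<phi> z) (\<theta> z)"
    using F0[OF z] by (simp add: \<zeta>F[OF z, symmetric] wd_simps)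
  then show ?thesis using e by simp
qed

text \<open>The three equations have sum 0 = 0, so they are consistent in the two unknowns \<alpha>
  and \<beta>. Eliminating \<alpha> gives \<beta> as minus the second divided difference of the
  primed values at the nodes x, y, z.\<close>

lemma divided_differences:
  fixes x y z x' y' z' :: complex
  assumes "x \<noteq> y" "y \<noteq> z" "z \<noteq> x"
  defines "\<beta> \<equiv> - (x' / ((x - y) * (x - z)) + y' / ((y - x) * (y - z)) + z' / ((z - x) * (z - y)))"
  defines "\<alpha> \<equiv> (z' - y') / (z - y) - \<beta> * x"
  shows "z' - y' = (z - y) * (\<alpha> + \<beta> * x)" "x' - z' = (x - z) * (\<alpha> + \<beta> * y)"
    "y' - x' = (y - x) * (\<alpha> + \<beta> * z)"
proof -
  define u v where "u = y - x" and "v = z - y"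
  have y: "y = x + u" and z: "z = x + u + v" by (simp_all add: u_def v_def)
  have nz: "u \<noteq> 0" "v \<noteq> 0" "u + v \<noteq> 0" using assms(1-3) by (auto simp: y z)
  have xy: "x - y = - u" "x - z = - (u + v)" "y - x = u" "y - z = - v" "z - x = u + v" "z - y = v"
    by (simp_all add: y z)
  have \<beta>: "\<beta> = - (x' / (u * (u + v)) - y' / (u * v) + z' / ((u + v) * v))"
    unfolding \<beta>_def xy by (simp only: minus_mult_minus mult_minus_left mult_minus_right divide_minus_right minus_minus add_uminus_conv_diff)
  have \<alpha>: "\<alpha> + \<beta> * x = (z' - y') / v" by (simp add: \<alpha>_def y z)
  have \<beta>u: "\<beta> * u = (x' - z') / (- (u + v)) - (z' - y') / v"
    and \<beta>uv: "\<beta> * (u + v) = (y' - x') / u - (z' - y') / v"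
  proof -
    \<comment> \<open>With the inverses as further variables subject to \<open>ijk\<close>, the
      claims become polynomial identities.\<close>
    define i j k where "i = inverse u" and "j = inverse v" and "k = inverse (u + v)"
    have ijk: "u * i = 1" "v * j = 1" "(u + v) * k = 1" using nz by (simp_all add: i_def j_def k_def)
    have \<beta>': "\<beta> = - (x' * (i * k) - y' * (i * j) + z' * (k * j))"
      unfolding \<beta> divide_inverse inverse_mult_distrib i_def j_def k_def ..
    have "\<beta> * u = - ((x' - z') * k) - (z' - y') * j" "\<beta> * (u + v) = (y' - x') * i - (z' - y') * j"
      unfolding \<beta>' using ijk by algebra+
    then show "\<beta> * u = (x' - z') / (- (u + v)) - (z' - y') / v"
      "\<beta> * (u + v) = (y' - x') / u - (z' - y') / v"
      by (simp_all only: i_def j_def k_def divide_inverse inverse_minus_eq mult_minus_right)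
  qed
  show "z' - y' = (z - y) * (\<alpha> + \<beta> * x)" using nz by (simp add: \<alpha> y z)
  have "\<alpha> + \<beta> * y = (\<alpha> + \<beta> * x) + \<beta> * u" by (simp add: y algebra_simps)
  then have "\<alpha> + \<beta> * y = (x' - z') / (- (u + v))" unfolding \<alpha> \<beta>u by simp
  then show "x' - z' = (x - z) * (\<alpha> + \<beta> * y)" 
    using nz(3) xy(2) by (metis neg_equal_0_iff_equal nonzero_eq_divide_eq mult.commute)
  have "\<alpha> + \<beta> * z = (\<alpha> + \<beta> * x) + \<beta> * (u + v)" by (simp add: z algebra_simps)
  then have "\<alpha> + \<beta> * z = (y' - x') / u" unfolding \<alpha> \<beta>uv by simp
  then show "y' - x' = (y - x) * (\<alpha> + \<beta> * z)" using nz by (simp add: y)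
qed

section \<open>Symmetrization of sums over increasing triples\<close>

lemma square_of_sum:
  fixes f :: "nat \<Rightarrow> complex"
  assumes "finite A"
  shows "(\<Sum>s\<in>A. f s)\<^sup>2 - (\<Sum>s\<in>A. (f s)\<^sup>2) = 2 * (\<Sum>(s, t) | s \<in> A \<and> t \<in> A \<and> s < t. f s * f t)"
proof -
  let ?g = "\<lambda>(s, t). f s * f t"
  let ?L = "{(s, t). s \<in> A \<and> t \<in> A \<and> s < t}"
  have fin: "finite ?L" by (rule finite_subset[of _ "A \<times> A"]) (use assms in auto)
  have un: "A \<times> A = ((\<lambda>s. (s, s)) ` A \<union> ?L) \<union> prod.swap ` ?L"
    by (auto simp: image_iff)
  have "(\<Sum>s\<in>A. f s)\<^sup>2 = sum ?g (A \<times> A)"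
    by (simp add: power2_eq_square sum_product sum.cartesian_product)
  also have "\<dots> = sum ?g ((\<lambda>s. (s, s)) ` A) + sum ?g ?L + sum ?g (prod.swap ` ?L)"
  proof -
    have "sum ?g (A \<times> A) = sum ?g ((\<lambda>s. (s, s)) ` A \<union> ?L) + sum ?g (prod.swap ` ?L)"
      unfolding un by (rule sum.union_disjoint) (use fin assms in auto)
    also have "sum ?g ((\<lambda>s. (s, s)) ` A \<union> ?L) = sum ?g ((\<lambda>s. (s, s)) ` A) + sum ?g ?L"
      by (rule sum.union_disjoint) (use fin assms in auto)
    finally show ?thesis .
  qed
  also have "sum ?g ((\<lambda>s. (s, s)) ` A) = (\<Sum>s\<in>A. (f s)\<^sup>2)"
    by (subst sum.reindex) (auto simp: inj_on_def power2_eq_square)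
  also have "sum ?g (prod.swap ` ?L) = sum ?g ?L"
    by (subst sum.reindex) (auto simp: inj_on_def mult.commute intro!: sum.cong)
  finally show ?thesis by simp
qed

text \<open>A triple contributes one summand for each choice of the index that carries
  \<open>y\<close>; the other two form an unordered pair, and \<open>square_of_sum\<close> counts
  such pairs twice.\<close>

lemma sum_increasing_triples:
  fixes y :: "nat \<Rightarrow> complex" and x :: "nat \<Rightarrow> nat \<Rightarrow> complex"
  shows "2 * (\<Sum>(r, s, t) | r < s \<and> s < t \<and> t < d. y r * x r s * x r t + y s * x s r * x s t + y t * x t r * x t s)
    = (\<Sum>r<d. y r * ((\<Sum>s\<in>{..<d}-{r}. x r s)\<^sup>2 - (\<Sum>s\<in>{..<d}-{r}. (x r s)\<^sup>2)))"
proof -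
  let ?T = "{(r, s, t). r < s \<and> s < t \<and> t < d}"
  let ?g = "\<lambda>(r, s, t). y r * x r s * x r t"
  let ?p = "\<lambda>(r, s, t). (s, r, t)" and ?q = "\<lambda>(r, s, t). (t, r, s)"
  have fin: "finite ?T" by (rule finite_subset[of _ "{..<d} \<times> {..<d} \<times> {..<d}"]) auto
  have "(\<Sum>r<d. y r * ((\<Sum>s\<in>{..<d}-{r}. x r s)\<^sup>2 - (\<Sum>s\<in>{..<d}-{r}. (x r s)\<^sup>2)))
      = (\<Sum>r<d. 2 * (\<Sum>(s, t) | s \<in> {..<d}-{r} \<and> t \<in> {..<d}-{r} \<and> s < t. y r * x r s * x r t))"
    by (rule sum.cong) (simp_all add: square_of_sum sum_distrib_left case_prod_unfold mult.assoc mult.left_commute)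
  also have "\<dots> = 2 * (\<Sum>r<d. \<Sum>(s, t) | s \<in> {..<d}-{r} \<and> t \<in> {..<d}-{r} \<and> s < t. y r * x r s * x r t)"
    by (rule sum_distrib_left[symmetric])
  also have "(\<Sum>r<d. \<Sum>(s, t) | s \<in> {..<d}-{r} \<and> t \<in> {..<d}-{r} \<and> s < t. y r * x r s * x r t)
      = sum ?g (SIGMA r:{..<d}. {(s, t). s \<in> {..<d}-{r} \<and> t \<in> {..<d}-{r} \<and> s < t})"
    by (subst sum.Sigma) (auto simp: case_prod_unfold intro: finite_subset[of _ "{..<d} \<times> {..<d}"])
  \<comment> \<open>The distinguished index lies below, between or above the two others.\<close>
  also have "(SIGMA r:{..<d}. {(s, t). s \<in> {..<d}-{r} \<and> t \<in> {..<d}-{r} \<and> s < t}) = (?T \<union> ?p ` ?T) \<union> ?q ` ?T"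
    by (auto simp: image_iff)
  also have "sum ?g \<dots> = sum ?g (?T \<union> ?p ` ?T) + sum ?g (?q ` ?T)"
    by (rule sum.union_disjoint) (use fin in auto)
  also have "sum ?g (?T \<union> ?p ` ?T) = sum ?g ?T + sum ?g (?p ` ?T)"
    by (rule sum.union_disjoint) (use fin in auto)
  also have "sum ?g (?p ` ?T) = sum (\<lambda>(r, s, t). y s * x s r * x s t) ?T"
    by (subst sum.reindex) (auto simp: inj_on_def intro!: sum.cong)
  also have "sum ?g (?q ` ?T) = sum (\<lambda>(r, s, t). y t * x t r * x t s) ?T"
    by (subst sum.reindex) (auto simp: inj_on_def intro!: sum.cong)
  finally show ?thesis by (simp add: sum.distrib[symmetric] case_prod_unfold)
qed


text \<open>\<open>i0\<close> is the index of the foliation dual to \<ell>. By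
  \<open>ext_eta_form\<close> the exterior derivative of each \<eta> is the derivative of its
  \<beta> times \<open>\<phi>\<close> \<and> \<open>\<theta>\<close>, and the \<beta> of all triples
  add up to half of \<open>pair_sum\<close>, a constant.\<close>

lemma (in convex_pencil) curvature_eq_0:
  fixes om :: "nat \<Rightarrow> form1" and \<phi> \<theta> :: form1 and \<epsilon> :: complex
  assumes V: "open V" and \<phi>: "\<And>z. z \<in> V \<Longrightarrow> has_ext \<phi> 0 z" and \<theta>: "\<And>z. z \<in> V \<Longrightarrow> has_ext \<theta> 0 z"
    and J: "\<And>z. z \<in> V \<Longrightarrow> wd (\<phi> z) (\<theta> z) \<noteq> 0"
    and Pf: "\<And>z. z \<in> V \<Longrightarrow> has_diff Pf (\<phi> z) z"
    and i0: "i0 < Suc n" and \<epsilon>: "\<epsilon> = 0 \<or> \<epsilon> = 1"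
    and root: "\<And>i z. i < Suc n \<Longrightarrow> i \<noteq> i0 \<Longrightarrow> z \<in> V \<Longrightarrow> poly (T (Pf z)) (tt i z) = 0"
    and root_neq: "\<And>i z. i < Suc n \<Longrightarrow> i \<noteq> i0 \<Longrightarrow> z \<in> V \<Longrightarrow> Pf z \<noteq> tt i z"
    and tt_diff: "\<And>i z. i < Suc n \<Longrightarrow> i \<noteq> i0 \<Longrightarrow> z \<in> V \<Longrightarrow> \<exists>A. has_diff (tt i) A z"
    and tt_inj: "\<And>i j z. i < Suc n \<Longrightarrow> i \<noteq> i0 \<Longrightarrow> j < Suc n \<Longrightarrow> j \<noteq> i0 \<Longrightarrow> i \<noteq> j \<Longrightarrow> z \<in> V \<Longrightarrow> tt i z \<noteq> tt j z"
    and om: "\<And>i z. i < Suc n \<Longrightarrow> i \<noteq> i0 \<Longrightarrow> z \<in> V \<Longrightarrow>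
      om i z = scl (f i z) (\<theta> z - scl (1 / (Pf z - tt i z)) (\<phi> z))"
    and om0: "\<And>z. z \<in> V \<Longrightarrow> om i0 z = scl (f i0 z) (if \<epsilon> = 1 then \<theta> z else \<phi> z)"
    and f: "\<And>i z. i < Suc n \<Longrightarrow> z \<in> V \<Longrightarrow> \<exists>A. has_diff (f i) A z"
    and f0: "\<And>i z. i < Suc n \<Longrightarrow> z \<in> V \<Longrightarrow> f i z \<noteq> 0"
    and \<eta>: "\<And>r s t. r < s \<Longrightarrow> s < t \<Longrightarrow> t < Suc n \<Longrightarrow> eta_form V (om r) (om s) (om t) (\<eta> r s t)"
    and z0: "z0 \<in> V"
  shows "curvature (Suc n) \<eta> z0 = 0"
proof -
  define I where "I = {..<Suc n} - {i0}"
  have I: "i \<in> I \<longleftrightarrow> i < Suc n \<and> i \<noteq> i0" for i by (auto simp: I_def)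
  have fI: "finite I" and cI: "card I = n" using i0 by (auto simp: I_def)
  have tt_I: "inj_on (\<lambda>i. tt i z) I" "(\<lambda>i. tt i z) ` I = R (Pf z)" "card (R (Pf z)) = n" if z: "z \<in> V" for z
  proof -
    show inj: "inj_on (\<lambda>i. tt i z) I" using tt_inj[OF _ _ _ _ _ z] by (intro inj_onI) (metis I)
    have fin: "finite (R (Pf z))" unfolding R_def using T_nz by (rule poly_roots_finite)
    have sub: "(\<lambda>i. tt i z) ` I \<subseteq> R (Pf z)" using root[OF _ _ z] by (auto simp: R_def I)
    moreover have "card (R (Pf z)) \<le> n"
      using card_poly_roots_bound[OF T_nz, of "Pf z"] by (simp add: R_def degree_T)
    ultimately show eq: "(\<lambda>i. tt i z) ` I = R (Pf z)"
      using card_image[OF inj] cI fin by (intro card_subset_eq) (auto dest: card_mono[OF fin])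
    show "card (R (Pf z)) = n" using card_image[OF inj] cI eq by simp
  qed
  define dT where "dT i z = poly (pderiv a) (tt i z) + Pf z * poly (pderiv b) (tt i z)" for i z
  have dT: "dT i z = poly (pderiv (T (Pf z))) (tt i z)" for i z
    by (simp add: dT_def T_def pderiv_add pderiv_smult)
  have dT0: "dT i z \<noteq> 0" if "i \<in> I" "z \<in> V" for i z
    unfolding dT using split_poly.pderiv_T_nz[OF split_T[OF tt_I(3)[OF that(2)]]] tt_I(2)[OF that(2)] that(1)
    by blast
  \<comment> \<open>Implicit differentiation of a(t) + P b(t) = 0; uniqueness of the differential
    stands in for solving the equation.\<close>
  have tt': "has_diff (tt i) (scl (- (poly b (tt i z) / dT i z)) (\<phi> z)) z" if i: "i \<in> I" and z: "z \<in> V" for i z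
  proof -
    obtain A where A: "has_diff (tt i) A z" using tt_diff[OF _ _ z, of i] i by (auto simp: I)
    have "has_diff (\<lambda>z. poly a (tt i z) + Pf z * poly b (tt i z))
      (scl (poly (pderiv a) (tt i z)) A + (scl (Pf z) (scl (poly (pderiv b) (tt i z)) A) + scl (poly b (tt i z)) (\<phi> z))) z"
      by (intro has_diff_add has_diff_mult has_diff_comp[OF A poly_DERIV] Pf z)
    moreover have "has_diff (\<lambda>z. poly a (tt i z) + Pf z * poly b (tt i z)) 0 z"
      by (rule has_diff_cong[OF has_diff_const[of 0] V z]) (use root[of i] i in \<open>simp add: I T_def\<close>)
    ultimately have "scl (poly (pderiv a) (tt i z)) A + (scl (Pf z) (scl (poly (pderiv b) (tt i z)) A)
        + scl (poly b (tt i z)) (\<phi> z)) = 0"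
      by (rule has_diff_unique)
    then have A_eq: "scl (dT i z) A + scl (poly b (tt i z)) (\<phi> z) = 0"
      by (simp add: dT_def scl_def prod_eq_iff distrib_right add.assoc mult.assoc)
    have div: "u = - (b' * v / c)" if "c * u + b' * v = 0" "c \<noteq> 0" for u v b' c :: complex
    proof -
      have "c * u = - (b' * v)" using that(1) by (simp add: eq_neg_iff_add_eq_0)
      then have "u = - (b' * v) / c" using that(2) by (metis nonzero_mult_div_cancel_left)
      then show ?thesis by simp
    qed
    have "A = scl (- (poly b (tt i z) / dT i z)) (\<phi> z)"
      using A_eq dT0[OF i z] by (auto simp: scl_def prod_eq_iff intro!: div)
    then show ?thesis using A by simp
  qed
  have Pf_basic: "basic \<phi> z Pf" if "z \<in> V" for z
    using Pf[OF that] by (auto simp: basic_def scl_simps intro!: exI[of _ 1])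
  have tt_basic: "basic \<phi> z (tt i)" if "i \<in> I" "z \<in> V" for i z
    using tt'[OF that] by (auto simp: basic_def)
  define y where "y i z = (if i = i0 then 0 else 1 + poly b (tt i z) / dT i z)" for i z
  have y_basic: "basic \<phi> z (y i)" if "i < Suc n" "z \<in> V" for i z
  proof (cases "i = i0")
    case False
    then have i: "i \<in> I" using that by (simp add: I)
    have "basic \<phi> z (dT i)"
      unfolding dT_def[abs_def] by (intro basic_add basic_mult basic_poly tt_basic Pf_basic i that)
    then have "basic \<phi> z (\<lambda>z. 1 + poly b (tt i z) / dT i z)"
      by (intro basic_add basic_const basic_divide basic_poly tt_basic i that dT0)
    then show ?thesis using False by (simp add: y_def[abs_def])
  qed (simp add: y_def[abs_def] basic_const)
  \<comment> \<open>\<open>om i\<close> is a multiple of \<open>x i\<close> \<theta> -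
    \<open>l i\<close> \<phi>. For \<open>i0\<close> the pair (x, l) is (1, 0) if \<epsilon> = 1 and
    (0, -1) if \<epsilon> = 0; for the others it is (1, 1 / (P - t)).\<close>
  define x where "x i = (if i = i0 then \<epsilon> else 1)" for i
  define l where "l i z = (if i = i0 then \<epsilon> - 1 else 1 / (Pf z - tt i z))" for i z
  define l' where "l' i z = - (l i z)\<^sup>2 * y i z" for i z
  have l_diff: "has_diff (l i) (scl (l' i z) (\<phi> z)) z" if "i < Suc n" and z: "z \<in> V" for i z
  proof (cases "i = i0")
    case True
    then show ?thesis using has_diff_const[of "\<epsilon> - 1" z] by (simp add: l_def[abs_def] l'_def y_def scl_simps)
  next
    case False
    then have i: "i \<in> I" using that by (simp add: I)
    have nz: "Pf z - tt i z \<noteq> 0" using root_neq[OF _ _ z] i by (simp add: I)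
    have "has_diff (\<lambda>z. 1 / (Pf z - tt i z)) (scl (1 / (Pf z - tt i z)) 0
        - scl (1 / (Pf z - tt i z)\<^sup>2) (\<phi> z - scl (- (poly b (tt i z) / dT i z)) (\<phi> z))) z"
      by (intro has_diff_divide has_diff_const has_diff_diff Pf tt' i that nz)
    then show ?thesis
      using False by (simp add: l_def[abs_def] l'_def y_def) (erule has_diff_eq, simp add: scl_def prod_eq_iff power_divide add_divide_distrib algebra_simps)
  qed
  have l_basic: "basic \<phi> z (l i)" if "i < Suc n" "z \<in> V" for i z
    using l_diff[OF that] by (auto simp: basic_def)
  have l'_basic: "basic \<phi> z (l' i)" if "i < Suc n" "z \<in> V" for i z
  proof -
    have "basic \<phi> z (\<lambda>z. (0 - l i z * l i z) * y i z)"
      by (intro basic_mult basic_diff basic_const l_basic y_basic that)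
    then show ?thesis by (simp add: l'_def[abs_def] power2_eq_square)
  qed
  have l_inj: "l i z \<noteq> l j z" if "i < Suc n" "j < Suc n" "i \<noteq> j" "\<epsilon> = 1 \<or> i \<noteq> i0 \<and> j \<noteq> i0" "z \<in> V" for i j z
    using that root_neq[of i z] root_neq[of j z] tt_inj[of i j z] by (auto simp: l_def)
  \<comment> \<open>This is l_i / (l_i - l_j) in terms of the roots, so that y_i X_ij X_ik is a
    summand of the divided difference. For \<epsilon> = 0 the value at j = i0 makes \<beta> vanish
    on every triple through \<open>i0\<close>; the value at i = i0 always meets the factor y =
    0.\<close>
  define X where "X i j z = (if j = i0 then \<epsilon> else if i = i0 then 0 else 1 + (Pf z - tt i z) / (tt i z - tt j z))" for i j z
  define \<beta> where "\<beta> r s t z = y r z * X r s z * X r t z + y s z * X s r z * X s t z + y t z * X t r z * X t s z" for r s t z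
  define Tr where "Tr = {(r, s, t). r < s \<and> s < t \<and> t < Suc n}"
  have X_basic: "basic \<phi> z (X i j)" if "i < Suc n" "j < Suc n" "i \<noteq> j" "z \<in> V" for i j z
  proof (cases "i = i0 \<or> j = i0")
    case True
    then have "X i j = (\<lambda>z. if j = i0 then \<epsilon> else 0)" by (auto simp: X_def)
    then show ?thesis by (simp add: basic_const)
  next
    case False
    then have ij: "i \<in> I" "j \<in> I" using that by (auto simp: I)
    have "tt i z - tt j z \<noteq> 0" using tt_inj that False by simp
    then have "basic \<phi> z (\<lambda>z. 1 + (Pf z - tt i z) / (tt i z - tt j z))"
      by (intro basic_add basic_const basic_divide basic_diff Pf_basic tt_basic ij that)
    then show ?thesis using False by (simp add: X_def[abs_def])
  qed
  have \<beta>_basic: "basic \<phi> z (\<beta> r s t)" if "(r, s, t) \<in> Tr" "z \<in> V" for r s t z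
    unfolding \<beta>_def[abs_def] using that by (intro basic_add basic_mult X_basic y_basic) (auto simp: Tr_def)
  have yX: "y i z * X i j z * X i k z = - (l' i z / ((l i z - l j z) * (l i z - l k z)))"
    if "i < Suc n" "j < Suc n" "k < Suc n" "i \<noteq> j" "i \<noteq> k"
      and e: "\<epsilon> = 1 \<or> i \<noteq> i0 \<and> j \<noteq> i0 \<and> k \<noteq> i0" and z: "z \<in> V" for i j k z
  proof (cases "i = i0")
    case False
    have li: "l i z \<noteq> 0" using False root_neq[of i z] that by (simp add: l_def)
    have Xl: "X i m z = l i z / (l i z - l m z)" if m: "m < Suc n" "m \<noteq> i" "\<epsilon> = 1 \<or> m \<noteq> i0" for m
    proof (cases "m = i0")
      case True
      then show ?thesis using m li by (auto simp: X_def l_def)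
    next
      case False
      have nz: "Pf z - tt i z \<noteq> 0" "Pf z - tt m z \<noteq> 0" "tt i z - tt m z \<noteq> 0"
        using root_neq[of i z] root_neq[of m z] tt_inj[of i m z] that False \<open>i \<noteq> i0\<close> z \<open>i < Suc n\<close> m by auto
      have "l i z - l m z = (tt i z - tt m z) / ((Pf z - tt i z) * (Pf z - tt m z))"
        using nz False \<open>i \<noteq> i0\<close> by (simp add: l_def diff_frac_eq)
      then show ?thesis
        using nz False \<open>i \<noteq> i0\<close> by (simp add: X_def l_def add_divide_eq_iff)
    qed
    have "X i j z = l i z / (l i z - l j z)" "X i k z = l i z / (l i z - l k z)"
      using Xl[of j] Xl[of k] that by auto
    then show ?thesis by (simp add: l'_def power2_eq_square)
  qed (simp add: y_def l'_def)
  have ext: "\<exists>\<beta>'. has_diff (\<beta> r s t) (scl \<beta>' (\<phi> z0)) z0 \<and> has_ext (\<eta> r s t) (\<beta>' * wd (\<phi> z0) (\<theta> z0)) z0"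
    if rst: "(r, s, t) \<in> Tr" for r s t
  proof -
    have lt: "r < Suc n" "s < Suc n" "t < Suc n" and neq: "r \<noteq> s" "s \<noteq> t" "t \<noteq> r" using rst by (auto simp: Tr_def)
    obtain \<beta>' where \<beta>': "\<And>z. z \<in> V \<Longrightarrow> has_diff (\<beta> r s t) (scl (\<beta>' z) (\<phi> z)) z"
      using \<beta>_basic[OF rst] unfolding basic_def by metis
    \<comment> \<open>If \<open>\<phi>\<close> itself is one of the three foliations, \<alpha> =
      \<beta> = 0 works: both sides of all three equations vanish.\<close>
    define \<alpha> where "\<alpha> z = (if \<epsilon> = 1 \<or> i0 \<notin> {r, s, t}
      then (l' t z - l' s z) / (l t z - l s z) - \<beta> r s t z * l r z else 0)" for z
    have \<alpha>_basic: "basic \<phi> z \<alpha>" if z: "z \<in> V" for z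
    proof (cases "\<epsilon> = 1 \<or> i0 \<notin> {r, s, t}")
      case True
      have "l t z - l s z \<noteq> 0" using l_inj[of t s z] True lt neq z by auto
      then have "basic \<phi> z (\<lambda>z. (l' t z - l' s z) / (l t z - l s z) - \<beta> r s t z * l r z)"
        by (intro basic_diff basic_divide basic_mult l'_basic l_basic \<beta>_basic rst lt z)
      then show ?thesis using True by (simp add: \<alpha>_def[abs_def])
    qed (simp add: \<alpha>_def[abs_def] basic_const)
    have eqs: "x r * (l' t z * x s - l' s z * x t) = (l t z * x s - l s z * x t) * (\<alpha> z * x r + \<beta> r s t z * l r z)" (is ?A)
      "x s * (l' r z * x t - l' t z * x r) = (l r z * x t - l t z * x r) * (\<alpha> z * x s + \<beta> r s t z * l s z)" (is ?B)
      "x t * (l' s z * x r - l' r z * x s) = (l s z * x r - l r z * x s) * (\<alpha> z * x t + \<beta> r s t z * l t z)" (is ?C)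
      if z: "z \<in> V" for z
    proof -
      have "?A \<and> ?B \<and> ?C"
      proof (cases "\<epsilon> = 1 \<or> i0 \<notin> {r, s, t}")
        case True
        have x1: "x r = 1" "x s = 1" "x t = 1" using True by (auto simp: x_def)
        have \<beta>: "\<beta> r s t z = - (l' r z / ((l r z - l s z) * (l r z - l t z))
            + l' s z / ((l s z - l r z) * (l s z - l t z)) + l' t z / ((l t z - l r z) * (l t z - l s z)))"
        proof -
          have 1: "\<epsilon> = 1 \<or> r \<noteq> i0 \<and> s \<noteq> i0 \<and> t \<noteq> i0" using True by auto
          have "y r z * X r s z * X r t z = - (l' r z / ((l r z - l s z) * (l r z - l t z)))"
            "y s z * X s r z * X s t z = - (l' s z / ((l s z - l r z) * (l s z - l t z)))"
            "y t z * X t r z * X t s z = - (l' t z / ((l t z - l r z) * (l t z - l s z)))"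
            by (rule yX; use 1 lt neq z in blast)+
          then show ?thesis by (simp add: \<beta>_def)
        qed
        have li: "l r z \<noteq> l s z" "l s z \<noteq> l t z" "l t z \<noteq> l r z"
          using l_inj[of r s z] l_inj[of s t z] l_inj[of t r z] True lt neq z by auto
        note dd = divided_differences[OF li, where x' = "l' r z" and y' = "l' s z" and z' = "l' t z", folded \<beta>]
        have \<alpha>: "\<alpha> z = (l' t z - l' s z) / (l t z - l s z) - \<beta> r s t z * l r z" using True by (simp add: \<alpha>_def)
        show ?thesis using dd[folded \<alpha>] by (simp add: x1)
      next
        case False
        then have \<epsilon>0: "\<epsilon> = 0" and or: "i0 = r \<or> i0 = s \<or> i0 = t" using \<epsilon> by auto
        have "\<beta> r s t z = 0" using or neq by (auto simp: \<beta>_def X_def y_def \<epsilon>0)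
        moreover have "\<alpha> z = 0" using False by (simp add: \<alpha>_def)
        ultimately show ?thesis using or neq by (auto simp: x_def \<epsilon>0 l'_def y_def)
      qed
      then show ?A ?B ?C by blast+
    qed
    have "has_ext (\<eta> r s t) (\<beta>' z0 * wd (\<phi> z0) (\<theta> z0)) z0"
    proof (rule ext_eta_form[OF V \<phi> \<theta> J, where om = om and f = f and x = x and l = l and l' = l' and r = r and s = s and t = t
          and \<alpha> = \<alpha> and \<beta> = "\<beta> r s t" and \<beta>' = \<beta>'])
      show "om i z = scl (f i z) (scl (x i) (\<theta> z) - scl (l i z) (\<phi> z))" if "i \<in> {r, s, t}" "z \<in> V" for i z
      proof (cases "i = i0")
        case True
        then show ?thesis using om0[OF that(2)] \<epsilon> by (auto simp: x_def l_def scl_simps scl_def prod_eq_iff)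
      next
        case False
        then show ?thesis using om[of i z] that lt by (auto simp: x_def l_def scl_simps)
      qed
      show "l j z * x i - l i z * x j \<noteq> 0" if "i \<in> {r, s, t}" "j \<in> {r, s, t}" "i \<noteq> j" "z \<in> V" for i j z
        using l_inj[of i j z] that lt \<epsilon> by (cases "\<epsilon> = 1"; cases "i = i0"; cases "j = i0") (auto simp: x_def l_def)
      show "\<exists>A. has_diff (f i) A z" "f i z \<noteq> 0" "has_diff (l i) (scl (l' i z) (\<phi> z)) z"
        if "i \<in> {r, s, t}" "z \<in> V" for i z
        using that(1) lt f[OF _ that(2)] f0[OF _ that(2)] l_diff[OF _ that(2)] by blast+
      show "eta_form V (om r) (om s) (om t) (\<eta> r s t)"
        using rst by (intro \<eta>) (simp_all add: Tr_def)
    qed (assumption | rule neq \<alpha>_basic \<beta>' eqs z0)+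
    then show ?thesis using \<beta>'[OF z0] by blast
  qed
  obtain \<kappa> where \<kappa>: "\<And>P. card (R P) = n \<Longrightarrow> pair_sum \<epsilon> P = \<kappa>" using pair_sum_const by blast
  have sum_\<beta>: "(\<Sum>(r, s, t)\<in>Tr. \<beta> r s t z) = \<kappa> / 2" if z: "z \<in> V" for z
  proof -
    let ?X = "\<lambda>r s. 1 + (Pf z - r) / (r - s)"
    have "2 * (\<Sum>(r, s, t)\<in>Tr. \<beta> r s t z)
      = (\<Sum>r<Suc n. y r z * ((\<Sum>s\<in>{..<Suc n}-{r}. X r s z)\<^sup>2 - (\<Sum>s\<in>{..<Suc n}-{r}. (X r s z)\<^sup>2)))"
      unfolding Tr_def \<beta>_def by (rule sum_increasing_triples)
    also have "\<dots> = (\<Sum>r\<in>I. y r z * ((\<Sum>s\<in>{..<Suc n}-{r}. X r s z)\<^sup>2 - (\<Sum>s\<in>{..<Suc n}-{r}. (X r s z)\<^sup>2)))"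
      unfolding I_def using i0 by (subst sum.remove[of _ i0]) (auto simp: y_def)
    also have "\<dots> = (\<Sum>r\<in>I. (1 + poly b (tt r z) / poly (pderiv (T (Pf z))) (tt r z)) *
       (2 * \<epsilon> * (\<Sum>s\<in>R (Pf z) - {tt r z}. ?X (tt r z) s) +
        ((\<Sum>s\<in>R (Pf z) - {tt r z}. ?X (tt r z) s)\<^sup>2
          - (\<Sum>s\<in>R (Pf z) - {tt r z}. (?X (tt r z) s)\<^sup>2))))"
    proof (rule sum.cong[OF refl])
      fix r assume r: "r \<in> I"
      have set: "{..<Suc n} - {r} = insert i0 (I - {r})" using r i0 by (auto simp: I_def)
      have notin: "i0 \<notin> I - {r}" by (simp add: I_def)
      have reg: "(\<Sum>s\<in>I - {r}. g (X r s z)) = (\<Sum>s\<in>R (Pf z) - {tt r z}. g (?X (tt r z) s))" for g :: "complex \<Rightarrow> complex"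
      proof -
        have "R (Pf z) - {tt r z} = (\<lambda>i. tt i z) ` (I - {r})"
          using tt_I(1,2)[OF z] r by (auto simp: inj_on_def)
        then show ?thesis
          using r tt_I(1)[OF z] by (simp add: sum.reindex[OF inj_on_subset[OF tt_I(1)[OF z]]]) (auto simp: X_def I intro!: sum.cong)
      qed
      have s1: "(\<Sum>s\<in>{..<Suc n}-{r}. X r s z) = \<epsilon> + (\<Sum>s\<in>R (Pf z) - {tt r z}. ?X (tt r z) s)"
        unfolding set using notin fI reg[of "\<lambda>v. v"] by (simp add: X_def[of r i0])
      have s2: "(\<Sum>s\<in>{..<Suc n}-{r}. (X r s z)\<^sup>2) = \<epsilon>\<^sup>2 + (\<Sum>s\<in>R (Pf z) - {tt r z}. (?X (tt r z) s)\<^sup>2)"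
        unfolding set using notin fI reg[of "\<lambda>v. v\<^sup>2"] by (simp add: X_def[of r i0])
      have yr: "y r z = 1 + poly b (tt r z) / poly (pderiv (T (Pf z))) (tt r z)" using r by (simp add: y_def dT I)
      show "y r z * ((\<Sum>s\<in>{..<Suc n}-{r}. X r s z)\<^sup>2 - (\<Sum>s\<in>{..<Suc n}-{r}. (X r s z)\<^sup>2)) =
        (1 + poly b (tt r z) / poly (pderiv (T (Pf z))) (tt r z)) *
       (2 * \<epsilon> * (\<Sum>s\<in>R (Pf z) - {tt r z}. ?X (tt r z) s) +
        ((\<Sum>s\<in>R (Pf z) - {tt r z}. ?X (tt r z) s)\<^sup>2
          - (\<Sum>s\<in>R (Pf z) - {tt r z}. (?X (tt r z) s)\<^sup>2)))"
        unfolding s1 s2 yr power2_sum by (simp add: algebra_simps)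
    qed
    also have "\<dots> = pair_sum \<epsilon> (Pf z)"
      unfolding pair_sum_def tt_I(2)[OF z, symmetric] sum.reindex[OF tt_I(1)[OF z]] o_def ..
    also have "\<dots> = \<kappa>" by (rule \<kappa>[OF tt_I(3)[OF z]])
    finally show ?thesis by (simp add: mult.commute)
  qed
  obtain \<beta>' where \<beta>': "\<And>u. u \<in> Tr \<Longrightarrow> has_diff (\<lambda>z. case u of (r, s, t) \<Rightarrow> \<beta> r s t z) (scl (\<beta>' u) (\<phi> z0)) z0"
      "\<And>u. u \<in> Tr \<Longrightarrow> has_ext (\<lambda>z. case u of (r, s, t) \<Rightarrow> \<eta> r s t z) (\<beta>' u * wd (\<phi> z0) (\<theta> z0)) z0"
  proof -
    have "\<forall>u\<in>Tr. \<exists>b'. has_diff (\<lambda>z. case u of (r, s, t) \<Rightarrow> \<beta> r s t z) (scl b' (\<phi> z0)) z0 \<and>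
      has_ext (\<lambda>z. case u of (r, s, t) \<Rightarrow> \<eta> r s t z) (b' * wd (\<phi> z0) (\<theta> z0)) z0"
      using ext by auto
    then show ?thesis using that by metis
  qed
  \<comment> \<open>The sum of the \<beta> is constant, so its differential vanishes; the wedge
    product of this differential with \<theta> is the curvature.\<close>
  have "has_diff (\<lambda>z. \<Sum>u\<in>Tr. case u of (r, s, t) \<Rightarrow> \<beta> r s t z) (scl (\<Sum>u\<in>Tr. \<beta>' u) (\<phi> z0)) z0"
    using has_diff_sum[of Tr, OF \<beta>'(1)] by (simp add: sum_scl)
  moreover have "has_diff (\<lambda>z. \<Sum>u\<in>Tr. case u of (r, s, t) \<Rightarrow> \<beta> r s t z) 0 z0"
    using sum_\<beta> by (intro has_diff_cong[OF has_diff_const[of "\<kappa> / 2"] V z0]) simp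
  ultimately have "scl (\<Sum>u\<in>Tr. \<beta>' u) (\<phi> z0) = 0" by (rule has_diff_unique)
  then have "(\<Sum>u\<in>Tr. \<beta>' u) * wd (\<phi> z0) (\<theta> z0) = 0"
    by (simp flip: wd_simps(1)) (simp add: wd_simps)
  moreover have "has_ext (\<lambda>z. \<Sum>u\<in>Tr. case u of (r, s, t) \<Rightarrow> \<eta> r s t z) ((\<Sum>u\<in>Tr. \<beta>' u) * wd (\<phi> z0) (\<theta> z0)) z0"
    using has_ext_sum[of Tr, OF \<beta>'(2)] by (simp add: sum_distrib_right)
  ultimately show ?thesis
    using has_ext_ext_deriv by (simp add: curvature_def Tr_def)
qed

section \<open>Homogeneous foliations in an adapted chart\<close>

abbreviation v3 :: "complex \<Rightarrow> complex \<Rightarrow> complex \<Rightarrow> complex ^ 3" where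
  "v3 x y z \<equiv> vector [x, y, z]"

lemma v3_eta: "v3 (m $ 1) (m $ 2) (m $ 3) = m"
  by (simp add: vec_eq_iff forall_3)

lemma v3_eq_iff: "v3 x y z = v3 x' y' z' \<longleftrightarrow> x = x' \<and> y = y' \<and> z = z'"
  by (auto simp: vec_eq_iff forall_3)

lemma v3_eq_0_iff: "v3 x y z = 0 \<longleftrightarrow> x = 0 \<and> y = 0 \<and> z = 0"
  by (auto simp: vec_eq_iff forall_3)

lemma ex_v3: "\<exists>x y z. m = v3 x y z"
  by (metis v3_eta)

lemma cdot_eq: "cdot u v = u $ 1 * v $ 1 + u $ 2 * v $ 2 + u $ 3 * v $ 3"
  by (simp add: cdot_def sum_3)

lemma cdot_v_mult: "cdot (x v* M) e = cdot x (M *v e)"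
  by (simp add: cdot_eq vector_matrix_mult_def matrix_vector_mult_def sum_3 algebra_simps)

section \<open>Polynomial functions on C^3\<close>

lemma eval3_closed:
  assumes const: "\<And>c. (\<lambda>t. c) \<in> S"
    and add: "\<And>f g. f \<in> S \<Longrightarrow> g \<in> S \<Longrightarrow> (\<lambda>t. f t + g t) \<in> S"
    and mult: "\<And>f g. f \<in> S \<Longrightarrow> g \<in> S \<Longrightarrow> (\<lambda>t. f t * g t) \<in> S"
    and f: "f1 \<in> S" "f2 \<in> S" "f3 \<in> S"
  shows "(\<lambda>t. eval3 P (v3 (f1 t) (f2 t) (f3 t))) \<in> S"
proof -
  have 1: "(\<lambda>t. poly c (f1 t)) \<in> S" for c
    by (induction c) (auto intro!: const add mult f)
  have 2: "(\<lambda>t. poly (poly c [:f2 t:]) (f1 t)) \<in> S" for c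
    by (induction c) (auto intro!: const add mult f 1)
  have "(\<lambda>t. poly (poly (poly P [:[:f3 t:]:]) [:f2 t:]) (f1 t)) \<in> S"
    by (induction P) (auto intro!: const add mult f 2)
  then show ?thesis by (simp add: eval3_def)
qed

text \<open>Linear changes of coordinates are carried out on functions, where they are mere
  composition; \<open>eval3_inject\<close> leads back to elements of C[x][y][z].\<close>

definition polyfun :: "(complex ^ 3 \<Rightarrow> complex) \<Rightarrow> bool" where
  "polyfun f \<longleftrightarrow> (\<exists>P. f = eval3 P)"

lemma eval3_add: "eval3 (P + Q) m = eval3 P m + eval3 Q m"
  and eval3_mult: "eval3 (P * Q) m = eval3 P m * eval3 Q m"
  by (simp_all add: eval3_def)

lemma polyfun_const: "polyfun (\<lambda>m. c)"
  unfolding polyfun_def by (intro exI[of _ "[:[:[:c:]:]:]"]) (simp add: eval3_def fun_eq_iff)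

lemma polyfun_coord: "polyfun (\<lambda>m. m $ 1)" "polyfun (\<lambda>m. m $ 2)" "polyfun (\<lambda>m. m $ 3)"
  unfolding polyfun_def
  by (rule exI[of _ "[:[:[:0, 1:]:]:]"], simp add: eval3_def fun_eq_iff)
    (rule exI[of _ "[:[:0, 1:]:]"], simp add: eval3_def fun_eq_iff,
     rule exI[of _ "[:0, 1:]"], simp add: eval3_def fun_eq_iff)

lemma polyfun_add: "polyfun f \<Longrightarrow> polyfun g \<Longrightarrow> polyfun (\<lambda>m. f m + g m)"
  unfolding polyfun_def by (elim exE, rule_tac x = "P + Pa" in exI) (simp add: fun_eq_iff eval3_add)

lemma polyfun_mult: "polyfun f \<Longrightarrow> polyfun g \<Longrightarrow> polyfun (\<lambda>m. f m * g m)"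
  unfolding polyfun_def by (elim exE, rule_tac x = "P * Pa" in exI) (simp add: fun_eq_iff eval3_mult)

lemma polyfun_minus: "polyfun f \<Longrightarrow> polyfun (\<lambda>m. - f m)"
  using polyfun_mult[OF polyfun_const[of "-1"]] by simp

lemma polyfun_diff: "polyfun f \<Longrightarrow> polyfun g \<Longrightarrow> polyfun (\<lambda>m. f m - g m)"
  using polyfun_add[OF _ polyfun_minus] by simp

lemma polyfun_power: "polyfun f \<Longrightarrow> polyfun (\<lambda>m. f m ^ k)"
  by (induction k) (auto intro: polyfun_const polyfun_mult)

lemma polyfun_sum: "(\<And>i. i \<in> I \<Longrightarrow> polyfun (f i)) \<Longrightarrow> polyfun (\<lambda>m. \<Sum>i\<in>I. f i m)"
  by (induction I rule: infinite_finite_induct) (auto intro: polyfun_const polyfun_add)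

lemmas polyfun_intros = polyfun_const polyfun_coord polyfun_add polyfun_mult polyfun_minus
  polyfun_diff polyfun_power polyfun_sum

lemma polyfun_eval3: "polyfun (eval3 P)" unfolding polyfun_def by blast

lemma polyfun_subst:
  assumes "polyfun f" "polyfun f1" "polyfun f2" "polyfun f3"
  shows "polyfun (\<lambda>m. f (v3 (f1 m) (f2 m) (f3 m)))"
proof -
  obtain P where "f = eval3 P" using assms by (auto simp: polyfun_def)
  then show ?thesis
    using eval3_closed[of "Collect polyfun" f1 f2 f3 P] assms by (simp add: polyfun_intros)
qed

lemma polyfun_linear:
  assumes "polyfun f" shows "polyfun (\<lambda>m. f (N *v m))"
proof -
  have "N *v m = v3 (\<Sum>j\<in>UNIV. N $ 1 $ j * m $ j) (\<Sum>j\<in>UNIV. N $ 2 $ j * m $ j) (\<Sum>j\<in>UNIV. N $ 3 $ j * m $ j)" for m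
    by (simp add: vec_eq_iff forall_3 matrix_vector_mult_def)
  then show ?thesis
    by (simp only:) (intro polyfun_subst assms, simp_all add: sum_3 polyfun_intros)
qed

lemma polyfun_restrict:
  assumes "polyfun f"
  shows "\<exists>p. \<forall>t. poly p t = f (v3 (poly p1 t) (poly p2 t) (poly p3 t))"
proof -
  let ?S = "{g. \<exists>p. g = poly p}"
  obtain P where f: "f = eval3 P" using assms by (auto simp: polyfun_def)
  have "(\<lambda>t. eval3 P (v3 (poly p1 t) (poly p2 t) (poly p3 t))) \<in> ?S"
  proof (rule eval3_closed)
    show "(\<lambda>t. c) \<in> ?S" for c by (auto intro!: exI[of _ "[:c:]"])
    show "(\<lambda>t. f t + g t) \<in> ?S" if "f \<in> ?S" "g \<in> ?S" for f g
      using that by (auto simp: fun_eq_iff) (metis poly_add)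
    show "(\<lambda>t. f t * g t) \<in> ?S" if "f \<in> ?S" "g \<in> ?S" for f g
      using that by (auto simp: fun_eq_iff) (metis poly_mult)
  qed auto
  then show ?thesis by (auto simp: f fun_eq_iff)
qed

lemma eval3_eq_0D:
  assumes "\<And>m. eval3 P m = 0"
  shows "P = 0"
proof -
  have 2: "p = 0" if "\<And>x y. poly (poly p [:y:]) x = 0" for p :: "complex poly poly"
  proof (rule ccontr)
    assume "p \<noteq> 0"
    then have "finite {c. poly p c = 0}" by (rule poly_roots_finite)
    moreover have "range (\<lambda>y. [:y:]) \<subseteq> {c. poly p c = 0}" using that poly_all_0_iff_0 by blast
    ultimately show False
      using finite_subset finite_imageD[of "\<lambda>y::complex. [:y:]" UNIV] infinite_UNIV_char_0 by (auto simp: inj_def)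
  qed
  show ?thesis
  proof (rule ccontr)
    assume "P \<noteq> 0"
    then have "finite {c. poly P c = 0}" by (rule poly_roots_finite)
    moreover have "poly P [:[:z:]:] = 0" for z
      using assms[of "v3 _ _ z"] by (intro 2) (simp add: eval3_def)
    then have "range (\<lambda>z. [:[:z:]:]) \<subseteq> {c. poly P c = 0}" by blast
    ultimately show False
      using finite_subset finite_imageD[of "\<lambda>z::complex. [:[:z:]:]" UNIV] infinite_UNIV_char_0 by (auto simp: inj_def)
  qed
qed

lemma eval3_inject:
  assumes "\<And>m. eval3 P m = eval3 Q m" shows "P = Q"
proof -
  have "eval3 (P - Q) m = 0" for m using assms[of m] by (simp add: eval3_def)
  then have "P - Q = 0" by (rule eval3_eq_0D)
  then show ?thesis by simp
qed

lemma eval3_homogeneous: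
  assumes "homogeneous_poly3 N P"
  shows "eval3 P (v3 (\<mu> * x) (\<mu> * y) (\<mu> * z)) = \<mu> ^ N * eval3 P (v3 x y z)"
proof -
  have e: "eval3 P (v3 x y z) = (\<Sum>k\<le>degree P. \<Sum>j\<le>degree (coeff P k). \<Sum>i\<le>degree (coeff (coeff P k) j).
      coeff (coeff (coeff P k) j) i * x ^ i * y ^ j * z ^ k)" for x y z
    by (simp add: eval3_def poly_altdef[of P] poly_altdef[of "coeff P _"] poly_altdef[of "coeff (coeff P _) _"]
        poly_sum poly_power sum_distrib_right)
  show ?thesis unfolding e sum_distrib_left
  proof (intro sum.cong refl)
    fix k j i
    show "coeff (coeff (coeff P k) j) i * (\<mu> * x) ^ i * (\<mu> * y) ^ j * (\<mu> * z) ^ k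
      = \<mu> ^ N * (coeff (coeff (coeff P k) j) i * x ^ i * y ^ j * z ^ k)"
    proof (cases "coeff (coeff (coeff P k) j) i = 0")
      case False
      then have "N = i + j + k" using assms by (auto simp: homogeneous_poly3_def)
      then show ?thesis by (simp add: power_add power_mult_distrib)
    qed simp
  qed
qed

section \<open>Binary forms as homogenizations, with a factor x for each degree that
  \<open>a\<close> lacks\<close>

definition hom :: "nat \<Rightarrow> complex poly \<Rightarrow> complex \<Rightarrow> complex \<Rightarrow> complex" where
  "hom n a x y = (\<Sum>j\<le>n. coeff a j * x ^ (n - j) * y ^ j)"

lemma continuous_hom: "isCont (\<lambda>x. hom n a x y) x0"
  unfolding hom_def by (intro continuous_intros)

lemma hom_nz:
  assumes "degree a \<le> n" "x \<noteq> 0"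
  shows "hom n a x y = x ^ n * poly a (y / x)"
proof -
  have "poly a (y / x) = (\<Sum>j\<le>n. coeff a j * (y / x) ^ j)"
    unfolding poly_altdef by (rule sum.mono_neutral_left) (use assms in \<open>auto simp: coeff_eq_0\<close>)
  then have "x ^ n * poly a (y / x) = (\<Sum>j\<le>n. x ^ n * (coeff a j * (y / x) ^ j))"
    by (simp only: sum_distrib_left)
  also have "\<dots> = hom n a x y"
    unfolding hom_def by (rule sum.cong) (use assms in \<open>simp_all add: power_diff power_divide\<close>)
  finally show ?thesis by simp
qed

lemma hom_1: "degree a \<le> n \<Longrightarrow> hom n a 1 t = poly a t"
  by (simp add: hom_nz)

lemma hom_0: "hom n a 0 y = coeff a n * y ^ n"
proof -
  have "hom n a 0 y = (\<Sum>j\<le>n. if j = n then coeff a n * y ^ n else 0)"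
    unfolding hom_def by (rule sum.cong) (auto simp: power_0_left)
  then show ?thesis by simp
qed

lemma hom_0_0: "0 < n \<Longrightarrow> hom n a 0 0 = 0" by (simp add: hom_0)

lemma polyfun_hom: "polyfun f \<Longrightarrow> polyfun g \<Longrightarrow> polyfun (\<lambda>m. hom n a (f m) (g m))"
  unfolding hom_def by (intro polyfun_intros)

text \<open>Extends identities of forms to x = 0, where the coordinate y / x is missing.\<close>

lemma eq_off_0:
  fixes f g :: "complex \<Rightarrow> complex"
  assumes "isCont f 0" "isCont g 0" "\<And>x. x \<noteq> 0 \<Longrightarrow> f x = g x"
  shows "f x = g x"
proof (cases "x = 0")
  case True
  have "(f \<longlongrightarrow> f 0) (at 0)" "(g \<longlongrightarrow> g 0) (at 0)" using assms by (simp_all add: isCont_def)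
  moreover have "eventually (\<lambda>x. f x = g x) (at 0)"
    using assms(3) by (auto simp: eventually_at_filter)
  ultimately show ?thesis using True tendsto_unique[OF at_neq_bot] by (metis tendsto_cong)
qed (use assms in simp)

lemma hom_linear_factor:
  assumes "degree a \<le> n"
  shows "hom (Suc n) ([:- t, 1:] * a) x y = (y - t * x) * hom n a x y"
proof (rule eq_off_0[where f = "\<lambda>x. hom (Suc n) ([:- t, 1:] * a) x y" and g = "\<lambda>x. (y - t * x) * hom n a x y"])
  fix x :: complex assume x: "x \<noteq> 0"
  have "degree ([:- t, 1:] * a) \<le> Suc n" using degree_mult_le[of "[:- t, 1:]" a] assms by simp
  then show "hom (Suc n) ([:- t, 1:] * a) x y = (y - t * x) * hom n a x y"
    using x assms by (simp add: hom_nz field_simps del: mult_pCons_left)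
qed (intro continuous_intros continuous_hom)+

lemma hom_low_degree:
  assumes "degree a \<le> n"
  shows "hom (Suc n) a x y = x * hom n a x y"
proof (rule eq_off_0[where f = "\<lambda>x. hom (Suc n) a x y" and g = "\<lambda>x. x * hom n a x y"])
  fix x :: complex assume "x \<noteq> 0"
  then show "hom (Suc n) a x y = x * hom n a x y" using assms by (simp add: hom_nz)
qed (intro continuous_intros continuous_hom)+

lemma hom_pCons_0:
  assumes "degree a \<le> n"
  shows "hom (Suc n) (pCons 0 a) x y = y * hom n a x y"
  using hom_linear_factor[OF assms, of 0] by simp

text \<open>a(t) / t^n = a'(1 / t) stays bounded at infinity. Multiplication by t^(deg a') gives
  polynomials on both sides, whose degrees can be compared.\<close>

lemma degree_le_reflect:
  assumes "\<And>t::complex. t \<noteq> 0 \<Longrightarrow> poly a t = t ^ n * poly a' (inverse t)"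
  shows "degree a \<le> n"
proof (cases "a = 0")
  case False
  have "poly (monom 1 (degree a') * a) t = poly (monom 1 n * reflect_poly a') t" for t
    by (rule eq_off_0) (auto simp: poly_monom poly_reflect_poly_nz assms)
  then have "monom 1 (degree a') * a = monom 1 n * reflect_poly a'"
    by (intro poly_eq_poly_eq_iff[THEN iffD1] ext)
  then have "degree (monom 1 (degree a') * a) = degree (monom 1 n * reflect_poly a')" by simp
  also have "\<dots> \<le> n + degree a'"
    using degree_mult_le[of "monom 1 n" "reflect_poly a'"] degree_reflect_poly_le[of a'] degree_monom_le[of "1 :: complex" n]
    by linarith
  finally show ?thesis using False by (simp add: degree_mult_eq degree_monom_eq)
qed simp

text \<open>\<open>a\<close> is the restriction of \<open>f\<close> to x = 1. Comparison with the
  restriction to y = 1 bounds its degree, and homogeneity recovers \<open>f\<close> off x =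
  0.\<close>

lemma hom_form:
  assumes f: "polyfun f" and h: "\<And>\<mu> x y. \<mu> \<noteq> 0 \<Longrightarrow> f (v3 (\<mu> * x) (\<mu> * y) 1) = \<mu> ^ n * f (v3 x y 1)"
  shows "\<exists>a. degree a \<le> n \<and> (\<forall>x y. f (v3 x y 1) = hom n a x y)"
proof -
  obtain a where a: "\<And>t. poly a t = f (v3 1 t 1)"
    using polyfun_restrict[OF f, of 1 "[:0, 1:]" 1] by auto
  obtain a' where a': "\<And>t. poly a' t = f (v3 t 1 1)"
    using polyfun_restrict[OF f, of "[:0, 1:]" 1 1] by auto
  have rel: "poly a t = t ^ n * poly a' (inverse t)" if "t \<noteq> 0" for t
    using h[of t "inverse t" 1] that by (simp add: a a')
  then have "degree a \<le> n" by (rule degree_le_reflect)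
  moreover have "f (v3 x y 1) = hom n a x y" for x y
  proof -
    obtain p where p: "\<And>t. poly p t = f (v3 t y 1)"
      using polyfun_restrict[OF f, of "[:0, 1:]" "[:y:]" 1] by auto
    have "poly p x = hom n a x y"
    proof (rule eq_off_0[where f = "poly p" and g = "\<lambda>x. hom n a x y"])
      fix x :: complex assume "x \<noteq> 0"
      then show "poly p x = hom n a x y"
        using h[of x 1 "y / x"] \<open>degree a \<le> n\<close> by (simp add: p hom_nz a)
    qed (simp_all add: continuous_hom)
    then show ?thesis by (simp add: p)
  qed
  ultimately show ?thesis by blast
qed

text \<open>The powers of 2 are pairwise distinct, so a polynomial that z -> 2 z multiplies by a
  constant contains a single power of \<open>z\<close>. Its exponent is fixed by that constant and
  is therefore the same for all x and y.\<close>

lemma z_power: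
  assumes f: "polyfun f" and \<kappa>: "\<And>x y z. \<kappa> * f (v3 x y (2 * z)) = 2 ^ N * f (v3 x y z)"
    and nz: "f m \<noteq> 0"
  shows "\<exists>k. \<kappa> * 2 ^ k = 2 ^ N \<and> (\<forall>x y z. f (v3 x y z) = z ^ k * f (v3 x y 1))"
proof -
  have c: "\<kappa> * (2 ^ j * coeff p j) = 2 ^ N * coeff p j" if p: "\<And>t. poly p t = f (v3 x y t)" for p x y j
  proof -
    have "smult \<kappa> (pcompose p [:0, 2:]) = smult (2 ^ N) p"
      by (rule poly_eq_poly_eq_iff[THEN iffD1], rule ext) (use \<kappa>[of x y] in \<open>simp add: poly_pcompose p mult.commute\<close>)
    then have "coeff (smult \<kappa> (pcompose p [:0, 2:])) j = coeff (smult (2 ^ N) p) j" by simp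
    then show ?thesis by (simp add: coeff_pcompose_linear)
  qed
  have ex: "\<exists>p. \<forall>t. poly p t = f (v3 x y t)" for x y
    using polyfun_restrict[OF f, of "[:x:]" "[:y:]" "[:0, 1:]"] by simp
  obtain p0 where p0: "\<And>t. poly p0 t = f (v3 (m $ 1) (m $ 2) t)" using ex by blast
  have "poly p0 (m $ 3) \<noteq> 0" using nz p0 by (simp add: v3_eta)
  then obtain k where k: "coeff p0 k \<noteq> 0" by (metis leading_coeff_0_iff poly_0)
  then have \<kappa>k: "\<kappa> * 2 ^ k = 2 ^ N" using c[OF p0, of k] by simp
  have "f (v3 x y z) = z ^ k * f (v3 x y 1)" for x y z
  proof -
    obtain p where p: "\<And>t. poly p t = f (v3 x y t)" using ex by blast
    have "coeff p j = 0" if "j \<noteq> k" for j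
    proof (rule ccontr)
      assume "coeff p j \<noteq> 0"
      then have "\<kappa> * 2 ^ j = \<kappa> * 2 ^ k" using c[OF p, of j] \<kappa>k by simp
      moreover have "\<kappa> \<noteq> 0" using \<kappa>k by auto
      ultimately have "(2::complex) ^ j = 2 ^ k" by simp
      then have "norm ((2::complex) ^ j) = norm ((2::complex) ^ k)" by simp
      then show False using that by (simp add: norm_power)
    qed
    then have "p = monom (coeff p k) k" by (auto simp: poly_eq_iff)
    then have "poly p t = coeff p k * t ^ k" for t by (metis poly_monom)
    then show ?thesis by (simp add: p[symmetric])
  qed
  then show ?thesis using \<kappa>k by blast
qed


section \<open>Normal form of the 1-form in an adapted chart\<close>

definition good_chart :: "complex ^ 3 ^ 3 \<Rightarrow> complex ^ 3 \<Rightarrow> form3 \<Rightarrow> bool" where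
  "good_chart M u \<Omega> \<longleftrightarrow> invertible M \<and>
    (\<forall>x y z. cdot u (M *v v3 (2 * x) (2 * y) z) = 0 \<longleftrightarrow> cdot u (M *v v3 x y z) = 0) \<and>
    (\<exists>c. c \<noteq> 0 \<and> (\<forall>x y z x' y' z'.
      cdot (form_at \<Omega> (M *v v3 (2 * x) (2 * y) z)) (M *v v3 (2 * x') (2 * y') z')
        = c * cdot (form_at \<Omega> (M *v v3 x y z)) (M *v v3 x' y' z')))"

lemma good_chart_exists:
  assumes "homogeneous_prefoliation u \<Omega>"
  shows "\<exists>M. good_chart M u \<Omega>"
proof -
  obtain M where M: "invertible M"
    "line_preserved (M ** homothety 2 ** matrix_inv M) u"
    "foliation_preserved (M ** homothety 2 ** matrix_inv M) \<Omega>"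
    using assms unfolding homogeneous_prefoliation_def by (metis zero_neq_numeral)
  have inv: "matrix_inv M ** M = mat 1"
    using M(1) unfolding matrix_inv_def invertible_def by (rule someI2_ex) blast
  have h: "homothety 2 *v v3 x y z = v3 (2 * x) (2 * y) z" for x y z
    by (simp add: vec_eq_iff forall_3 matrix_vector_mult_def sum_3 homothety_def)
  have "(M ** homothety 2 ** matrix_inv M) *v (M *v v3 x y z) = M *v v3 (2 * x) (2 * y) z" for x y z
  proof -
    have "(M ** homothety 2 ** matrix_inv M) *v (M *v v3 x y z)
      = M *v (homothety 2 *v ((matrix_inv M ** M) *v v3 x y z))"
      by (simp add: matrix_vector_mul_assoc matrix_mul_assoc)
    then show ?thesis by (simp add: inv h)
  qed
  then show ?thesis
    using M unfolding good_chart_def line_preserved_def foliation_preserved_def by (metis (no_types, lifting))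
qed

definition block :: "complex \<Rightarrow> complex \<Rightarrow> complex \<Rightarrow> complex \<Rightarrow> complex ^ 3 ^ 3" where
  "block x x' y y' = vector [v3 x x' 0, v3 y y' 0, v3 0 0 1]"

lemma block_mult: "block x x' y y' *v v3 s t z = v3 (x * s + x' * t) (y * s + y' * t) z"
  by (simp add: vec_eq_iff forall_3 matrix_vector_mult_def sum_3 block_def)

lemma invertible_block: "x * y' - x' * y \<noteq> 0 \<Longrightarrow> invertible (block x x' y y')"
  by (simp add: invertible_det_nz det_3 block_def)

lemma good_chart_block:
  assumes M: "good_chart M u \<Omega>" and N: "x * y' - x' * y \<noteq> 0"
  shows "good_chart (M ** block x x' y y') u \<Omega>"
proof -
  have e: "x * (2 * s) + x' * (2 * t) = 2 * (x * s + x' * t)" for x x' s t :: complex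
    by (simp add: algebra_simps)
  show ?thesis
    using M invertible_mult[OF _ invertible_block[OF N], of M]
    unfolding good_chart_def matrix_vector_mul_assoc[symmetric] block_mult e by blast
qed

locale homogeneous_chart =
  fixes M :: "complex ^ 3 ^ 3" and u :: "complex ^ 3" and \<Omega> :: form3 and n :: nat
  assumes chart: "good_chart M u \<Omega>" and fol: "foliation n \<Omega>" and n: "0 < n"
begin

text \<open>The coefficient vector of the pull-back of \<Omega> by \<open>M\<close>.\<close>

definition w where "w m = form_at \<Omega> (M *v m) v* M"

lemma cdot_w: "cdot (w m) e = cdot (form_at \<Omega> (M *v m)) (M *v e)"
  by (simp add: w_def cdot_v_mult)

lemma inv: "invertible M" using chart by (simp add: good_chart_def)

text \<open>The inverse of \<open>M\<close> carries a common factor of the pull-back to a common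
  factor of \<Omega>; its zero at the origin shows that it is not a unit.\<close>

lemma no_common_factor:
  assumes h: "polyfun h" and g: "polyfun g1" "polyfun g2" "polyfun g3"
    and eq: "\<And>m. w m $ 1 = h m * g1 m" "\<And>m. w m $ 2 = h m * g2 m" "\<And>m. w m $ 3 = h m * g3 m"
    and h0: "h 0 = 0"
  shows False
proof -
  obtain L where L: "M ** L = mat 1" "L ** M = mat 1" using inv by (auto simp: invertible_def)
  have f: "form_at \<Omega> m $ i = h (L *v m) * (L $ 1 $ i * g1 (L *v m) + L $ 2 $ i * g2 (L *v m) + L $ 3 $ i * g3 (L *v m))" for m i
  proof -
    have "w (L *v m) v* L = form_at \<Omega> (M *v (L *v m)) v* (M ** L)"
      by (simp add: w_def vector_matrix_mul_assoc)
    then have "form_at \<Omega> m = w (L *v m) v* L" by (simp add: matrix_vector_mul_assoc L)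
    then show ?thesis
      by (simp add: vector_matrix_mult_def sum_3 eq algebra_simps)
  qed
  obtain H where H: "(\<lambda>m. h (L *v m)) = eval3 H" using polyfun_linear[OF h] by (auto simp: polyfun_def)
  have "\<forall>i. \<exists>G. (\<lambda>m. L $ 1 $ i * g1 (L *v m) + L $ 2 $ i * g2 (L *v m) + L $ 3 $ i * g3 (L *v m)) = eval3 G"
  proof
    fix i
    have "polyfun (\<lambda>m. L $ 1 $ i * g1 (L *v m) + L $ 2 $ i * g2 (L *v m) + L $ 3 $ i * g3 (L *v m))"
      by (intro polyfun_intros polyfun_linear g)
    then show "\<exists>G. (\<lambda>m. L $ 1 $ i * g1 (L *v m) + L $ 2 $ i * g2 (L *v m) + L $ 3 $ i * g3 (L *v m)) = eval3 G"
      by (simp add: polyfun_def)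
  qed
  from choice[OF this] obtain G where
    "\<And>i. (\<lambda>m. L $ 1 $ i * g1 (L *v m) + L $ 2 $ i * g2 (L *v m) + L $ 3 $ i * g3 (L *v m)) = eval3 (G i)"
    by blast
  note G = fun_cong[OF this]
  have "\<Omega> $ i = H * G i" for i
    by (rule eval3_inject) (use f[of _ i] fun_cong[OF H] in \<open>simp add: eval3_mult G form_at_def\<close>)
  then have "is_unit H" using fol by (auto simp: foliation_def)
  then obtain H' where "1 = H * H'" by (elim dvdE)
  then have "eval3 H 0 * eval3 H' 0 = eval3 1 0" by (metis eval3_mult)
  moreover have "eval3 H 0 = 0" using fun_cong[OF H, of 0] h0 by simp
  ultimately show False by (simp add: eval3_def)
qed

lemma w_homogeneous: "w (v3 (\<mu> * x) (\<mu> * y) (\<mu> * z)) = \<mu> ^ (n + 1) *s w (v3 x y z)"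
proof -
  have "M *v v3 (\<mu> * x) (\<mu> * y) (\<mu> * z) = \<mu> *s (M *v v3 x y z)"
    by (simp add: vec_eq_iff matrix_vector_mult_def sum_3 algebra_simps)
  moreover have "form_at \<Omega> (\<mu> *s m) = \<mu> ^ (n + 1) *s form_at \<Omega> m" for m
  proof -
    have "eval3 (\<Omega> $ i) (v3 (\<mu> * m $ 1) (\<mu> * m $ 2) (\<mu> * m $ 3)) = \<mu> ^ (n + 1) * eval3 (\<Omega> $ i) (v3 (m $ 1) (m $ 2) (m $ 3))" for i
      using fol unfolding foliation_def by (intro eval3_homogeneous) blast
    moreover have "v3 (\<mu> * m $ 1) (\<mu> * m $ 2) (\<mu> * m $ 3) = \<mu> *s m" by (simp add: vec_eq_iff forall_3)
    ultimately have "form_at \<Omega> (\<mu> *s m) $ i = (\<mu> ^ (n + 1) *s form_at \<Omega> m) $ i" for i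
      by (simp add: form_at_def v3_eta)
    then show ?thesis unfolding vec_eq_iff by blast
  qed
  ultimately have "w (v3 (\<mu> * x) (\<mu> * y) (\<mu> * z)) = (\<mu> ^ (n + 1) *s form_at \<Omega> (M *v v3 x y z)) v* M"
    unfolding w_def by simp
  then show ?thesis
    by (simp add: w_def vec_eq_iff vector_matrix_mult_def sum_distrib_left mult_ac)
qed

lemma polyfun_w: "polyfun (\<lambda>m. w m $ i)"
proof -
  have "w m $ i = (\<Sum>j\<in>UNIV. eval3 (\<Omega> $ j) (M *v m) * M $ j $ i)" for m
    by (simp add: w_def vector_matrix_mult_def form_at_def mult.commute)
  then show ?thesis
    by (simp only:) (intro polyfun_intros polyfun_linear polyfun_eval3)
qed

lemma euler: "x * w (v3 x y z) $ 1 + y * w (v3 x y z) $ 2 + z * w (v3 x y z) $ 3 = 0"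
proof -
  have rel: "m $ 1 * eval3 (\<Omega> $ 1) m + m $ 2 * eval3 (\<Omega> $ 2) m + m $ 3 * eval3 (\<Omega> $ 3) m = 0" for m
  proof -
    have "eval3 ([:[:[:0, 1:]:]:] * \<Omega> $ 1 + [:[:0, 1:]:] * \<Omega> $ 2 + [:0, 1:] * \<Omega> $ 3) m = eval3 0 m"
      using fol by (simp add: foliation_def)
    then show ?thesis by (simp add: eval3_def)
  qed
  have "cdot (w m) m = 0" for m
    unfolding cdot_w using rel[of "M *v m"] by (simp add: cdot_eq form_at_def mult.commute)
  from this[of "v3 x y z"] show ?thesis by (simp add: cdot_eq mult.commute)
qed

text \<open>Homogeneity trades the doubling of x and y for one of z. The homothety also doubles the
  first two entries of the tangent vector, whence the extra factor 2 for the dx and dy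
  coefficients.\<close>

lemma w_scale_z:
  "\<exists>c. (\<forall>i x y z. i \<noteq> 3 \<longrightarrow> c * w (v3 x y (2 * z)) $ i = 2 ^ (n + 2) * w (v3 x y z) $ i) \<and>
    (\<forall>x y z. c * w (v3 x y (2 * z)) $ 3 = 2 ^ (n + 1) * w (v3 x y z) $ 3)"
proof -
  obtain c where c: "\<And>x y z x' y' z'. cdot (w (v3 (2 * x) (2 * y) z)) (v3 (2 * x') (2 * y') z')
      = c * cdot (w (v3 x y z)) (v3 x' y' z')"
    using chart unfolding good_chart_def cdot_w by blast
  have h: "w (v3 (2 * x) (2 * y) (2 * z)) $ i = 2 ^ (n + 1) * w (v3 x y z) $ i" for x y z i
    by (simp add: w_homogeneous)
  have c1: "c * w (v3 x y (2 * z)) $ 1 = 2 ^ (n + 2) * w (v3 x y z) $ 1"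
    and c2: "c * w (v3 x y (2 * z)) $ 2 = 2 ^ (n + 2) * w (v3 x y z) $ 2"
    and c3: "c * w (v3 x y (2 * z)) $ 3 = 2 ^ (n + 1) * w (v3 x y z) $ 3" for x y z
    using c[of x y "2 * z" 1 0 0] c[of x y "2 * z" 0 1 0] c[of x y "2 * z" 0 0 1]
    by (simp_all add: cdot_eq h mult.assoc)
  have "i = 1 \<or> i = 2" if "i \<noteq> 3" for i :: 3 using that exhaust_3[of i] by blast
  then show ?thesis using c1 c2 c3 by blast
qed

text \<open>By \<open>z_power\<close> the dx and dy coefficients contain z^k, and the dz coefficient
  z^(k - 1) if it is not zero. As \<open>z\<close> is no common factor, k = 1, and Euler's relation
  yields the dz coefficient. Were the latter zero, the others would be (- y, x) times a form of
  degree n > 0, a common factor.\<close>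

lemma normal_form:
  "\<exists>a b. degree a \<le> n \<and> degree b \<le> n \<and>
    (\<forall>x y z. w (v3 x y z) = v3 (z * hom n a x y) (z * hom n b x y) (- (x * hom n a x y + y * hom n b x y)))"
proof -
  obtain c where c12: "\<And>i x y z. i \<noteq> 3 \<Longrightarrow> c * w (v3 x y (2 * z)) $ i = 2 ^ (n + 2) * w (v3 x y z) $ i"
    and c3: "\<And>x y z. c * w (v3 x y (2 * z)) $ 3 = 2 ^ (n + 1) * w (v3 x y z) $ 3"
    using w_scale_z by blast
  have z_div: False if "\<And>i x y z. w (v3 x y z) $ i = z * g i (v3 x y z)" "\<And>i. polyfun (g i)" for g
  proof (rule no_common_factor[of "\<lambda>m :: complex ^ 3. m $ 3" "g 1" "g 2" "g 3"])
    show "w m $ 1 = m $ 3 * g 1 m" "w m $ 2 = m $ 3 * g 2 m" "w m $ 3 = m $ 3 * g 3 m" for m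
      using that(1)[of "m $ 1" "m $ 2" "m $ 3"] unfolding v3_eta by blast+
  qed (simp_all add: polyfun_intros that)
  have pw: "polyfun (\<lambda>m. w (v3 (m $ 1) (m $ 2) 1) $ i)" for i
    by (rule polyfun_subst[OF polyfun_w]) (rule polyfun_intros)+
  have ex12: "\<exists>k. c * 2 ^ k = 2 ^ (n + 2) \<and> (\<forall>i x y z. i \<noteq> 3 \<longrightarrow> w (v3 x y z) $ i = z ^ k * w (v3 x y 1) $ i)"
    if nz: "w m $ i \<noteq> 0" and i3: "i \<noteq> 3" for m i
  proof -
    obtain k where k: "c * 2 ^ k = 2 ^ (n + 2)"
      using z_power[OF polyfun_w c12[OF i3] nz] by blast
    have "w (v3 x y z) $ j = z ^ k * w (v3 x y 1) $ j" if j: "j \<noteq> 3" for j x y z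
    proof (cases "\<exists>m. w m $ j \<noteq> 0")
      case True
      then obtain k' where k': "c * 2 ^ k' = 2 ^ (n + 2)"
        "\<And>x y z. w (v3 x y z) $ j = z ^ k' * w (v3 x y 1) $ j"
        using z_power[OF polyfun_w c12[OF j]] by blast
      have "c \<noteq> 0" using k by auto
      then have "(2::complex) ^ k = 2 ^ k'" using k k' by (metis mult_left_cancel)
      then have "norm ((2::complex) ^ k) = norm ((2::complex) ^ k')" by simp
      then have "k = k'" by (simp add: norm_power)
      then show ?thesis using k'(2)[of x y z] by simp
    qed simp
    then show ?thesis using k by blast
  qed
  have ne: "\<exists>m. w m $ 1 \<noteq> 0 \<or> w m $ 2 \<noteq> 0"
  proof (rule ccontr)
    assume "\<not> ?thesis"
    then have w12: "w m $ 1 = 0" "w m $ 2 = 0" for m by auto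
    have "w m $ 3 = 0" for m
    proof -
      obtain p where p: "\<And>t. poly p t = w (v3 (m $ 1) (m $ 2) t) $ 3"
        using polyfun_restrict[OF polyfun_w[of 3], of "[:m $ 1:]" "[:m $ 2:]" "[:0, 1:]"] by auto
      have "poly p t = 0" for t
        by (rule eq_off_0[where f = "poly p" and g = "\<lambda>_. 0"]) (use euler in \<open>auto simp: p w12\<close>)
      then show ?thesis using p by (metis v3_eta)
    qed
    then have "w m $ i = 0" for m i using w12 exhaust_3[of i] by metis
    then show False by (intro z_div[of "\<lambda>_ _. 0"]) (simp_all add: polyfun_intros)
  qed
  then obtain m i where "w m $ i \<noteq> 0" "i \<noteq> 3"
    by (elim exE disjE) (force, force)
  then obtain k where k: "c * 2 ^ k = 2 ^ (n + 2)"
    and wk: "\<And>i x y z. i \<noteq> 3 \<Longrightarrow> w (v3 x y z) $ i = z ^ k * w (v3 x y 1) $ i"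
    using ex12 by blast
  have w1: "w (v3 x y z) $ 1 = z ^ k * w (v3 x y 1) $ 1" and w2: "w (v3 x y z) $ 2 = z ^ k * w (v3 x y 1) $ 2" for x y z
    by (rule wk, simp)+
  have powers: False if w3: "\<And>x y z. w (v3 x y z) $ 3 = z ^ Suc k3 * w (v3 x y 1) $ 3" and "k \<noteq> 0" for k3
  proof -
    obtain k' where k': "k = Suc k'" using \<open>k \<noteq> 0\<close> by (cases k) auto
    define e where "e i = (if i = 3 then k3 else k')" for i :: 3
    show False
    proof (rule z_div[of "\<lambda>i (m :: complex ^ 3). m $ 3 ^ e i * w (v3 (m $ 1) (m $ 2) 1) $ i"])
      fix i x y z
      have "w (v3 x y z) $ i = z ^ Suc (e i) * w (v3 x y 1) $ i"
      proof (cases "i = 3")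
        case True
        then have "Suc (e i) = Suc k3" by (simp add: e_def)
        then show ?thesis using w3[of x y z] True by (simp only:)
      next
        case False
        then have "Suc (e i) = k" by (simp add: e_def k')
        then show ?thesis using wk[OF False, of x y z] by (simp only:)
      qed
      then show "w (v3 x y z) $ i = z * (v3 x y z $ 3 ^ e i * w (v3 (v3 x y z $ 1) (v3 x y z $ 2) 1) $ i)"
        by (simp add: mult.assoc)
    qed (intro polyfun_mult polyfun_power polyfun_coord pw)
  qed
  show ?thesis
  proof (cases "\<forall>m. w m $ 3 = 0")
    case True
    have "k = 0" using powers[of 0] True by (cases k) auto
    then have w12: "w (v3 x y z) $ 1 = w (v3 x y 1) $ 1" "w (v3 x y z) $ 2 = w (v3 x y 1) $ 2" for x y z
      using w1[of x y z] w2[of x y z] by simp_all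
    have h12: "w (v3 (\<mu> * x) (\<mu> * y) 1) $ 1 = \<mu> ^ Suc n * w (v3 x y 1) $ 1"
      "w (v3 (\<mu> * x) (\<mu> * y) 1) $ 2 = \<mu> ^ Suc n * w (v3 x y 1) $ 2" for \<mu> x y
      using w_homogeneous[of \<mu> x y 1] w12[of "\<mu> * x" "\<mu> * y" \<mu>] by simp_all
    obtain a where a: "degree a \<le> Suc n" "\<And>x y. w (v3 x y 1) $ 1 = hom (Suc n) a x y"
      using hom_form[OF polyfun_w h12(1)] by blast
    obtain b where b: "degree b \<le> Suc n" "\<And>x y. w (v3 x y 1) $ 2 = hom (Suc n) b x y"
      using hom_form[OF polyfun_w h12(2)] by blast
    have "poly (a + pCons 0 b) t = poly 0 t" for t
      using euler[of 1 t 1] True by (simp add: a(2) b(2) hom_1 a(1) b(1))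
    then have "a + pCons 0 b = 0" by (intro poly_eq_poly_eq_iff[THEN iffD1] ext)
    then have ab: "a = - pCons 0 b" by (rule eq_neg_iff_add_eq_0[THEN iffD2])
    have db: "degree b \<le> n" using a(1) ab by (cases "b = 0") (auto simp: degree_pCons_eq)
    have "hom (Suc n) (- pCons 0 b) x y = - hom (Suc n) (pCons 0 b) x y" for x y
      unfolding hom_def coeff_minus by (simp only: mult_minus_left sum_negf)
    then have h: "hom (Suc n) a x y = - (y * hom n b x y)" "hom (Suc n) b x y = x * hom n b x y" for x y
      using hom_pCons_0[OF db] hom_low_degree[OF db] by (simp_all add: ab)
    have False
    proof (rule no_common_factor[of "\<lambda>m :: complex ^ 3. hom n b (m $ 1) (m $ 2)" "\<lambda>m :: complex ^ 3. - m $ 2" "\<lambda>m :: complex ^ 3. m $ 1" "\<lambda>m. 0"])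
      show "w m $ 1 = hom n b (m $ 1) (m $ 2) * - m $ 2" "w m $ 2 = hom n b (m $ 1) (m $ 2) * m $ 1" for m
        using w12[of "m $ 1" "m $ 2" "m $ 3"] by (simp_all add: v3_eta a(2) b(2) h)
      show "w m $ 3 = hom n b (m $ 1) (m $ 2) * 0" for m using True by simp
    qed (use n in \<open>simp_all add: polyfun_intros polyfun_hom hom_0_0\<close>)
    then show ?thesis ..
  next
    case False
    then obtain m where "w m $ 3 \<noteq> 0" by blast
    then obtain k3 where k3: "c * 2 ^ k3 = 2 ^ (n + 1)" "\<And>x y z. w (v3 x y z) $ 3 = z ^ k3 * w (v3 x y 1) $ 3"
      using z_power[OF polyfun_w c3] by blast
    have "c \<noteq> 0" using k by auto
    moreover have "c * 2 ^ k = c * 2 ^ Suc k3" using k k3(1) by simp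
    ultimately have "norm ((2::complex) ^ k) = norm ((2::complex) ^ Suc k3)" by (metis mult_left_cancel)
    then have "(2::real) ^ k = 2 ^ Suc k3" by (simp only: norm_power norm_numeral)
    then have kk: "k = Suc k3" by (rule power_inject_exp[THEN iffD1, rotated]) simp
    have "k3 = 0"
    proof (cases k3)
      case (Suc j)
      from powers[of j] k3(2)[unfolded Suc] kk show ?thesis by blast
    qed
    then have k1: "k = 1" using kk by simp
    have w3: "w (v3 x y z) $ 3 = - (x * w (v3 x y 1) $ 1 + y * w (v3 x y 1) $ 2)" for x y z
      using euler[of x y 1] k3(2)[of x y z] \<open>k3 = 0\<close>
      by (simp only: power_0 mult_1 eq_neg_iff_add_eq_0 add.commute)
    have h12: "w (v3 (\<mu> * x) (\<mu> * y) 1) $ 1 = \<mu> ^ n * w (v3 x y 1) $ 1"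
      "w (v3 (\<mu> * x) (\<mu> * y) 1) $ 2 = \<mu> ^ n * w (v3 x y 1) $ 2" if "\<mu> \<noteq> 0" for \<mu> x y
      using w_homogeneous[of \<mu> x y 1] w1[of "\<mu> * x" "\<mu> * y" \<mu>] w2[of "\<mu> * x" "\<mu> * y" \<mu>] that
      by (simp_all add: k1)
    obtain a where a: "degree a \<le> n" "\<And>x y. w (v3 x y 1) $ 1 = hom n a x y"
      using hom_form[OF polyfun_w h12(1)] by blast
    obtain b where b: "degree b \<le> n" "\<And>x y. w (v3 x y 1) $ 2 = hom n b x y"
      using hom_form[OF polyfun_w h12(2)] by blast
    have "w (v3 x y z) = v3 (z * hom n a x y) (z * hom n b x y) (- (x * hom n a x y + y * hom n b x y))" for x y z
      unfolding vec_eq_iff forall_3 using w1[of x y z] w2[of x y z] w3[of x y z] by (simp add: k1 a(2) b(2))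
    then show ?thesis using a(1) b(1) by blast
  qed
qed

context
  fixes a b
  assumes dega: "degree a \<le> n" and degb: "degree b \<le> n"
    and nf: "\<And>x y z. w (v3 x y z) = v3 (z * hom n a x y) (z * hom n b x y) (- (x * hom n a x y + y * hom n b x y))"
begin

lemma nf_component: "w m $ 1 = m $ 3 * hom n a (m $ 1) (m $ 2)" "w m $ 2 = m $ 3 * hom n b (m $ 1) (m $ 2)"
  "w m $ 3 = - (m $ 1 * hom n a (m $ 1) (m $ 2) + m $ 2 * hom n b (m $ 1) (m $ 2))"
  using nf[of "m $ 1" "m $ 2" "m $ 3"] by (simp_all add: v3_eta)

lemma no_common_root: "\<not> (poly a t = 0 \<and> poly b t = 0)"
proof
  assume "poly a t = 0 \<and> poly b t = 0"
  then obtain a1 b1 where ab: "a = [:- t, 1:] * a1" "b = [:- t, 1:] * b1"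
    by (metis dvdE poly_eq_0_iff_dvd)
  obtain n1 where n1: "n = Suc n1" using n by (cases n) auto
  have "degree a1 \<le> n1" using dega ab n1 by (cases "a1 = 0") (auto simp: degree_mult_eq simp del: mult_pCons_left)
  moreover have "degree b1 \<le> n1" using degb ab n1 by (cases "b1 = 0") (auto simp: degree_mult_eq simp del: mult_pCons_left)
  ultimately have h: "hom n a x y = (y - t * x) * hom n1 a1 x y" "hom n b x y = (y - t * x) * hom n1 b1 x y" for x y
    by (simp_all only: n1 ab hom_linear_factor)
  show False
    by (rule no_common_factor[of "\<lambda>m :: complex ^ 3. m $ 2 - t * m $ 1" "\<lambda>m :: complex ^ 3. m $ 3 * hom n1 a1 (m $ 1) (m $ 2)"
          "\<lambda>m :: complex ^ 3. m $ 3 * hom n1 b1 (m $ 1) (m $ 2)" "\<lambda>m :: complex ^ 3. - (m $ 1 * hom n1 a1 (m $ 1) (m $ 2) + m $ 2 * hom n1 b1 (m $ 1) (m $ 2))"])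
      (simp_all add: nf_component h polyfun_intros polyfun_hom algebra_simps)
qed

text \<open>The analogue of \<open>no_common_root\<close> for the direction t = \<infinity>: x would
  divide both forms.\<close>

lemma top_coeff: "\<not> (coeff a n = 0 \<and> coeff b n = 0)"
proof
  assume top: "coeff a n = 0 \<and> coeff b n = 0"
  obtain n1 where n1: "n = Suc n1" using n by (cases n) auto
  have "degree p \<le> n1" if "degree p \<le> n" "coeff p n = 0" for p :: "complex poly"
  proof -
    have "degree p \<noteq> n" using that n by (metis degree_0 leading_coeff_0_iff not_less_zero)
    then show ?thesis using that(1) n1 by simp
  qed
  then have h: "hom n a x y = x * hom n1 a x y" "hom n b x y = x * hom n1 b x y" for x y
    using top dega degb by (simp_all add: n1 hom_low_degree)
  show False
    by (rule no_common_factor[of "\<lambda>m :: complex ^ 3. m $ 1" "\<lambda>m :: complex ^ 3. m $ 3 * hom n1 a (m $ 1) (m $ 2)"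
          "\<lambda>m :: complex ^ 3. m $ 3 * hom n1 b (m $ 1) (m $ 2)" "\<lambda>m :: complex ^ 3. - (m $ 1 * hom n1 a (m $ 1) (m $ 2) + m $ 2 * hom n1 b (m $ 1) (m $ 2))"])
      (simp_all add: nf_component h polyfun_intros polyfun_hom algebra_simps)
qed

text \<open>Otherwise the dz coefficient vanishes, and \<open>z\<close> is a common factor of the
  others.\<close>

lemma fixp_nonzero: "a + pCons 0 b \<noteq> 0"
proof
  assume 0: "a + pCons 0 b = 0"
  have "x * hom n a x y + y * hom n b x y = 0" for x y
  proof (rule eq_off_0[where f = "\<lambda>x. x * hom n a x y + y * hom n b x y" and g = "\<lambda>_. 0"])
    fix x :: complex assume x: "x \<noteq> 0"
    have "x * hom n a x y + y * hom n b x y = x ^ Suc n * poly (a + pCons 0 b) (y / x)"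
    proof -
      define t where "t = y / x"
      have "y = x * t" using x by (simp add: t_def)
      then show ?thesis
        unfolding hom_nz[OF dega x] hom_nz[OF degb x] t_def[symmetric] by (simp add: algebra_simps)
    qed
    then show "x * hom n a x y + y * hom n b x y = 0" by (simp add: 0)
  qed (intro continuous_intros continuous_hom)+
  then show False
    by (intro no_common_factor[of "\<lambda>m :: complex ^ 3. m $ 3" "\<lambda>m :: complex ^ 3. hom n a (m $ 1) (m $ 2)" "\<lambda>m :: complex ^ 3. hom n b (m $ 1) (m $ 2)" "\<lambda>m. 0"])
      (simp_all add: nf_component polyfun_intros polyfun_hom)
qed

end

end

section \<open>Convexity\<close>

text \<open>The bound \<open>degb\<close> expresses that x = 0 is invariant: y^(n + 1) has in x A +
  y B the coefficient of t^n in \<open>b\<close>. By \<open>line\<close>, \<epsilon> records whether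
  \<ell> is x = 0 or the line at infinity.\<close>

locale normal_chart = homogeneous_chart +
  fixes a b :: "complex poly" and \<epsilon> :: complex
  assumes dega: "degree a = n" and degb: "degree b < n" and b0: "b \<noteq> 0" and coprime: "coprime a b"
    and fixp0: "a + pCons 0 b \<noteq> 0"
    and nf: "w (v3 x y z) = v3 (z * hom n a x y) (z * hom n b x y) (- (x * hom n a x y + y * hom n b x y))"
    and eps: "\<epsilon> = 0 \<or> \<epsilon> = 1"
    and line: "cdot u (M *v v3 x y z) = 0 \<longleftrightarrow> (if \<epsilon> = 1 then x = 0 else z = 0)"

lemma invertible_mult_eq_0:
  fixes M :: "complex ^ 3 ^ 3"
  assumes "invertible M" shows "M *v m = 0 \<longleftrightarrow> m = 0"
proof -
  obtain L where "L ** M = mat 1" using assms by (auto simp: invertible_def)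
  then have "L *v (M *v m) = m" by (simp add: matrix_vector_mul_assoc)
  then show ?thesis by (metis matrix_vector_mult_0_right)
qed

lemma v_invertible_mult_eq_0:
  fixes M :: "complex ^ 3 ^ 3"
  assumes "invertible M" shows "m v* M = 0 \<longleftrightarrow> m = 0"
proof -
  obtain L where "M ** L = mat 1" using assms by (auto simp: invertible_def)
  then have "(m v* M) v* L = m" by (simp add: vector_matrix_mul_assoc)
  then show ?thesis by (metis vector_matrix_mult_0)
qed

text \<open>The direction \<open>(x0, y0)\<close> of an invariant line through the origin, namely of \<open>u\<close> unless \<open>u\<close> is
  the line at infinity, is moved to \<open>x = 0\<close>.\<close>

lemma normal_chart_exists:
  assumes n: "0 < n" and fol: "foliation n \<Omega>" and u: "u \<noteq> 0"
    and homogeneous: "homogeneous_prefoliation u \<Omega>" and inv_line: "invariant_line u \<Omega>"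
  shows "\<exists>M a b \<epsilon>. normal_chart M u \<Omega> n a b \<epsilon>"
proof -
  obtain M0 where M0: "good_chart M0 u \<Omega>" using good_chart_exists[OF homogeneous] by blast
  interpret H: homogeneous_chart M0 u \<Omega> n by unfold_locales (rule M0 fol n)+
  define U where "U = u v* M0"
  define u1 u2 u3 where "u1 = U $ 1" and "u2 = U $ 2" and "u3 = U $ 3"
  have U: "cdot u (M0 *v v3 x y z) = u1 * x + u2 * y + u3 * z" for x y z
    unfolding cdot_v_mult[symmetric] U_def[symmetric] by (simp add: cdot_eq u1_def u2_def u3_def)
  have "U \<noteq> 0" using u v_invertible_mult_eq_0[OF H.inv] by (simp add: U_def)
  then have U0: "\<not> (u1 = 0 \<and> u2 = 0 \<and> u3 = 0)"
    by (auto simp: u1_def u2_def u3_def vec_eq_iff forall_3)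
  have pres: "u1 * (2 * x) + u2 * (2 * y) + u3 * z = 0 \<longleftrightarrow> u1 * x + u2 * y + u3 * z = 0" for x y z
    using M0 unfolding good_chart_def U by blast
  \<comment> \<open>A line preserved by the homothety of ratio 2 passes through the origin unless it
    is the line at infinity.\<close>
  have u12: "u1 = 0 \<and> u2 = 0" if "u3 \<noteq> 0"
    using pres[of 1 0 "- 2 * u1 / u3"] pres[of 0 1 "- 2 * u2 / u3"] that by simp
  \<comment> \<open>The third component of \<open>w\<close> is - (x A + y B), whose zeros are the
    directions of the invariant lines through the origin.\<close>
  obtain x0 y0 where xy0: "x0 \<noteq> 0 \<or> y0 \<noteq> 0" and w0: "H.w (v3 x0 y0 0) $ 3 = 0"
    and uxy: "u3 = 0 \<Longrightarrow> u1 * x0 + u2 * y0 = 0"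
  proof (cases "u3 = 0")
    case True
    have "cdot (H.w (v3 (- u2) u1 0)) (v3 0 0 1) = 0"
      unfolding H.cdot_w using inv_line True unfolding invariant_line_def by (simp add: U)
    then show thesis using that[of "- u2" u1] U0 True by (auto simp: cdot_eq)
  next
    case False
    obtain a b where deg: "degree a \<le> n" "degree b \<le> n"
      and nf: "\<And>x y z. H.w (v3 x y z) = v3 (z * hom n a x y) (z * hom n b x y) (- (x * hom n a x y + y * hom n b x y))"
      using H.normal_form by blast
    show thesis
    proof (cases "coeff b n = 0")
      case True
      then show ?thesis using that[of 0 1] False by (simp add: nf hom_0)
    next
      case nz: False
      have "coeff (a + pCons 0 b) (Suc n) = coeff b n" using deg by (simp add: coeff_eq_0)
      then have "degree (a + pCons 0 b) \<noteq> 0" using nz le_degree[of "a + pCons 0 b" "Suc n"] by auto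
      then obtain t where "poly (a + pCons 0 b) t = 0"
        using fundamental_theorem_of_algebra_alt[of "a + pCons 0 b"] by (metis degree_pCons_0)
      then show ?thesis using that[of 1 t] False by (simp add: nf hom_1 deg neg_eq_iff_add_eq_0)
    qed
  qed
  obtain p q where pq: "p * y0 - x0 * q \<noteq> 0"
  proof (cases "x0 = 0")
    case True then show thesis using that[of 1 0] xy0 by simp
  next
    case False then show thesis using that[of 0 1] by simp
  qed
  \<comment> \<open>The new coordinate vector (0, 1) is sent to (x0, y0), which makes the invariant
    line x = 0.\<close>
  define M where "M = M0 ** block p x0 q y0"
  have M: "good_chart M u \<Omega>" unfolding M_def by (rule good_chart_block[OF M0 pq])
  interpret N: homogeneous_chart M u \<Omega> n by unfold_locales (rule M fol n)+
  have Mv: "M *v v3 x y z = M0 *v v3 (p * x + x0 * y) (q * x + y0 * y) z" for x y z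
    by (simp add: M_def matrix_vector_mul_assoc[symmetric] block_mult)
  obtain a b where deg: "degree a \<le> n" "degree b \<le> n"
    and nf: "\<And>x y z. N.w (v3 x y z) = v3 (z * hom n a x y) (z * hom n b x y) (- (x * hom n a x y + y * hom n b x y))"
    using N.normal_form by blast
  have "cdot (N.w (v3 0 1 0)) (v3 0 0 1) = cdot (H.w (v3 x0 y0 0)) (v3 0 0 1)"
    unfolding N.cdot_w H.cdot_w Mv by simp
  then have "N.w (v3 0 1 0) $ 3 = 0" using w0 by (simp add: cdot_eq)
  then have bn: "coeff b n = 0" by (simp add: nf hom_0)
  then have an: "coeff a n \<noteq> 0" using N.top_coeff[OF deg nf] by blast
  have coprime: "coprime a b" by (rule coprime_if_no_common_root) (rule N.no_common_root[OF deg nf])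
  define \<epsilon> :: complex where "\<epsilon> = (if u3 = 0 then 1 else 0)"
  have "normal_chart M u \<Omega> n a b \<epsilon>"
  proof
    show da: "degree a = n" using deg(1) le_degree[OF an] by simp
    show "degree b < n"
      using deg(2) bn n by (metis degree_0 leading_coeff_0_iff le_neq_implies_less)
    show "b \<noteq> 0"
    proof
      assume "b = 0"
      then have "is_unit a" using coprime by simp
      then show False using da n by (auto simp: is_unit_poly_iff)
    qed
    show "a + pCons 0 b \<noteq> 0" by (rule N.fixp_nonzero[OF deg nf])
    show "\<epsilon> = 0 \<or> \<epsilon> = 1" by (simp add: \<epsilon>_def)
    show "cdot u (M *v v3 x y z) = 0 \<longleftrightarrow> (if \<epsilon> = 1 then x = 0 else z = 0)" for x y z
    proof (cases "u3 = 0")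
      case True
      have "u1 * p + u2 * q \<noteq> 0"
      proof
        assume "u1 * p + u2 * q = 0"
        then have "u1 * (p * y0 - x0 * q) = 0" "u2 * (p * y0 - x0 * q) = 0"
          using uxy[OF True] by algebra+
        then show False using pq U0 True by simp
      qed
      moreover have "cdot u (M *v v3 x y z) = (u1 * p + u2 * q) * x"
        using uxy[OF True] True unfolding Mv U by algebra
      ultimately show ?thesis using True by (simp add: \<epsilon>_def)
    next
      case False
      then show ?thesis using u12 by (simp add: Mv U \<epsilon>_def)
    qed
  qed (rule coprime nf)+
  then show ?thesis by blast
qed

context normal_chart
begin

lemma w3_nz:
  assumes "x \<noteq> 0" "poly (a + pCons 0 b) t \<noteq> 0"
  shows "w (v3 x (t * x) 1) \<noteq> 0"
proof -
  have "w (v3 x (t * x) 1) $ 3 = - (x ^ Suc n * poly (a + pCons 0 b) t)"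
    using assms dega degb by (simp add: nf hom_nz algebra_simps)
  then show ?thesis using assms by auto
qed

text \<open>
  On \<open>y = t x\<close> the foliation becomes \<open>(a + t b) dx + x b dt = 0\<close>.  Along a leaf, parametrized by
  \<open>t\<close>, the Wronskian of the lift is a multiple of \<open>a' b - a b'\<close>.
\<close>

lemma critical_point_fixed:
  assumes convex: "convex_foliation \<Omega>" and c: "poly (pderiv a * b - a * pderiv b) c = 0"
  shows "poly (a + pCons 0 b) c = 0"
proof (rule ccontr)
  define C where "C = a + pCons 0 b"
  assume "poly (a + pCons 0 b) c \<noteq> 0"
  then have Cc: "poly C c \<noteq> 0" by (simp add: C_def)
  have "open {t. poly C t \<noteq> 0}"
    by (rule open_Collect_neq) (intro continuous_intros)+
  then obtain r where r: "r > 0" "ball c r \<subseteq> {t. poly C t \<noteq> 0}"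
    using Cc open_contains_ball by (metis (mono_tags) mem_Collect_eq)
  define S where "S = ball c r"
  have S: "open S" "connected S" "convex S" "c \<in> S" using r by (auto simp: S_def)
  have C0: "poly C t \<noteq> 0" if "t \<in> S" for t using that r by (auto simp: S_def)
  \<comment> \<open>The logarithmic derivative of x along the leaf, from (a + t b) dx + x b dt =
    0.\<close>
  define g where "g t = - (poly b t / poly C t)" for t
  define g' where "g' t = - ((poly (pderiv b) t * poly C t - poly b t * poly (pderiv C) t) / (poly C t * poly C t))" for t
  have g': "(g has_field_derivative g' t) (at t)" if "t \<in> S" for t
    unfolding g_def g'_def using C0[OF that] by (auto intro!: derivative_eq_intros)
  have "\<exists>G. \<forall>t\<in>S. (G has_field_derivative g t) (at t)"
  proof -
    have "g holomorphic_on S"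
      using g' by (meson holomorphic_onI field_differentiable_def field_differentiable_at_within)
    then obtain G where "\<And>t. t \<in> S \<Longrightarrow> (G has_field_derivative g t) (at t within S)"
      using holomorphic_convex_primitive'[OF S(3) S(1)] by blast
    then show ?thesis using S(1) at_within_open by metis
  qed
  then obtain G where G: "\<And>t. t \<in> S \<Longrightarrow> (G has_field_derivative g t) (at t)" by blast
  define x where "x t = exp (G t)" for t
  have x0: "x t \<noteq> 0" for t by (simp add: x_def)
  have x': "(x has_field_derivative x t * g t) (at t)" if "t \<in> S" for t
    unfolding x_def using G[OF that] by (auto intro!: derivative_eq_intros)
  define \<gamma> where "\<gamma> t = M *v v3 (x t) (t * x t) 1" for t
  have \<gamma>_i: "\<gamma> t $ i = M $ i $ 1 * x t + M $ i $ 2 * (t * x t) + M $ i $ 3" for t i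
    by (simp add: \<gamma>_def matrix_vector_mult_def sum_3)
  have d1: "((\<lambda>s. \<gamma> s $ i) has_field_derivative
      M $ i $ 1 * (x t * g t) + M $ i $ 2 * (x t + t * (x t * g t))) (at t)" if "t \<in> S" for t i
    unfolding \<gamma>_i using x'[OF that] by (auto intro!: derivative_eq_intros)
  have cd1: "curve_deriv \<gamma> t = M *v v3 (x t * g t) (x t + t * (x t * g t)) 0" if "t \<in> S" for t
    by (simp add: curve_deriv_def vec_eq_iff matrix_vector_mult_def sum_3 DERIV_imp_deriv[OF d1[OF that]])
  have cd2: "curve_deriv (curve_deriv \<gamma>) c = (2 * g c) *s curve_deriv \<gamma> c"
  proof -
    \<comment> \<open>b' C - b C' = - (a' b - a b') - b^2, and the Wronskian vanishes at
      \<open>c\<close>. The relation g' = g^2 is what makes the second derivative of the lift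
      proportional to the first.\<close>
    have gc: "g' c = (g c)\<^sup>2"
    proof -
      have "poly (pderiv b) c * poly C c - poly b c * poly (pderiv C) c = - (poly b c)\<^sup>2"
        using c by (simp add: C_def pderiv_add pderiv_pCons power2_eq_square algebra_simps)
      then show ?thesis by (simp add: g'_def g_def power2_eq_square)
    qed
    have "((\<lambda>s. curve_deriv \<gamma> s $ i) has_field_derivative (2 * g c) * (curve_deriv \<gamma> c $ i)) (at c)" for i
    proof (rule has_field_derivative_transform_within_open[OF _ S(1,4)])
      show "((\<lambda>s. M $ i $ 1 * (x s * g s) + M $ i $ 2 * (x s + s * (x s * g s)))
          has_field_derivative (2 * g c) * (curve_deriv \<gamma> c $ i)) (at c)"
        by (rule derivative_eq_intros x' g' S(4) refl)+
          (simp add: cd1 S(4) gc matrix_vector_mult_def sum_3 power2_eq_square algebra_simps)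
    qed (simp add: cd1 matrix_vector_mult_def sum_3)
    then have "deriv (\<lambda>s. curve_deriv \<gamma> s $ i) c = (2 * g c) * (curve_deriv \<gamma> c $ i)" for i
      by (rule DERIV_imp_deriv)
    then show ?thesis unfolding curve_deriv_def[of "curve_deriv \<gamma>"] vec_eq_iff by simp
  qed
  have "inflection_point \<gamma> c"
    unfolding inflection_point_def cd2 det_3 by (simp add: algebra_simps)
  moreover have "leaf_piece \<Omega> S \<gamma>"
    unfolding leaf_piece_def
  proof (intro conjI ballI allI)
    show "(\<lambda>t. \<gamma> t $ i) holomorphic_on S" for i
      using d1 by (meson holomorphic_onI field_differentiable_def field_differentiable_at_within)
    fix t assume t: "t \<in> S"
    show "\<gamma> t \<noteq> 0" by (simp add: \<gamma>_def invertible_mult_eq_0[OF inv] v3_eq_0_iff)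
    show "curve_deriv \<gamma> t \<noteq> k *s \<gamma> t" for k
    proof
      assume "curve_deriv \<gamma> t = k *s \<gamma> t"
      then have "M *v (v3 (x t * g t) (x t + t * (x t * g t)) 0 - k *s v3 (x t) (t * x t) 1) = 0"
        by (simp add: cd1 t \<gamma>_def matrix_vector_mult_diff_distrib vector_scalar_commute)
      then have "v3 (x t * g t) (x t + t * (x t * g t)) 0 - k *s v3 (x t) (t * x t) 1 = 0"
        using invertible_mult_eq_0[OF inv] by blast
      then show False using x0 by (auto simp: vec_eq_iff forall_3)
    qed
    show "form_at \<Omega> (\<gamma> t) \<noteq> 0"
      using w3_nz[OF x0, of t t] C0[OF t] by (auto simp: w_def \<gamma>_def C_def)
    have "cdot (form_at \<Omega> (\<gamma> t)) (curve_deriv \<gamma> t)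
        = x t ^ n * (poly C t * (x t * g t) + poly b t * x t)"
      using x0[of t] dega degb unfolding cd1[OF t] \<gamma>_def cdot_w[symmetric] nf
      by (simp add: cdot_eq hom_nz C_def algebra_simps)
    also have "\<dots> = 0" using C0[OF t] by (simp add: g_def)
    finally show "cdot (form_at \<Omega> (\<gamma> t)) (curve_deriv \<gamma> t) = 0" .
  qed (rule S)+
  \<comment> \<open>A linear relation between x, t x and 1 can be differentiated and divided by x;
    clearing the denominator gives v2 a = v1 b, which deg b < deg a excludes unless both
    coefficients vanish.\<close>
  moreover have "\<not> (\<exists>U. U \<noteq> 0 \<and> (\<forall>t\<in>S. cdot U (\<gamma> t) = 0))"
  proof
    assume "\<exists>U. U \<noteq> 0 \<and> (\<forall>t\<in>S. cdot U (\<gamma> t) = 0)"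
    then obtain U where U: "U \<noteq> 0" "\<And>t. t \<in> S \<Longrightarrow> cdot U (\<gamma> t) = 0" by blast
    define v1 v2 v3' where "v1 = (U v* M) $ 1" and "v2 = (U v* M) $ 2" and "v3' = (U v* M) $ 3"
    have V0: "\<not> (v1 = 0 \<and> v2 = 0 \<and> v3' = 0)"
      using U(1) v_invertible_mult_eq_0[OF inv, of U] by (auto simp: v1_def v2_def v3'_def vec_eq_iff forall_3)
    have V: "v1 * x t + v2 * (t * x t) + v3' = 0" if "t \<in> S" for t
      using U(2)[OF that] unfolding \<gamma>_def cdot_v_mult[symmetric] by (simp add: cdot_eq v1_def v2_def v3'_def)
    have vanish: "p = 0" if "\<And>t. t \<in> S \<Longrightarrow> poly p t = 0" for p
    proof (rule ccontr)
      assume "p \<noteq> 0"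
      then have "finite S" using that poly_roots_finite[of p] by (metis (mono_tags) finite_subset mem_Collect_eq subsetI)
      then show False using S finite_imp_not_open by blast
    qed
    have eq: "v1 * g t + v2 * (1 + t * g t) = 0" if t: "t \<in> S" for t
    proof -
      have "((\<lambda>t. v1 * x t + v2 * (t * x t) + v3') has_field_derivative
          v1 * (x t * g t) + v2 * (x t + t * (x t * g t))) (at t)"
        using x'[OF t] by (auto intro!: derivative_eq_intros)
      moreover have "((\<lambda>t. v1 * x t + v2 * (t * x t) + v3') has_field_derivative 0) (at t)"
        by (rule has_field_derivative_transform_within_open[OF DERIV_const S(1) t]) (simp add: V)
      ultimately have "v1 * (x t * g t) + v2 * (x t + t * (x t * g t)) = 0" by (rule DERIV_unique)
      then have "x t * (v1 * g t + v2 * (1 + t * g t)) = 0" by (simp add: algebra_simps)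
      then show ?thesis using x0 by simp
    qed
    have "smult v2 a - smult v1 b = 0"
    proof (rule vanish)
      fix t assume t: "t \<in> S"
      have "poly C t * (v1 * g t + v2 * (1 + t * g t)) = v2 * (poly C t - t * poly b t) - v1 * poly b t"
        using C0[OF t] by (simp add: g_def algebra_simps)
      then show "poly (smult v2 a - smult v1 b) t = 0" using eq[OF t] by (simp add: C_def)
    qed
    then have *: "smult v2 a = smult v1 b" by simp
    have "v2 = 0"
    proof (rule ccontr)
      assume "v2 \<noteq> 0"
      then have "degree (smult v2 a) = n" using dega by simp
      then show False using * degb by (metis degree_smult_le not_le)
    qed
    then have "v1 = 0" using * b0 by simp
    then show False using V[OF S(4)] V0 \<open>v2 = 0\<close> by simp
  qed
  ultimately show False using convex S(4) unfolding convex_foliation_def by blast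
qed

lemma convex_pencil: "convex_foliation \<Omega> \<Longrightarrow> convex_pencil a b n"
  by unfold_locales (use dega degb b0 coprime critical_point_fixed in blast)+

end

section \<open>The Legendre transform in the adapted chart\<close>

lemma poly_poly_eval: "poly (poly c r) x = poly (poly c [:poly r x:]) x"
  by (induction c) simp_all

lemma eval3_line: "poly (poly (poly P 1) [:- q, p:]) x = eval3 P (v3 x (p * x - q) 1)"
  by (subst poly_poly_eval) (simp add: eval3_def one_pCons mult.commute)

definition line_vec :: "complex \<times> complex \<Rightarrow> complex ^ 3" where
  "line_vec z = v3 (fst z) (- 1) (- snd z)"

text \<open>The contact point of the line \<open>z\<close> in the tangent direction \<open>v\<close>, i.e. \<open>x = dq / dp\<close>.\<close>

definition contact :: "complex \<times> complex \<Rightarrow> complex \<times> complex \<Rightarrow> complex ^ 3" where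
  "contact z v = v3 (snd v) (fst z * snd v - snd z * fst v) (fst v)"

text \<open>The right-hand sides have degree n + 2 in the tangent vector, the web has degree n + 1:
  the relation xa + yb + zc = 0 makes A + p B drop one degree on the line. The surplus factor is dp,
  or dq after another use of the relation; one of the two is non-zero for each non-zero
  \<open>v\<close>.\<close>

lemma legendre_eq:
  assumes "foliation n \<Omega>"
  shows "fst v * legendre (Suc n) u \<Omega> z v =
      cdot u (contact z v) * (eval3 (\<Omega> $ 1) (contact z v) + fst z * eval3 (\<Omega> $ 2) (contact z v))" (is ?A)
    and "snd v * legendre (Suc n) u \<Omega> z v =
      cdot u (contact z v) * (snd z * eval3 (\<Omega> $ 2) (contact z v) - eval3 (\<Omega> $ 3) (contact z v))" (is ?B)
proof -
  obtain p q where z: "z = (p, q)" by fastforce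
  obtain dp dq where v: "v = (dp, dq)" by fastforce
  have homog: "eval3 (\<Omega> $ i) (v3 (\<mu> * x) (\<mu> * y) (\<mu> * z)) = \<mu> ^ (n + 1) * eval3 (\<Omega> $ i) (v3 x y z)" for i \<mu> x y z
    using assms unfolding foliation_def by (intro eval3_homogeneous) blast
  have rel: "m $ 1 * eval3 (\<Omega> $ 1) m + m $ 2 * eval3 (\<Omega> $ 2) m + m $ 3 * eval3 (\<Omega> $ 3) m = 0" for m
  proof -
    have "eval3 ([:[:[:0, 1:]:]:] * \<Omega> $ 1 + [:[:0, 1:]:] * \<Omega> $ 2 + [:0, 1:] * \<Omega> $ 3) m = eval3 0 m"
      using assms by (simp add: foliation_def)
    then show ?thesis by (simp add: eval3_def)
  qed
  define G where "G = poly (poly (\<Omega> $ 1) 1) [:- q, p:] + smult p (poly (poly (\<Omega> $ 2) 1) [:- q, p:])"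
  define lp where "lp = legendre_poly u \<Omega> p q"
  have polyG: "poly G x = eval3 (\<Omega> $ 1) (v3 x (p * x - q) 1) + p * eval3 (\<Omega> $ 2) (v3 x (p * x - q) 1)" for x
    by (simp add: G_def eval3_line)
  have relG: "x * poly G x = q * eval3 (\<Omega> $ 2) (v3 x (p * x - q) 1) - eval3 (\<Omega> $ 3) (v3 x (p * x - q) 1)" for x
    using rel[of "v3 x (p * x - q) 1"] by (simp add: polyG algebra_simps eq_diff_eq)
  \<comment> \<open>By \<open>relG\<close>, x G(x) is the restriction to the line of a form of
    degree n + 1.\<close>
  have degG: "degree G \<le> n"
  proof -
    have "polyfun (\<lambda>m. q * eval3 (\<Omega> $ 2) m - eval3 (\<Omega> $ 3) m)"
      by (intro polyfun_intros polyfun_eval3)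
    then obtain a' where a': "\<And>t. poly a' t = q * eval3 (\<Omega> $ 2) (v3 1 (p - q * t) t) - eval3 (\<Omega> $ 3) (v3 1 (p - q * t) t)"
      using polyfun_restrict[of "\<lambda>m. q * eval3 (\<Omega> $ 2) m - eval3 (\<Omega> $ 3) m" 1 "[:p, - q:]" "[:0, 1:]"]
      by (auto simp: mult.commute)
    show ?thesis
    proof (rule degree_le_reflect)
      fix t :: complex assume t: "t \<noteq> 0"
      have "v3 t (p * t - q) 1 = v3 (t * 1) (t * (p - q * inverse t)) (t * inverse t)"
        using t by (simp add: v3_eq_iff algebra_simps)
      then have "t * poly G t = t ^ (n + 1) * poly a' (inverse t)"
        unfolding relG a' by (simp only: homog) (simp add: algebra_simps)
      then show "poly G t = t ^ n * poly a' (inverse t)" using t by simp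
    qed
  qed
  have lp: "lp = ([:0, u $ 1:] + smult (u $ 2) [:- q, p:] + [:u $ 3:]) * G"
    by (simp add: lp_def legendre_poly_def G_def)
  have deg: "degree lp \<le> Suc n"
  proof -
    have "degree ([:0, u $ 1:] + smult (u $ 2) [:- q, p:] + [:u $ 3:]) \<le> 1" by simp
    moreover have "degree lp \<le> degree ([:0, u $ 1:] + smult (u $ 2) [:- q, p:] + [:u $ 3:]) + degree G"
      unfolding lp by (rule degree_mult_le)
    ultimately show ?thesis using degG by linarith
  qed
  have leg: "legendre (Suc n) u \<Omega> (p, q) (s, dq) = hom (Suc n) lp s dq" for s
    unfolding legendre_def hom_def lp_def[symmetric] prod.case by (rule sum.cong) (simp_all add: mult_ac)
  define m where "m s = v3 dq (p * dq - q * s) s" for s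
  have nzA: "s * hom (Suc n) lp s dq = cdot u (m s) * (eval3 (\<Omega> $ 1) (m s) + p * eval3 (\<Omega> $ 2) (m s))"
    if s: "s \<noteq> 0" for s
  proof -
    define x where "x = dq / s"
    have ms: "m s = v3 (s * x) (s * (p * x - q)) (s * 1)"
      using s by (simp add: m_def x_def v3_eq_iff algebra_simps)
    have "cdot u (m s) = s * (u $ 1 * x + u $ 2 * (p * x - q) + u $ 3)"
      unfolding ms by (simp add: cdot_eq algebra_simps)
    moreover have "eval3 (\<Omega> $ 1) (m s) + p * eval3 (\<Omega> $ 2) (m s) = s ^ (n + 1) * poly G x"
      unfolding ms homog polyG by (simp add: algebra_simps)
    moreover have "hom (Suc n) lp s dq = s ^ Suc n * ((u $ 1 * x + u $ 2 * (p * x - q) + u $ 3) * poly G x)"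
      using s deg by (simp add: hom_nz x_def[symmetric]) (simp add: lp algebra_simps)
    ultimately show ?thesis by simp
  qed
  have relm: "dq * (eval3 (\<Omega> $ 1) (m s) + p * eval3 (\<Omega> $ 2) (m s)) = s * (q * eval3 (\<Omega> $ 2) (m s) - eval3 (\<Omega> $ 3) (m s))" for s
    using rel[of "m s"] unfolding m_def by (simp add: algebra_simps eq_diff_eq)
  have nzB: "dq * hom (Suc n) lp s dq = cdot u (m s) * (q * eval3 (\<Omega> $ 2) (m s) - eval3 (\<Omega> $ 3) (m s))"
    if s: "s \<noteq> 0" for s
  proof -
    have "s * (dq * hom (Suc n) lp s dq) = s * (cdot u (m s) * (q * eval3 (\<Omega> $ 2) (m s) - eval3 (\<Omega> $ 3) (m s)))"
      using nzA[OF s] relm[of s] by algebra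
    then show ?thesis using s by simp
  qed
  have cont: "isCont (\<lambda>s. eval3 Q (m s)) s0" for Q s0
  proof -
    obtain r where "\<And>t. poly r t = eval3 Q (m t)"
      using polyfun_restrict[OF polyfun_eval3[of Q], of "[:dq:]" "[:p * dq, - q:]" "[:0, 1:]"]
      by (auto simp: m_def mult.commute)
    then have "(\<lambda>s. eval3 Q (m s)) = poly r" by auto
    then show ?thesis by simp
  qed
  have cont': "isCont (\<lambda>s. cdot u (m s)) s0" for s0
    by (simp add: m_def cdot_eq)
  have "dp * hom (Suc n) lp dp dq = cdot u (m dp) * (eval3 (\<Omega> $ 1) (m dp) + p * eval3 (\<Omega> $ 2) (m dp))"
    by (rule eq_off_0[where f = "\<lambda>s. s * hom (Suc n) lp s dq" and g = "\<lambda>s. cdot u (m s) * (eval3 (\<Omega> $ 1) (m s) + p * eval3 (\<Omega> $ 2) (m s))"])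
      (intro continuous_intros continuous_hom cont cont' nzA | assumption)+
  then show ?A by (simp add: z v leg m_def contact_def)
  have "dq * hom (Suc n) lp dp dq = cdot u (m dp) * (q * eval3 (\<Omega> $ 2) (m dp) - eval3 (\<Omega> $ 3) (m dp))"
    by (rule eq_off_0[where f = "\<lambda>s. dq * hom (Suc n) lp s dq" and g = "\<lambda>s. cdot u (m s) * (q * eval3 (\<Omega> $ 2) (m s) - eval3 (\<Omega> $ 3) (m s))"])
      (intro continuous_intros continuous_hom cont cont' nzB | assumption)+
  then show ?B by (simp add: z v leg m_def contact_def)
qed

text \<open>Both alternatives are incidence relations, the contact point lying on \<ell> or the line
  being tangent to the foliation there, so they can be transported to the chart
  \<open>M\<close>.\<close>

lemma legendre_eq_0_iff:
  assumes "foliation n \<Omega>" and v: "v \<noteq> 0"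
  shows "legendre (Suc n) u \<Omega> z v = 0 \<longleftrightarrow> cdot u (contact z v) = 0 \<or>
    (\<forall>e. cdot (line_vec z) e = 0 \<longrightarrow> cdot (form_at \<Omega> (contact z v)) e = 0)"
proof -
  define m where "m = contact z v"
  note eqs = legendre_eq[OF assms(1), of v u z, folded m_def]
  have leg0: "legendre (Suc n) u \<Omega> z v = 0 \<longleftrightarrow> fst v * legendre (Suc n) u \<Omega> z v = 0 \<and> snd v * legendre (Suc n) u \<Omega> z v = 0"
    using v by (auto simp: prod_eq_iff)
  have "(\<forall>e. cdot (line_vec z) e = 0 \<longrightarrow> cdot (form_at \<Omega> m) e = 0) \<longleftrightarrow>
      eval3 (\<Omega> $ 1) m + fst z * eval3 (\<Omega> $ 2) m = 0 \<and> snd z * eval3 (\<Omega> $ 2) m - eval3 (\<Omega> $ 3) m = 0" (is "?L \<longleftrightarrow> ?R")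
  proof
    assume L: ?L
    have "cdot (form_at \<Omega> m) (v3 1 (fst z) 0) = 0" "cdot (form_at \<Omega> m) (v3 0 (- snd z) 1) = 0"
      by (rule L[rule_format], simp add: line_vec_def cdot_eq)+
    then show ?R by (auto simp: cdot_eq form_at_def algebra_simps)
  next
    assume R: ?R
    show ?L
    proof (intro allI impI)
      fix e assume "cdot (line_vec z) e = 0"
      then have "e $ 2 = fst z * e $ 1 - snd z * e $ 3" by (simp add: line_vec_def cdot_eq algebra_simps)
      then have "cdot (form_at \<Omega> m) e = e $ 1 * (eval3 (\<Omega> $ 1) m + fst z * eval3 (\<Omega> $ 2) m)
          - e $ 3 * (snd z * eval3 (\<Omega> $ 2) m - eval3 (\<Omega> $ 3) m)"
        unfolding cdot_eq form_at_def vec_lambda_beta by algebra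
      then show "cdot (form_at \<Omega> m) e = 0" using R by simp
    qed
  qed
  then show ?thesis unfolding leg0 eqs m_def[symmetric] by auto
qed

lemma legendre_at_0: "legendre (Suc n) u \<Omega> z 0 = 0"
  by (cases z) (auto simp: legendre_def zero_prod_def power_0_left intro!: sum.neutral)

context normal_chart
begin

text \<open>The coefficients of the line \<open>z\<close> in the chart \<open>M\<close>. Off
  \<open>l 2 z = 0\<close> its equation in that chart is y = Pc x - Qc, and \<open>\<phi>\<close>,
  \<open>\<psi>\<close> are the differentials of \<open>Pc\<close>, \<open>Qc\<close>.\<close>

definition l :: "3 \<Rightarrow> complex \<times> complex \<Rightarrow> complex" where
  "l j z = fst z * M $ 1 $ j - M $ 2 $ j - snd z * M $ 3 $ j"

definition dl :: "3 \<Rightarrow> complex \<times> complex" where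
  "dl j = (M $ 1 $ j, - M $ 3 $ j)"

definition Pc where "Pc z = - (l 1 z / l 2 z)"
definition Qc where "Qc z = l 3 z / l 2 z"
definition \<phi> where "\<phi> z = - (scl (1 / l 2 z) (dl 1) - scl (l 1 z / (l 2 z)\<^sup>2) (dl 2))"
definition \<psi> where "\<psi> z = scl (1 / l 2 z) (dl 3) - scl (l 3 z / (l 2 z)\<^sup>2) (dl 2)"

lemma has_diff_l: "has_diff (l j) (dl j) z"
proof -
  have "has_diff (\<lambda>z. fst z * M $ 1 $ j - M $ 2 $ j - snd z * M $ 3 $ j)
      (scl (fst z) 0 + scl (M $ 1 $ j) (1, 0) - 0 - (scl (snd z) 0 + scl (M $ 3 $ j) (0, 1))) z"
    by (intro has_diff_diff has_diff_mult has_diff_const has_diff_fst has_diff_snd)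
  then show ?thesis by (simp add: l_def[abs_def] dl_def scl_def)
qed

lemma has_diff_Pc: "l 2 z \<noteq> 0 \<Longrightarrow> has_diff Pc (\<phi> z) z"
  unfolding Pc_def[abs_def] \<phi>_def by (intro has_diff_minus has_diff_divide has_diff_l)

lemma has_diff_Qc: "l 2 z \<noteq> 0 \<Longrightarrow> has_diff Qc (\<psi> z) z"
  unfolding Qc_def[abs_def] \<psi>_def by (intro has_diff_divide has_diff_l)

lemma line_vec_v_mult: "(line_vec z v* M) $ j = l j z"
  by (simp add: line_vec_def l_def vector_matrix_mult_def sum_3)

text \<open>The contact point is the intersection of two infinitesimally near lines, i.e. the cross
  product of the covector of the line and its derivative. \<open>M\<close> maps the cross product of
  the transformed covectors to det M times the original one, and normalizing the covector by
  \<open>l 2\<close> accounts for the square.\<close>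

lemma contact_eq:
  assumes "l 2 z \<noteq> 0"
  shows "contact z v = ((l 2 z)\<^sup>2 / det M) *s
    (M *v v3 (dotp (\<psi> z) v) (Pc z * dotp (\<psi> z) v - Qc z * dotp (\<phi> z) v) (dotp (\<phi> z) v))"
proof -
  define h where "h j = dotp (dl j) v" for j
  have \<phi>: "dotp (\<phi> z) v = (l 1 z * h 2 - l 2 z * h 1) / (l 2 z)\<^sup>2"
    using assms by (simp add: \<phi>_def h_def dotp_def field_simps power2_eq_square)
  have \<psi>: "dotp (\<psi> z) v = (l 2 z * h 3 - l 3 z * h 2) / (l 2 z)\<^sup>2"
    using assms by (simp add: \<psi>_def h_def dotp_def field_simps power2_eq_square)
  have Y: "Pc z * dotp (\<psi> z) v - Qc z * dotp (\<phi> z) v = (l 3 z * h 1 - l 1 z * h 3) / (l 2 z)\<^sup>2"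
  proof -
    have "Pc z * l 2 z = - l 1 z" "Qc z * l 2 z = l 3 z" using assms by (simp_all add: Pc_def Qc_def)
    then have "Pc z * (l 2 z * h 3 - l 3 z * h 2) - Qc z * (l 1 z * h 2 - l 2 z * h 1) = l 3 z * h 1 - l 1 z * h 3"
      by algebra
    then show ?thesis unfolding \<phi> \<psi> by (metis diff_divide_distrib times_divide_eq_right)
  qed
  have dM: "det M \<noteq> 0" using inv invertible_det_nz[of M] by blast
  have "M *v v3 (l 2 z * h 3 - l 3 z * h 2) (l 3 z * h 1 - l 1 z * h 3) (l 1 z * h 2 - l 2 z * h 1) = det M *s contact z v"
    unfolding vec_eq_iff forall_3 h_def
    by (simp add: matrix_vector_mult_def sum_3 contact_def l_def dl_def dotp_def det_3 algebra_simps)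
  moreover have "v3 (dotp (\<psi> z) v) (Pc z * dotp (\<psi> z) v - Qc z * dotp (\<phi> z) v) (dotp (\<phi> z) v)
     = (1 / (l 2 z)\<^sup>2) *s v3 (l 2 z * h 3 - l 3 z * h 2) (l 3 z * h 1 - l 1 z * h 3) (l 1 z * h 2 - l 2 z * h 1)"
    unfolding Y unfolding \<phi> \<psi> by (simp add: vec_eq_iff forall_3)
  ultimately show ?thesis
    using dM assms by (simp add: vector_scalar_commute vector_smult_assoc)
qed

lemma dP_dQ_0:
  assumes "l 2 z \<noteq> 0" "dotp (\<phi> z) v = 0" "dotp (\<psi> z) v = 0"
  shows "v = 0"
proof -
  have "v3 0 0 0 = (0 :: complex ^ 3)" by (simp add: v3_eq_0_iff)
  then have "contact z v = 0" using contact_eq[OF assms(1), of v] assms by simp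
  then show ?thesis by (simp add: contact_def v3_eq_0_iff prod_eq_iff)
qed

lemma wd_\<phi>_\<psi>: assumes "l 2 z \<noteq> 0" shows "wd (\<phi> z) (\<psi> z) \<noteq> 0"
proof
  assume 0: "wd (\<phi> z) (\<psi> z) = 0"
  have "(snd (\<phi> z), - fst (\<phi> z)) = 0" "(snd (\<psi> z), - fst (\<psi> z)) = 0"
    using 0 by (auto intro!: dP_dQ_0[OF assms] simp: dotp_def wd_def algebra_simps)
  then have "(1, 0) = (0 :: complex \<times> complex)"
    by (intro dP_dQ_0[OF assms]) (auto simp: dotp_def zero_prod_def)
  then show False by (simp add: zero_prod_def)
qed

text \<open>In the chart the contact point is (dQ, P dQ - Q dP, dP), and tangency means that its
  slope t = y / x is a root of a + P b. For dQ = 0 only the top coefficient of \<open>a\<close>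
  remains, multiplied by a power of - Q dP, so there is no tangency.\<close>

lemma legendre_zero:
  assumes l2: "l 2 z \<noteq> 0" and l3: "l 3 z \<noteq> 0" and v: "v \<noteq> 0"
  shows "legendre (Suc n) u \<Omega> z v = 0 \<longleftrightarrow>
    dotp (if \<epsilon> = 1 then \<psi> z else \<phi> z) v = 0 \<or>
    (\<exists>t. poly (a + smult (Pc z) b) t = 0 \<and> (Pc z - t) * dotp (\<psi> z) v = Qc z * dotp (\<phi> z) v)"
proof -
  define X Z P Q where "X = dotp (\<psi> z) v" and "Z = dotp (\<phi> z) v" and "P = Pc z" and "Q = Qc z"
  define Y where "Y = P * X - Q * Z"
  define \<kappa> where "\<kappa> = (l 2 z)\<^sup>2 / det M"
  have \<kappa>: "\<kappa> \<noteq> 0" using l2 inv invertible_det_nz[of M] by (simp add: \<kappa>_def)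
  have Q0: "Q \<noteq> 0" using l2 l3 by (simp add: Q_def Qc_def)
  have XZ: "X \<noteq> 0 \<or> Z \<noteq> 0" using dP_dQ_0[OF l2, of v] v by (auto simp: X_def Z_def)
  have m: "contact z v = M *v v3 (\<kappa> * X) (\<kappa> * Y) (\<kappa> * Z)"
  proof -
    have "v3 (\<kappa> * X) (\<kappa> * Y) (\<kappa> * Z) = \<kappa> *s v3 X Y Z" by (simp add: vec_eq_iff forall_3)
    then show ?thesis
      using contact_eq[OF l2, of v] by (simp add: vector_scalar_commute \<kappa>_def X_def Y_def Z_def P_def Q_def)
  qed
  have 1: "cdot u (contact z v) = 0 \<longleftrightarrow> dotp (if \<epsilon> = 1 then \<psi> z else \<phi> z) v = 0"
    unfolding m line using \<kappa> by (simp add: X_def Z_def)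
  define A where "A = hom n a X Y + P * hom n b X Y"
  have "(\<forall>e. cdot (line_vec z) e = 0 \<longrightarrow> cdot (form_at \<Omega> (contact z v)) e = 0) \<longleftrightarrow>
      (\<forall>e. cdot (line_vec z) (M *v e) = 0 \<longrightarrow> cdot (form_at \<Omega> (contact z v)) (M *v e) = 0)"
  proof -
    obtain L where "M ** L = mat 1" using inv by (auto simp: invertible_def)
    then have "M *v (L *v e) = e" for e by (simp add: matrix_vector_mul_assoc)
    then show ?thesis by metis
  qed
  also have "\<dots> \<longleftrightarrow> (\<forall>x y t. - P * x + y + Q * t = 0 \<longrightarrow> Z * A * x = 0 \<and> X * A * t = 0)"
  proof -
    have e1: "cdot (line_vec z) (M *v v3 x y t) = l 2 z * (- P * x + y + Q * t)" for x y t
    proof -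
      have "l 1 z = - P * l 2 z" "l 3 z = Q * l 2 z" using l2 by (simp_all add: P_def Pc_def Q_def Qc_def)
      then show ?thesis
        unfolding cdot_v_mult[symmetric] unfolding cdot_eq line_vec_v_mult vector_3 by algebra
    qed
    have e2: "cdot (form_at \<Omega> (contact z v)) (M *v v3 x y t) = \<kappa> ^ (n + 1) * (Z * A * x - X * A * t)"
      if "- P * x + y + Q * t = 0" for x y t
    proof -
      have y: "y = P * x - Q * t" using that by algebra
      show ?thesis
        unfolding m cdot_w[symmetric] w_homogeneous y unfolding nf
        by (simp add: cdot_eq A_def Y_def algebra_simps)
    qed
    have all3: "(\<forall>e. R e) \<longleftrightarrow> (\<forall>x y t. R (v3 x y t))" for R by (metis ex_v3)
    have "(\<forall>e. cdot (line_vec z) (M *v e) = 0 \<longrightarrow> cdot (form_at \<Omega> (contact z v)) (M *v e) = 0) \<longleftrightarrow>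
       (\<forall>x y t. - P * x + y + Q * t = 0 \<longrightarrow> Z * A * x - X * A * t = 0)"
      unfolding all3[of "\<lambda>e. cdot (line_vec z) (M *v e) = 0 \<longrightarrow> cdot (form_at \<Omega> (contact z v)) (M *v e) = 0"]
      using l2 \<kappa> by (simp add: e1 e2)
    also have "\<dots> \<longleftrightarrow> (\<forall>x y t. - P * x + y + Q * t = 0 \<longrightarrow> Z * A * x = 0 \<and> X * A * t = 0)"
    proof safe
      fix x y t assume *: "\<forall>x y t. - P * x + y + Q * t = 0 \<longrightarrow> Z * A * x - X * A * t = 0"
      show "Z * A * x = 0" using *[rule_format, of 1 P 0] by simp
      show "X * A * t = 0" using *[rule_format, of 0 "- Q" 1] by simp
    qed (metis diff_self)
    finally show ?thesis .
  qed
  also have "\<dots> \<longleftrightarrow> A = 0"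
  proof
    assume *: "\<forall>x y t. - P * x + y + Q * t = 0 \<longrightarrow> Z * A * x = 0 \<and> X * A * t = 0"
    have "Z * A = 0" using *[rule_format, of 1 P 0] by simp
    moreover have "X * A = 0" using *[rule_format, of 0 "- Q" 1] by simp
    ultimately show "A = 0" using XZ by auto
  qed simp
  also have "\<dots> \<longleftrightarrow> (\<exists>t. poly (a + smult P b) t = 0 \<and> (P - t) * X = Q * Z)"
  proof (cases "X = 0")
    case True
    then have Y: "Y = - Q * Z" and Z: "Z \<noteq> 0" using XZ by (auto simp: Y_def)
    have "coeff a n \<noteq> 0" using dega n by (metis degree_0 leading_coeff_0_iff not_less_zero)
    moreover have "coeff b n = 0" using degb by (rule coeff_eq_0)
    ultimately show ?thesis using True Y Z Q0 by (simp add: A_def hom_0)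
  next
    case False
    have "A = X ^ n * poly (a + smult P b) (Y / X)"
      using False dega degb by (simp add: A_def hom_nz algebra_simps)
    moreover have "(P - t) * X = Q * Z \<longleftrightarrow> t = Y / X" for t
      using False by (auto simp: Y_def field_simps)
    ultimately show ?thesis using False by simp
  qed
  finally show ?thesis
    unfolding legendre_eq_0_iff[OF fol v] 1 by (simp add: X_def Z_def P_def Q_def)
qed

end

section \<open>Flatness\<close>

lemma closure_Int_open_dense:
  assumes "open S" "closure S = UNIV" "closure T = UNIV"
  shows "closure (S \<inter> T) = UNIV"
proof -
  have "S \<subseteq> closure (S \<inter> T)" using open_Int_closure_subset[OF assms(1), of T] assms(3) by simp
  then have "closure S \<subseteq> closure (S \<inter> T)" by (simp add: closure_minimal)
  then show ?thesis using assms(2) by auto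
qed

lemma open_dense_INT:
  assumes "finite I" "\<And>i. i \<in> I \<Longrightarrow> open (S i) \<and> closure (S i) = UNIV"
  shows "open (\<Inter>i\<in>I. S i) \<and> closure (\<Inter>i\<in>I. S i) = UNIV"
  using assms by (induction I rule: finite_induct) (auto simp: closure_Int_open_dense)

lemma open_dense_affine:
  assumes "k \<noteq> (0 :: complex ^ 3)"
  shows "open {z. cdot (line_vec z) k \<noteq> 0} \<and> closure {z. cdot (line_vec z) k \<noteq> 0} = UNIV"
proof
  define h where "h z = fst z * k $ 1 - k $ 2 - snd z * k $ 3" for z :: "complex \<times> complex"
  have h: "cdot (line_vec z) k = h z" for z by (simp add: h_def line_vec_def cdot_eq)
  show "open {z. cdot (line_vec z) k \<noteq> 0}"
    unfolding h h_def by (rule open_Collect_neq) (intro continuous_intros)+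
  have "z \<in> closure {z. h z \<noteq> 0}" for z
  proof (cases "k $ 1 = 0 \<and> k $ 3 = 0")
    case True
    then have "k $ 2 \<noteq> 0" using assms by (auto simp: vec_eq_iff forall_3)
    then show ?thesis using True closure_subset by (force simp: h_def)
  next
    case False
    show ?thesis
      unfolding closure_approachable
    proof (intro allI impI)
      fix e :: real assume e: "e > 0"
      define w :: "complex \<times> complex" where "w = (if k $ 1 \<noteq> 0 then (of_real (e / 2), 0) else (0, of_real (e / 2)))"
      have w: "norm w = e / 2" using e by (simp add: w_def norm_Pair)
      have hw: "h (z + w) = h z + (if k $ 1 \<noteq> 0 then of_real (e / 2) * k $ 1 else - (of_real (e / 2) * k $ 3))"
        by (simp add: h_def w_def algebra_simps)
      have "h z \<noteq> 0 \<or> h (z + w) \<noteq> 0" unfolding hw using False e by auto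
      moreover have "dist z z < e" "dist (z + w) z < e" using e w by (simp_all add: dist_norm)
      ultimately show "\<exists>y\<in>{z. h z \<noteq> 0}. dist y z < e" by blast
    qed
  qed
  then show "closure {z. cdot (line_vec z) k \<noteq> 0} = UNIV" unfolding h by blast
qed

lemma card_roots_simple:
  fixes p :: "complex poly"
  assumes "\<And>t. poly p t = 0 \<Longrightarrow> poly (pderiv p) t \<noteq> 0"
  shows "card {t. poly p t = 0} = degree p"
proof -
  have sf: "rsquarefree p" using assms by (auto simp: rsquarefree_roots)
  then have p0: "p \<noteq> 0" by (auto simp: rsquarefree_def)
  have "degree p = degree (smult (lead_coeff p) (root_poly {t. poly p t = 0}))"
    using complex_poly_decompose_rsquarefree[OF sf] by (simp add: root_poly_def)
  then show ?thesis using p0 by (simp add: degree_root_poly)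
qed

lemma wd_parallel: "wd A B = 0 \<Longrightarrow> wd A C = 0 \<Longrightarrow> A \<noteq> 0 \<Longrightarrow> wd B C = 0"
proof -
  assume BC: "wd A B = 0" "wd A C = 0" and "A \<noteq> 0"
  from BC have "fst A * wd B C = 0" "snd A * wd B C = 0" unfolding wd_def by algebra+
  then show ?thesis using \<open>A \<noteq> 0\<close> by (auto simp: prod_eq_iff)
qed

lemma wd_basis_eq:
  assumes "wd A B \<noteq> 0" "wd X A = wd Y A" "wd X B = wd Y B"
  shows "X = Y"
proof -
  have "fst X * wd A B = fst Y * wd A B" "snd X * wd A B = snd Y * wd A B"
    using assms(2,3) unfolding wd_def by algebra+
  then show ?thesis using assms(1) by (simp add: prod_eq_iff)
qed

definition kernel_vec :: "complex \<times> complex \<Rightarrow> complex \<times> complex" where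
  "kernel_vec A = (- snd A, fst A)"

lemma dotp_kernel_vec: "dotp A (kernel_vec B) = - wd A B"
  by (simp add: dotp_def kernel_vec_def wd_def)

lemma kernel_vec_eq_0_iff: "kernel_vec A = 0 \<longleftrightarrow> A = 0"
  by (auto simp: kernel_vec_def prod_eq_iff)

lemma superposition_dotp:
  "superposition d W U \<omega> \<Longrightarrow> z \<in> U \<Longrightarrow> W z v = 0 \<longleftrightarrow> (\<exists>i<d. dotp (\<omega> i z) v = 0)"
  unfolding superposition_def dotp_def by blast

lemma eta_form_subset: "eta_form U \<alpha> \<beta> \<gamma> \<eta> \<Longrightarrow> V \<subseteq> U \<Longrightarrow> eta_form V \<alpha> \<beta> \<gamma> \<eta>"
  unfolding eta_form_def holomorphic_form_iff_has_ext by blast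

section \<open>The generic locus of the dual plane and the curvature there\<close>

locale convex_chart = normal_chart +
  assumes convex: "convex_foliation \<Omega>"
begin

sublocale convex_pencil a b n by (rule convex_pencil[OF convex])

text \<open>The values of P for which some root t equals P, so that 1 / (P - t) is infinite, or for
  which two roots collide.\<close>

definition critical_values where
  "critical_values = {\<zeta>. poly fixp \<zeta> = 0} \<union> (\<lambda>c. - (poly a c / poly b c)) ` {c. poly wr c = 0}"

definition generic where
  "generic = {z. l 2 z \<noteq> 0 \<and> l 3 z \<noteq> 0 \<and> (\<forall>\<zeta>\<in>critical_values. l 1 z + \<zeta> * l 2 z \<noteq> 0)}"

lemma open_generic: "open generic" and closure_generic: "closure generic = UNIV"
proof -
  have fin: "finite critical_values"
    unfolding critical_values_def
    by (intro finite_UnI finite_imageI poly_roots_finite wr_nz) (simp add: fixp_def fixp0)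
  have cd: "cdot (line_vec z) (M *v v3 x y t) = l 1 z * x + l 2 z * y + l 3 z * t" for z x y t
    unfolding cdot_v_mult[symmetric] unfolding cdot_eq line_vec_v_mult by simp
  define I where "I = {v3 0 1 0, v3 0 0 1} \<union> (\<lambda>\<zeta>. v3 1 \<zeta> 0) ` critical_values"
  have "generic = (\<Inter>k\<in>I. {z. cdot (line_vec z) (M *v k) \<noteq> 0})"
    by (auto simp: generic_def I_def cd mult.commute)
  moreover have "open (\<Inter>k\<in>I. {z. cdot (line_vec z) (M *v k) \<noteq> 0}) \<and>
      closure (\<Inter>k\<in>I. {z. cdot (line_vec z) (M *v k) \<noteq> 0}) = UNIV"
    by (intro open_dense_INT open_dense_affine)
      (use fin in \<open>auto simp: I_def invertible_mult_eq_0[OF inv] v3_eq_0_iff\<close>)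
  ultimately show "open generic" "closure generic = UNIV" by simp_all
qed

lemma generic_Pc: "z \<in> generic \<Longrightarrow> Pc z \<notin> critical_values"
  by (auto simp: generic_def Pc_def field_simps)

lemma generic_root:
  assumes z: "z \<in> generic" and t: "poly (T (Pc z)) t = 0"
  shows "Pc z \<noteq> t" "poly (pderiv (T (Pc z))) t \<noteq> 0" "poly wr t \<noteq> 0"
proof -
  note r = at_root[OF t] and b = b_nz_at_root[OF t]
  show "Pc z \<noteq> t"
  proof
    assume "Pc z = t"
    then have "poly fixp t = 0" using r(5) by simp
    then show False using generic_Pc[OF z] \<open>Pc z = t\<close> by (auto simp: critical_values_def)
  qed
  show "poly wr t \<noteq> 0"
  proof
    assume "poly wr t = 0"
    moreover have "Pc z = - (poly a t / poly b t)" using r(1) b by simp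
    ultimately show False using generic_Pc[OF z] by (auto simp: critical_values_def)
  qed
  then show "poly (pderiv (T (Pc z))) t \<noteq> 0" using r(2) by simp
qed

lemma card_R_generic: "z \<in> generic \<Longrightarrow> card (R (Pc z)) = n"
  unfolding R_def using card_roots_simple[of "T (Pc z)"] generic_root(2) by (simp add: degree_T)

lemma generic_l: "z \<in> generic \<Longrightarrow> l 2 z \<noteq> 0" "z \<in> generic \<Longrightarrow> l 3 z \<noteq> 0"
  by (simp_all add: generic_def)

lemma Qc_nz: "z \<in> generic \<Longrightarrow> Qc z \<noteq> 0"
  by (simp add: generic_def Qc_def)

definition \<theta> where "\<theta> z = scl (1 / Qc z) (\<psi> z)"

lemma ext_forms:
  assumes z: "z \<in> generic"
  shows "has_ext \<phi> 0 z" "has_ext \<psi> 0 z" "has_ext \<theta> 0 z"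
proof -
  have dl0: "has_ext (\<lambda>z. dl j) 0 z" for j
    by (rule has_extI[of _ 0 _ 0]) (simp_all add: has_diff_const)
  have inv: "\<exists>A. has_diff (\<lambda>z. 1 / l 2 z) A z"
    by (rule exI) (rule has_diff_divide has_diff_const has_diff_l generic_l z)+
  have quot: "\<exists>A. has_diff (\<lambda>z. l j z / (l 2 z)\<^sup>2) A z" for j
    unfolding power2_eq_square
    by (rule exI) (rule has_diff_divide has_diff_mult has_diff_l | simp add: generic_l z)+
  obtain A B1 B3 where A: "has_diff (\<lambda>z. 1 / l 2 z) A z"
    and B: "has_diff (\<lambda>z. l 1 z / (l 2 z)\<^sup>2) B1 z" "has_diff (\<lambda>z. l 3 z / (l 2 z)\<^sup>2) B3 z"
    using inv quot[of 1] quot[of 3] by blast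
  have \<phi>_eq: "\<phi> = (\<lambda>z. scl (l 1 z / (l 2 z)\<^sup>2) (dl 2) - scl (1 / l 2 z) (dl 1))" by (simp add: \<phi>_def fun_eq_iff)
  have \<psi>_eq: "\<psi> = (\<lambda>z. scl (1 / l 2 z) (dl 3) - scl (l 3 z / (l 2 z)\<^sup>2) (dl 2))" by (simp add: \<psi>_def fun_eq_iff)
  obtain e1 where e1: "has_ext \<phi> e1 z"
    unfolding \<phi>_eq using has_ext_diff[OF has_ext_scl[OF B(1) dl0] has_ext_scl[OF A dl0]] by blast
  obtain e2 where e2: "has_ext \<psi> e2 z"
    unfolding \<psi>_eq using has_ext_diff[OF has_ext_scl[OF A dl0] has_ext_scl[OF B(2) dl0]] by blast
  show \<phi>: "has_ext \<phi> 0 z"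
    using e1 mixed_partials_commute[OF open_generic z has_diff_Pc e1] generic_l(1) by simp
  show \<psi>: "has_ext \<psi> 0 z"
    using e2 mixed_partials_commute[OF open_generic z has_diff_Qc e2] generic_l(1) by simp
  have "has_diff (\<lambda>z. 1 / Qc z) (scl (1 / Qc z) 0 - scl (1 / (Qc z)\<^sup>2) (\<psi> z)) z"
    by (intro has_diff_divide has_diff_const has_diff_Qc generic_l z Qc_nz)
  from has_ext_scl[OF this \<psi>] show "has_ext \<theta> 0 z"
    unfolding \<theta>_def[abs_def] by (rule has_ext_eq) (simp add: wd_simps)
qed

definition \<Lambda> where "\<Lambda> z = (if \<epsilon> = 1 then \<psi> z else \<phi> z)"

lemma \<Lambda>_nz: "z \<in> generic \<Longrightarrow> \<Lambda> z \<noteq> 0"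
  using wd_\<phi>_\<psi>[OF generic_l(1), of z] by (auto simp: \<Lambda>_def wd_simps)

lemma ext_\<Lambda>: "z \<in> generic \<Longrightarrow> has_ext \<Lambda> 0 z"
proof -
  assume z: "z \<in> generic"
  have "\<Lambda> = \<psi> \<or> \<Lambda> = \<phi>" unfolding \<Lambda>_def[abs_def] by (cases "\<epsilon> = 1") simp_all
  then show ?thesis using ext_forms[OF z] by auto
qed

lemma web_zero:
  assumes "z \<in> generic" "v \<noteq> 0"
  shows "legendre (Suc n) u \<Omega> z v = 0 \<longleftrightarrow> dotp (\<Lambda> z) v = 0 \<or>
    (\<exists>t. poly (T (Pc z)) t = 0 \<and> (Pc z - t) * dotp (\<psi> z) v = Qc z * dotp (\<phi> z) v)"
  unfolding \<Lambda>_def T_def using legendre_zero generic_l assms by simp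

lemma open_Collect_nz:
  assumes "open V" "\<And>z. z \<in> V \<Longrightarrow> isCont f z"
  shows "open {z\<in>V. f z \<noteq> (0::complex)}"
proof -
  have "continuous_on V f" using assms(2) by (simp add: continuous_at_imp_continuous_on)
  then have "open (f -` (- {0}) \<inter> V)"
    using assms(1) by (subst (asm) continuous_on_open_vimage) auto
  moreover have "f -` (- {0}) \<inter> V = {z\<in>V. f z \<noteq> 0}" by auto
  ultimately show ?thesis by simp
qed

lemma isCont_wd:
  assumes "has_ext \<omega> e z" "has_ext \<omega>' e' z"
  shows "isCont (\<lambda>z. wd (\<omega> z) (\<omega>' z)) z"
  using has_diff_wd[OF assms] has_diff_isCont by blast

text \<open>The superposition is arbitrary, so its members have to be matched with the known
  directions. One of them is parallel to \<open>\<Lambda>\<close>; each of the others yields a root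
  \<open>tt i\<close> as a quotient of wedge products, which also shows that the root is
  differentiable.\<close>

lemma curvature_generic:
  assumes sup: "superposition (Suc n) (legendre (Suc n) u \<Omega>) U \<omega>"
    and \<eta>: "\<And>r s t. r < s \<Longrightarrow> s < t \<Longrightarrow> t < Suc n \<Longrightarrow> eta_form U (\<omega> r) (\<omega> s) (\<omega> t) (\<eta> r s t)"
    and z0: "z0 \<in> U \<inter> generic"
  shows "curvature (Suc n) \<eta> z0 = 0"
proof -
  have U: "open U" and hol: "\<And>i. i < Suc n \<Longrightarrow> holomorphic_form (\<omega> i) U"
    and \<omega>0: "\<And>i z. z \<in> U \<Longrightarrow> i < Suc n \<Longrightarrow> \<omega> i z \<noteq> 0"
    and trans: "\<And>i j z. z \<in> U \<Longrightarrow> i < Suc n \<Longrightarrow> j < Suc n \<Longrightarrow> i \<noteq> j \<Longrightarrow> wd (\<omega> i z) (\<omega> j z) \<noteq> 0"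
    using sup by (simp_all add: superposition_def wedge_eq_wd)
  have J: "wd (\<phi> z) (\<psi> z) \<noteq> 0" if "z \<in> generic" for z using wd_\<phi>_\<psi> generic_l(1) that by blast
  define V0 where "V0 = U \<inter> generic"
  have V0: "open V0" using U open_generic by (simp add: V0_def open_Int)
  have \<omega>_ext: "\<exists>e. has_ext (\<omega> i) e z" if "i < Suc n" "z \<in> V0" for i z
    using hol[OF that(1)] that(2) by (auto simp: holomorphic_form_iff_has_ext V0_def)
  have ex\<Lambda>: "\<exists>i<Suc n. wd (\<omega> i z) (\<Lambda> z) = 0" if z: "z \<in> V0" for z
  proof -
    have "legendre (Suc n) u \<Omega> z (kernel_vec (\<Lambda> z)) = 0"
      using z by (subst web_zero) (auto simp: V0_def kernel_vec_eq_0_iff \<Lambda>_nz dotp_kernel_vec wd_simps)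
    then show ?thesis
      using superposition_dotp[OF sup, of z "kernel_vec (\<Lambda> z)"] z by (auto simp: V0_def dotp_kernel_vec)
  qed
  obtain i0 where i0: "i0 < Suc n" "wd (\<omega> i0 z0) (\<Lambda> z0) = 0" using ex\<Lambda>[of z0] z0 unfolding V0_def by blast
  \<comment> \<open>Being transverse to \<open>\<Lambda>\<close> is an open condition; near
    \<open>z0\<close> it confines the member parallel to \<open>\<Lambda>\<close> to the fixed index
    \<open>i0\<close>.\<close>
  define V where "V = (\<Inter>i\<in>{..<Suc n} - {i0}. {z \<in> V0. wd (\<omega> i z) (\<Lambda> z) \<noteq> 0}) \<inter> V0"
  have V: "open V"
    unfolding V_def
  proof (intro open_Int open_INT ballI V0)
    fix i assume i: "i \<in> {..<Suc n} - {i0}"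
    show "open {z \<in> V0. wd (\<omega> i z) (\<Lambda> z) \<noteq> 0}"
    proof (rule open_Collect_nz[OF V0])
      fix z assume z: "z \<in> V0"
      then obtain e where "has_ext (\<omega> i) e z" using \<omega>_ext[of i z] i by blast
      moreover have "has_ext \<Lambda> 0 z" using ext_\<Lambda> z by (simp add: V0_def)
      ultimately show "isCont (\<lambda>z. wd (\<omega> i z) (\<Lambda> z)) z" by (rule isCont_wd)
    qed
  qed simp
  have VV0: "z \<in> V0" and VU: "z \<in> U" and Vg: "z \<in> generic" if "z \<in> V" for z using that by (auto simp: V_def V0_def)
  have z0V: "z0 \<in> V"
  proof -
    have "wd (\<omega> i z0) (\<Lambda> z0) \<noteq> 0" if i: "i < Suc n" "i \<noteq> i0" for i
    proof
      assume "wd (\<omega> i z0) (\<Lambda> z0) = 0"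
      with i0(2) have "wd (\<Lambda> z0) (\<omega> i z0) = 0" "wd (\<Lambda> z0) (\<omega> i0 z0) = 0"
        by (simp_all add: wd_swap[of "\<Lambda> z0"])
      then have "wd (\<omega> i z0) (\<omega> i0 z0) = 0"
        by (rule wd_parallel) (use \<Lambda>_nz[of z0] z0 in simp)
      then show False using trans[of z0 i i0] i i0 z0 by simp
    qed
    then show ?thesis using z0 by (auto simp: V_def V0_def)
  qed
  have wd\<Lambda>: "wd (\<omega> i z) (\<Lambda> z) \<noteq> 0" if "i < Suc n" "i \<noteq> i0" "z \<in> V" for i z
    using that by (auto simp: V_def)
  have wd\<Lambda>0: "wd (\<omega> i0 z) (\<Lambda> z) = 0" if z: "z \<in> V" for z
    using ex\<Lambda>[OF VV0[OF z]] wd\<Lambda>[OF _ _ z] by metis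
  define tt where "tt i z = Pc z - Qc z * wd (\<phi> z) (\<omega> i z) / wd (\<psi> z) (\<omega> i z)" for i z
  have key: "wd (\<psi> z) (\<omega> i z) \<noteq> 0 \<and> poly (T (Pc z)) (tt i z) = 0"
    if i: "i < Suc n" "i \<noteq> i0" and z: "z \<in> V" for i z
  proof -
    have "legendre (Suc n) u \<Omega> z (kernel_vec (\<omega> i z)) = 0"
      using superposition_dotp[OF sup VU[OF z]] i(1) by (auto simp: dotp_kernel_vec wd_simps)
    moreover have "dotp (\<Lambda> z) (kernel_vec (\<omega> i z)) \<noteq> 0"
      using wd\<Lambda>[OF i z] by (simp add: dotp_kernel_vec wd_swap[of "\<Lambda> z"])
    ultimately obtain t where t: "poly (T (Pc z)) t = 0" "(Pc z - t) * wd (\<psi> z) (\<omega> i z) = Qc z * wd (\<phi> z) (\<omega> i z)"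
      using web_zero[OF Vg[OF z], of "kernel_vec (\<omega> i z)"] \<omega>0[OF VU[OF z] i(1)]
      by (auto simp: kernel_vec_eq_0_iff dotp_kernel_vec)
    have nz: "wd (\<psi> z) (\<omega> i z) \<noteq> 0"
    proof
      assume 0: "wd (\<psi> z) (\<omega> i z) = 0"
      then have "wd (\<phi> z) (\<omega> i z) = 0" using t(2) Qc_nz[OF Vg[OF z]] by simp
      then have "\<omega> i z = 0"
        by (intro wd_basis_eq[OF J[OF Vg[OF z]]]) (use 0 in \<open>simp_all add: wd_swap[of "\<omega> i z"] wd_simps\<close>)
      then show False using \<omega>0[OF VU[OF z] i(1)] by simp
    qed
    then have "t = tt i z" unfolding tt_def using t(2) by (simp add: field_simps)
    then show ?thesis using t(1) nz by simp
  qed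
  have tt_eq: "(Pc z - tt i z) * wd (\<psi> z) (\<omega> i z) = Qc z * wd (\<phi> z) (\<omega> i z)"
    if "i < Suc n" "i \<noteq> i0" "z \<in> V" for i z
    using key[OF that] by (simp add: tt_def)
  have neq: "Pc z \<noteq> tt i z" if "i < Suc n" "i \<noteq> i0" "z \<in> V" for i z
    using generic_root(1)[OF Vg[OF that(3)]] key[OF that] by blast
  \<comment> \<open>\<open>Y i\<close> is the form whose coefficient in \<open>\<omega> i\<close> is
    the factor \<open>f i\<close>; the wedge product with the complementary \<open>X i\<close>
    extracts it.\<close>
  define X where "X i = (if i = i0 \<and> \<epsilon> \<noteq> 1 then \<theta> else \<phi>)" for i
  define Y where "Y i = (if i = i0 \<and> \<epsilon> \<noteq> 1 then \<phi> else \<theta>)" for i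
  define f where "f i z = wd (\<omega> i z) (X i z) / wd (Y i z) (X i z)" for i z
  have J\<theta>: "wd (\<phi> z) (\<theta> z) \<noteq> 0" if "z \<in> V" for z
    using J[OF Vg[OF that]] Qc_nz[OF Vg[OF that]] by (simp add: \<theta>_def wd_simps)
  then have YX: "wd (Y i z) (X i z) \<noteq> 0" if "z \<in> V" for i z
    using that wd_swap[of "\<theta> z" "\<phi> z"] by (simp add: X_def Y_def)
  have XY_ext: "has_ext (X i) 0 z" "has_ext (Y i) 0 z" if "z \<in> V" for i z
    using ext_forms[OF Vg[OF that]] by (simp_all add: X_def Y_def)
  have f_diff: "\<exists>A. has_diff (f i) A z" if i: "i < Suc n" and z: "z \<in> V" for i z
  proof -
    obtain e where "has_ext (\<omega> i) e z" using \<omega>_ext[OF i VV0[OF z]] by blast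
    then obtain A B where "has_diff (\<lambda>z. wd (\<omega> i z) (X i z)) A z" "has_diff (\<lambda>z. wd (Y i z) (X i z)) B z"
      using has_diff_wd XY_ext[OF z] by metis
    then show ?thesis unfolding f_def[abs_def] using has_diff_divide YX[OF z] by blast
  qed
  have tt_diff: "\<exists>A. has_diff (tt i) A z" if i: "i < Suc n" "i \<noteq> i0" and z: "z \<in> V" for i z
  proof -
    obtain e where "has_ext (\<omega> i) e z" using \<omega>_ext[OF i(1) VV0[OF z]] by blast
    then obtain A B where "has_diff (\<lambda>z. wd (\<phi> z) (\<omega> i z)) A z" "has_diff (\<lambda>z. wd (\<psi> z) (\<omega> i z)) B z"
      using has_diff_wd ext_forms[OF Vg[OF z]] by metis
    then show ?thesis
      unfolding tt_def[abs_def] using key[OF i z, THEN conjunct1] generic_l(1)[OF Vg[OF z]]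
      by - (rule exI, (rule has_diff_diff has_diff_divide has_diff_mult has_diff_Pc has_diff_Qc | assumption)+)
  qed
  have om: "\<omega> i z = scl (f i z) (\<theta> z - scl (1 / (Pc z - tt i z)) (\<phi> z))"
    if i: "i < Suc n" "i \<noteq> i0" and z: "z \<in> V" for i z
  proof (rule wd_basis_eq[OF J\<theta>[OF z]])
    have q: "Qc z \<noteq> 0" "Pc z - tt i z \<noteq> 0" using Qc_nz[OF Vg[OF z]] neq[OF i z] by simp_all
    have fi: "f i z * wd (\<theta> z) (\<phi> z) = wd (\<omega> i z) (\<phi> z)"
      using J\<theta>[OF z] i wd_swap[of "\<theta> z" "\<phi> z"] by (simp add: f_def X_def Y_def)
    show "wd (\<omega> i z) (\<phi> z) = wd (scl (f i z) (\<theta> z - scl (1 / (Pc z - tt i z)) (\<phi> z))) (\<phi> z)"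
      by (simp add: wd_simps fi)
    have "wd (\<omega> i z) (\<theta> z) = wd (\<omega> i z) (\<psi> z) / Qc z" by (simp add: \<theta>_def wd_simps)
    also have "\<dots> = wd (\<omega> i z) (\<phi> z) / (Pc z - tt i z)"
      using tt_eq[OF i z] q by (simp add: wd_swap[of "\<omega> i z"] field_simps)
    also have "\<dots> = f i z * (- (1 / (Pc z - tt i z) * wd (\<phi> z) (\<theta> z)))"
      by (simp add: fi[symmetric] wd_swap[of "\<theta> z" "\<phi> z"])
    finally show "wd (\<omega> i z) (\<theta> z) = wd (scl (f i z) (\<theta> z - scl (1 / (Pc z - tt i z)) (\<phi> z))) (\<theta> z)"
      by (simp add: wd_simps)
  qed
  have om0: "\<omega> i0 z = scl (f i0 z) (Y i0 z)" if z: "z \<in> V" for z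
  proof (rule wd_basis_eq[OF YX[OF z]])
    have "wd (\<omega> i0 z) (Y i0 z) = 0"
      using wd\<Lambda>0[OF z] by (auto simp: Y_def \<Lambda>_def \<theta>_def wd_simps)
    then show "wd (\<omega> i0 z) (Y i0 z) = wd (scl (f i0 z) (Y i0 z)) (Y i0 z)" by (simp add: wd_simps)
    show "wd (\<omega> i0 z) (X i0 z) = wd (scl (f i0 z) (Y i0 z)) (X i0 z)"
      using YX[OF z] by (simp add: wd_simps f_def)
  qed
  have f0: "f i z \<noteq> 0" if i: "i < Suc n" and z: "z \<in> V" for i z
  proof
    assume "f i z = 0"
    then have "\<omega> i z = 0" using om[of i z] om0[of z] i z by (cases "i = i0") (simp_all add: scl_simps)
    then show False using \<omega>0[OF VU[OF z] i] by simp
  qed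
  show ?thesis
  proof (rule curvature_eq_0[OF V, of \<phi> \<theta> Pc i0 \<epsilon> tt \<omega> f \<eta>])
    show "has_ext \<phi> 0 z" "has_ext \<theta> 0 z" "has_diff Pc (\<phi> z) z" if "z \<in> V" for z
      using ext_forms has_diff_Pc generic_l(1) Vg[OF that] by blast+
    show "tt i z \<noteq> tt j z" if ij: "i < Suc n" "i \<noteq> i0" "j < Suc n" "j \<noteq> i0" "i \<noteq> j" and z: "z \<in> V" for i j z
    proof
      assume eq: "tt i z = tt j z"
      define B where "B = scl (Pc z - tt i z) (\<psi> z) - scl (Qc z) (\<phi> z)"
      have "wd B (\<omega> i z) = 0" "wd B (\<omega> j z) = 0"
        using tt_eq[OF ij(1,2) z] tt_eq[OF ij(3,4) z] by (simp_all add: B_def wd_simps eq)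
      moreover have "wd B (\<psi> z) \<noteq> 0" using J[OF Vg[OF z]] Qc_nz[OF Vg[OF z]] by (simp add: B_def wd_simps)
      then have "B \<noteq> 0" by (auto simp: wd_simps)
      ultimately have "wd (\<omega> i z) (\<omega> j z) = 0" by (rule wd_parallel)
      then show False using trans[OF VU[OF z] ij(1,3,5)] by simp
    qed
    show "\<omega> i0 z = scl (f i0 z) (if \<epsilon> = 1 then \<theta> z else \<phi> z)" if "z \<in> V" for z
      using om0[OF that] by (simp add: Y_def)
    show "poly (T (Pc z)) (tt i z) = 0" if "i < Suc n" "i \<noteq> i0" "z \<in> V" for i z using key[OF that] by blast
    show "eta_form V (\<omega> r) (\<omega> s) (\<omega> t) (\<eta> r s t)" if "r < s" "s < t" "t < Suc n" for r s t
      using eta_form_subset[OF \<eta>[OF that]] VU by blast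
  qed (assumption | rule J\<theta> i0(1) eps neq tt_diff om f_diff f0 z0V)+
qed

lemma flat: "flat_web (Suc n) (legendre (Suc n) u \<Omega>)"
  unfolding flat_web_def
proof (intro allI impI ballI)
  fix U \<omega> \<eta> z
  assume sup: "superposition (Suc n) (legendre (Suc n) u \<Omega>) U \<omega>"
    and \<eta>: "\<forall>r s t. r < s \<and> s < t \<and> t < Suc n \<longrightarrow> eta_form U (\<omega> r) (\<omega> s) (\<omega> t) (\<eta> r s t)"
    and z: "z \<in> U"
  let ?N = "\<lambda>z. \<Sum>(r, s, t) | r < s \<and> s < t \<and> t < Suc n. \<eta> r s t z"
  have "\<exists>e. has_ext ?N e w" if w: "w \<in> U" for w
  proof -
    have "\<forall>i\<in>{(r, s, t). r < s \<and> s < t \<and> t < Suc n}. \<exists>e. has_ext (\<lambda>z. case i of (r, s, t) \<Rightarrow> \<eta> r s t z) e w"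
      using \<eta> w by (auto simp: eta_form_def holomorphic_form_iff_has_ext)
    from bchoice[OF this] obtain e where "\<forall>i\<in>{(r, s, t). r < s \<and> s < t \<and> t < Suc n}.
        has_ext (\<lambda>z. case i of (r, s, t) \<Rightarrow> \<eta> r s t z) (e i) w" ..
    then have "has_ext ?N (sum e {(r, s, t). r < s \<and> s < t \<and> t < Suc n}) w"
      by (intro has_ext_sum) (erule (1) bspec)
    then show ?thesis ..
  qed
  then have hol: "holomorphic_form ?N U" unfolding holomorphic_form_iff_has_ext by blast
  have zero: "ext_deriv ?N w = 0" if "w \<in> U \<inter> generic" for w
    using curvature_generic[OF sup _ that, of \<eta>] \<eta> unfolding curvature_def by blast
  have "open U" using sup unfolding superposition_def by blast
  from ext_deriv_eq_0_dense[OF this hol closure_generic zero z]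
  show "curvature (Suc n) \<eta> z = 0" unfolding curvature_def .
qed

end

section \<open>Genericity of the superposition\<close>

text \<open>The map - a / b is locally biholomorphic at a non-critical point, and its local inverse
  is the branch of the root.\<close>

lemma local_inverse_branch:
  fixes a b :: "complex poly"
  assumes b: "poly b t \<noteq> 0" and wr: "poly (pderiv a * b - a * pderiv b) t \<noteq> 0"
    and P: "poly a t + P * poly b t = 0"
  shows "\<exists>N g. open N \<and> P \<in> N \<and> g holomorphic_on N \<and> g P = t \<and>
    (\<forall>s\<in>N. poly a (g s) + s * poly b (g s) = 0)"
proof -
  define G where "G t = - (poly a t / poly b t)" for t
  define S where "S = {t. poly b t \<noteq> 0}"
  have S: "open S" "t \<in> S"
    using b unfolding S_def by (auto intro!: open_Collect_neq continuous_intros)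
  have G': "(G has_field_derivative - ((poly (pderiv a) t * poly b t - poly a t * poly (pderiv b) t) / (poly b t * poly b t))) (at t)"
    if "t \<in> S" for t
    using that unfolding G_def S_def by (auto intro!: derivative_eq_intros)
  have hol: "G holomorphic_on S"
    using G' by (meson holomorphic_onI field_differentiable_def field_differentiable_at_within)
  have "deriv G t \<noteq> 0"
    using DERIV_imp_deriv[OF G'[OF S(2)]] wr b by simp
  then obtain r where r: "r > 0" "ball t r \<subseteq> S" "inj_on G (ball t r)"
    using has_complex_derivative_locally_injective[OF hol S(2,1)] by blast
  have hol': "G holomorphic_on ball t r" using hol r(2) holomorphic_on_subset by blast
  obtain g where g: "g holomorphic_on (G ` ball t r)"
    and "\<And>s. s \<in> ball t r \<Longrightarrow> deriv G s * deriv g (G s) = 1"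
    and gG: "\<And>s. s \<in> ball t r \<Longrightarrow> g (G s) = s"
    by (rule holomorphic_has_inverse[OF hol' open_ball r(3)]) (rule that; simp)
  have Gs: "poly a s + G s * poly b s = 0" if "s \<in> ball t r" for s
    using that r(2) by (auto simp: G_def S_def)
  have "poly a t = - P * poly b t" using P by (simp add: eq_neg_iff_add_eq_0)
  then have "G t = P" using b by (simp add: G_def)
  then have "P \<in> G ` ball t r" "g P = t" using r(1) gG[of t] by auto
  moreover have "open (G ` ball t r)" by (rule open_mapping_thm3[OF hol' open_ball r(3)])
  moreover have "poly a (g s) + s * poly b (g s) = 0" if "s \<in> G ` ball t r" for s
    using that gG Gs by auto
  ultimately show ?thesis using g by blast
qed

context convex_chart
begin

text \<open>At a generic point there are n simple roots. Their branches remain distinct nearby, and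
  as a + P b has degree n they exhaust the fibre there.\<close>

lemma superposition_generic:
  assumes z0: "z0 \<in> generic"
  shows "\<exists>U \<omega>. z0 \<in> U \<and> superposition (Suc n) (legendre (Suc n) u \<Omega>) U \<omega>"
proof -
  have finR: "finite (R P)" for P unfolding R_def using T_nz by (rule poly_roots_finite)
  obtain h where h: "bij_betw h {..<n} (R (Pc z0))"
    using ex_bij_betw_nat_finite[OF finR] card_R_generic[OF z0] by (metis atLeast0LessThan)
  have "\<exists>N g. open N \<and> Pc z0 \<in> N \<and> g holomorphic_on N \<and> g (Pc z0) = h i \<and>
      (\<forall>s\<in>N. poly a (g s) + s * poly b (g s) = 0)" if "i < n" for i
  proof -
    have t: "poly (T (Pc z0)) (h i) = 0" using h that by (auto simp: bij_betw_def R_def)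
    show ?thesis
      using b_nz_at_root[OF t] generic_root(3)[OF z0 t] t
      by (intro local_inverse_branch) (simp_all add: wr_def T_def)
  qed
  then obtain N g where N: "\<And>i. i < n \<Longrightarrow> open (N i)" "\<And>i. i < n \<Longrightarrow> Pc z0 \<in> N i"
    and g: "\<And>i. i < n \<Longrightarrow> g i holomorphic_on N i" "\<And>i. i < n \<Longrightarrow> g i (Pc z0) = h i"
    and gr: "\<And>i s. i < n \<Longrightarrow> s \<in> N i \<Longrightarrow> poly a (g i s) + s * poly b (g i s) = 0"
    by metis
  have Pc_diff: "has_diff Pc (\<phi> z) z" if "z \<in> generic" for z using has_diff_Pc generic_l(1) that by blast
  define V1 where "V1 = (\<Inter>i\<in>{..<n}. {z\<in>generic. Pc z \<in> N i}) \<inter> generic"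
  have V1: "open V1"
    unfolding V1_def
  proof (intro open_Int open_INT ballI open_generic)
    fix i assume "i \<in> {..<n}"
    moreover have "continuous_on generic Pc"
      using Pc_diff has_diff_isCont continuous_at_imp_continuous_on by blast
    ultimately have "open (Pc -` N i \<inter> generic)"
      using continuous_on_open_vimage[OF open_generic, of Pc] N(1) by blast
    moreover have "Pc -` N i \<inter> generic = {z\<in>generic. Pc z \<in> N i}" by auto
    ultimately show "open {z\<in>generic. Pc z \<in> N i}" by simp
  qed simp
  have V1g: "z \<in> generic" and V1N: "\<And>i. i < n \<Longrightarrow> Pc z \<in> N i" if "z \<in> V1" for z using that by (auto simp: V1_def)
  define s where "s i z = g i (Pc z)" for i z
  have s_diff: "\<exists>A. has_diff (s i) A z" if "i < n" "z \<in> V1" for i z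
  proof -
    have "(g i has_field_derivative deriv (g i) (Pc z)) (at (Pc z))"
      using g(1) N(1) V1N that holomorphic_derivI by blast
    from has_diff_comp[OF Pc_diff[OF V1g[OF that(2)]] this] show ?thesis unfolding s_def[abs_def] by blast
  qed
  define V where "V = (\<Inter>ij\<in>{(i, j). i < n \<and> j < n \<and> i \<noteq> j}. {z\<in>V1. s (fst ij) z - s (snd ij) z \<noteq> 0}) \<inter> V1"
  have V: "open V"
    unfolding V_def
  proof (intro open_Int open_INT ballI V1)
    show "finite {(i, j). i < n \<and> j < n \<and> i \<noteq> j}"
      by (rule finite_subset[of _ "{..<n} \<times> {..<n}"]) auto
    fix ij assume "ij \<in> {(i, j). i < n \<and> j < n \<and> i \<noteq> j}"
    then have ij: "fst ij < n" "snd ij < n" by auto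
    show "open {z\<in>V1. s (fst ij) z - s (snd ij) z \<noteq> 0}"
    proof (rule open_Collect_nz[OF V1])
      fix z assume z: "z \<in> V1"
      show "isCont (\<lambda>z. s (fst ij) z - s (snd ij) z) z"
        using s_diff[OF ij(1) z] s_diff[OF ij(2) z] by (blast intro: continuous_diff has_diff_isCont)
    qed
  qed
  have z0V: "z0 \<in> V"
  proof -
    have "h i \<noteq> h j" if "i < n" "j < n" "i \<noteq> j" for i j using h that by (auto simp: bij_betw_def inj_on_def)
    then show ?thesis using z0 N(2) g(2) by (auto simp: V_def V1_def s_def)
  qed
  have Vg: "z \<in> generic" and VV1: "z \<in> V1" if "z \<in> V" for z using that V1g by (auto simp: V_def)
  have s_inj: "s i z \<noteq> s j z" if "i < n" "j < n" "i \<noteq> j" "z \<in> V" for i j z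
    using that by (auto simp: V_def)
  have s_root: "poly (T (Pc z)) (s i z) = 0" if "i < n" "z \<in> V" for i z
    using gr[OF that(1) V1N[OF VV1[OF that(2)] that(1)]] by (simp add: T_def s_def)
  have roots: "poly (T (Pc z)) t = 0 \<longleftrightarrow> (\<exists>i<n. t = s i z)" if z: "z \<in> V" for t z
  proof -
    have sub: "(\<lambda>i. s i z) ` {..<n} \<subseteq> R (Pc z)" using s_root[OF _ z] by (auto simp: R_def)
    have "inj_on (\<lambda>i. s i z) {..<n}" using s_inj[OF _ _ _ z] by (auto simp: inj_on_def)
    then have "card ((\<lambda>i. s i z) ` {..<n}) = card (R (Pc z))"
      by (simp add: card_image card_R_generic[OF Vg[OF z]])
    then have "(\<lambda>i. s i z) ` {..<n} = R (Pc z)" using sub finR by (intro card_subset_eq)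
    then show ?thesis by (auto simp: R_def)
  qed
  \<comment> \<open>Apart from \<open>\<Lambda>\<close>, these are the forms dQ / Q - dP / (P - t)
    multiplied by Q (P - t).\<close>
  define \<omega> where "\<omega> i = (if i = n then \<Lambda> else (\<lambda>z. scl (Pc z - s i z) (\<psi> z) - scl (Qc z) (\<phi> z)))" for i
  have \<omega>n: "\<omega> n = \<Lambda>" and \<omega>i: "\<omega> i z = scl (Pc z - s i z) (\<psi> z) - scl (Qc z) (\<phi> z)" if "i < n" for i z
    using that by (auto simp: \<omega>_def)
  have J: "wd (\<phi> z) (\<psi> z) \<noteq> 0" "wd (\<psi> z) (\<phi> z) \<noteq> 0" and Q: "Qc z \<noteq> 0" if "z \<in> V" for z
    using wd_\<phi>_\<psi>[OF generic_l(1)[OF Vg[OF that]]] Qc_nz[OF Vg[OF that]] wd_swap[of "\<phi> z" "\<psi> z"] by auto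
  have wd_n: "wd (\<omega> i z) (\<omega> n z) \<noteq> 0" if "i < n" "z \<in> V" for i z
    using J[OF that(2)] Q[OF that(2)] generic_root(1)[OF Vg[OF that(2)] s_root[OF that]]
    by (auto simp: \<omega>i[OF that(1)] \<omega>_def[of n] \<Lambda>_def wd_simps)
  have wd_ij: "wd (\<omega> i z) (\<omega> j z) \<noteq> 0" if "i < n" "j < n" "i \<noteq> j" "z \<in> V" for i j z
  proof -
    have "wd (\<omega> i z) (\<omega> j z) = Qc z * (s j z - s i z) * wd (\<phi> z) (\<psi> z)"
      unfolding \<omega>i[OF that(1)] \<omega>i[OF that(2)] wd_simps wd_swap[of "\<psi> z" "\<phi> z"] by (simp add: algebra_simps)
    then show ?thesis using J(1)[OF that(4)] Q[OF that(4)] s_inj[OF that] by simp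
  qed
  have wd_all: "wd (\<omega> i z) (\<omega> j z) \<noteq> 0" if ij: "i < Suc n" "j < Suc n" "i \<noteq> j" and z: "z \<in> V" for i j z
  proof -
    consider "i < n" "j < n" | "i < n" "j = n" | "i = n" "j < n" using ij by linarith
    then show ?thesis
      using wd_ij[of i j z] wd_n[of i z] wd_n[of j z] ij z wd_swap[of "\<omega> n z" "\<omega> j z"] by cases auto
  qed
  have "superposition (Suc n) (legendre (Suc n) u \<Omega>) V \<omega>"
    unfolding superposition_def wedge_eq_wd
  proof (intro conjI allI impI ballI V wd_all)
    fix i assume i: "i < Suc n"
    show "holomorphic_form (\<omega> i) V"
      unfolding holomorphic_form_iff_has_ext
    proof
      fix z assume z: "z \<in> V"
      show "\<exists>e. has_ext (\<omega> i) e z"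
      proof (cases "i = n")
        case True
        then show ?thesis using ext_\<Lambda>[OF Vg[OF z]] by (auto simp: \<omega>_def)
      next
        case False
        then have i': "i < n" using i by simp
        obtain A where A: "has_diff (s i) A z" using s_diff[OF i' VV1[OF z]] by blast
        have "has_ext (\<lambda>z. scl (Pc z - s i z) (\<psi> z) - scl (Qc z) (\<phi> z))
            (wd (\<phi> z - A) (\<psi> z) + (Pc z - s i z) * 0 - (wd (\<psi> z) (\<phi> z) + Qc z * 0)) z"
          by (intro has_ext_diff has_ext_scl has_diff_diff Pc_diff Vg z A ext_forms has_diff_Qc generic_l)
        then show ?thesis using False by (auto simp: \<omega>_def)
      qed
    qed
  next
    fix z i assume z: "z \<in> V" and i: "i < Suc n"
    show "\<omega> i z \<noteq> 0"
    proof (cases "i = n")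
      case True
      then show ?thesis using \<Lambda>_nz[OF Vg[OF z]] by (simp add: \<omega>_def)
    next
      case False
      then have "wd (\<omega> i z) (\<omega> n z) \<noteq> 0" using wd_n z i by simp
      then show ?thesis by (auto simp: wd_simps)
    qed
  next
    fix z v assume z: "z \<in> V"
    show "legendre (Suc n) u \<Omega> z v = 0 \<longleftrightarrow> (\<exists>i<Suc n. fst (\<omega> i z) * fst v + snd (\<omega> i z) * snd v = 0)"
    proof (cases "v = 0")
      case True
      then show ?thesis by (auto simp: legendre_at_0)
    next
      case False
      have d: "dotp (\<omega> i z) v = 0 \<longleftrightarrow> (Pc z - s i z) * dotp (\<psi> z) v = Qc z * dotp (\<phi> z) v" if "i < n" for i
        unfolding \<omega>i[OF that] by (simp add: dotp_def algebra_simps)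
      have "legendre (Suc n) u \<Omega> z v = 0 \<longleftrightarrow> dotp (\<omega> n z) v = 0 \<or> (\<exists>i<n. dotp (\<omega> i z) v = 0)"
        unfolding web_zero[OF Vg[OF z] False] roots[OF z] by (auto simp: d \<omega>_def[of n])
      also have "\<dots> \<longleftrightarrow> (\<exists>i<Suc n. dotp (\<omega> i z) v = 0)" by (auto simp: less_Suc_eq)
      finally show ?thesis by (simp add: dotp_def)
    qed
  qed
  then show ?thesis using z0V by blast
qed

lemma is_web: "is_web (Suc n) (legendre (Suc n) u \<Omega>)"
proof -
  have "generic \<subseteq> {z. \<exists>U \<omega>. z \<in> U \<and> superposition (Suc n) (legendre (Suc n) u \<Omega>) U \<omega>}"
    using superposition_generic by blast
  from closure_mono[OF this] show ?thesis using closure_generic by (auto simp: is_web_def)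
qed

end

theorem corollaryD:
  fixes d :: nat and u :: "complex ^ 3" and \<Omega> :: form3
  assumes "d \<ge> 2"
    and "prefoliation d u \<Omega>"
    and "homogeneous_prefoliation u \<Omega>"
    and "convex_prefoliation u \<Omega>"
  shows "is_web d (legendre d u \<Omega>) \<and> flat_web d (legendre d u \<Omega>)"
proof -
  obtain n where d: "d = Suc n" and n: "0 < n" using assms(1) by (cases d) auto
  have fol: "foliation n \<Omega>" and "u \<noteq> 0" using assms(2) by (simp_all add: prefoliation_def d)
  moreover have convex: "convex_foliation \<Omega>" and "invariant_line u \<Omega>"
    using assms(4) by (simp_all add: convex_prefoliation_def)
  ultimately obtain M a b \<epsilon> where "normal_chart M u \<Omega> n a b \<epsilon>"
    using normal_chart_exists[OF n] assms(3) by blast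
  then interpret normal_chart M u \<Omega> n a b \<epsilon> .
  interpret convex_chart M u \<Omega> n a b \<epsilon> by unfold_locales (rule convex)
  show ?thesis unfolding d using is_web flat ..
qed

end
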